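(* Suppose that $q\in\Omega_{\xi,\eta}^{a,b}$ is a global minimizer of $J$ on $\Omega_{\xi,\eta}^{a,b}$, and let $[a^\ast,b^\ast]\subset[a,b]$ be a proper subset, with $a^\ast<b^\ast$. Then, for $\mu=(q(a^\ast),\dot q(a^\ast))$ and $\nu=(q(b^\ast),\dot q(b^\ast))$ in $TQ$, the curve $q|_{[a^\ast,b^\ast]}$ is the unique (global) minimizer of $J$ on $\Omega_{\mu,\nu}^{a^\ast,b^\ast}$.
   Context: $Q$ is a complete connected Riemannian manifold, $\frac{D}{dt}$ is the covariant derivative along a curve for the Levi-Civita connection, and $V:Q\to\mathbb{R}$ is smooth and non-negative. For $a<b$ and $\xi=(q_a,v_a),\eta=(q_b,v_b)\in TQ$, $\Omega_{\xi,\eta}^{a,b}$ is the set of piecewise smooth $C^1$ curves $\gamma:[a,b]\to Q$ with $\gamma(a)=q_a$, $\dot\gamma(a)=v_a$, $\gamma(b)=q_b$, $\dot\gamma(b)=v_b$. On $\Omega_{\xi,\eta}^{a,b}$ the functional $J$ is $J(\gamma)=\int_a^b\big(\tfrac12\|\tfrac{D}{dt}\dot\gamma(t)\|^2+V(\gamma(t))\big)dt$ (the limits of integration always match the interval of the admissible set). A curve $\gamma\in\Omega_{\xi,\eta}^{a,b}$ is a global minimizer of $J$ on $\Omega_{\xi,\eta}^{a,b}$ if $J(\gamma)\le J(\tilde\gamma)$ for all $\tilde\gamma\in\Omega_{\xi,\eta}^{a,b}$. *)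

theory Defs
  imports "HOL-Analysis.Analysis"
begin

text \<open>
  This is applied only to sets \<open>S\<close> on which derivatives within \<open>S\<close> are unique: open
  subsets of a Euclidean space, and relatively open subsets of a nondegenerate interval, where
  the derivatives at an end point are one-sided. Continuity of all directional derivatives is
  continuity of the derivative because the domain is finite dimensional.
\<close>
primrec Ck_on :: "nat \<Rightarrow> 'a::euclidean_space set \<Rightarrow> ('a \<Rightarrow> 'b::real_normed_vector) \<Rightarrow> bool" where
  "Ck_on 0 S f \<longleftrightarrow> continuous_on S f"
| "Ck_on (Suc k) S f \<longleftrightarrow>
     f differentiable_on S \<and> (\<forall>v. Ck_on k S (\<lambda>x. frechet_derivative f (at x within S) v))"

definition smooth_on :: "'a::euclidean_space set \<Rightarrow> ('a \<Rightarrow> 'b::real_normed_vector) \<Rightarrow> bool" where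
  "smooth_on S f \<longleftrightarrow> (\<forall>k. Ck_on k S f)"

text \<open>
  The manifold is the whole of the topological space \<open>'q\<close>, modelled on \<open>'e\<close>. A chart is a
  domain together with a total function of which only the values on the domain matter.
  The atlas need not be maximal: all notions below depend only on the smooth structure.
\<close>
type_synonym ('q, 'e) chart = "'q set \<times> ('q \<Rightarrow> 'e)"

abbreviation chart_dom :: "('q, 'e) chart \<Rightarrow> 'q set" where
  "chart_dom c \<equiv> fst c"

abbreviation chart_map :: "('q, 'e) chart \<Rightarrow> 'q \<Rightarrow> 'e" where
  "chart_map c \<equiv> snd c"

definition chart_img :: "('q, 'e) chart \<Rightarrow> 'e set" where
  "chart_img c = chart_map c ` chart_dom c"

definition chart_inv :: "('q, 'e) chart \<Rightarrow> 'e \<Rightarrow> 'q" where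
  "chart_inv c = inv_into (chart_dom c) (chart_map c)"

definition transition :: "('q, 'e) chart \<Rightarrow> ('q, 'e) chart \<Rightarrow> 'e \<Rightarrow> 'e" where
  "transition c c' = chart_map c' \<circ> chart_inv c"

definition smooth_atlas ::
  "('q::{t2_space, second_countable_topology}, 'e::euclidean_space) chart set \<Rightarrow> bool" where
  "smooth_atlas A \<longleftrightarrow>
     (\<Union>c\<in>A. chart_dom c) = UNIV \<and>
     (\<forall>c\<in>A. open (chart_dom c) \<and> open (chart_img c) \<and>
        homeomorphism (chart_dom c) (chart_img c) (chart_map c) (chart_inv c)) \<and>
     (\<forall>c\<in>A. \<forall>c'\<in>A. smooth_on (chart_map c ` (chart_dom c \<inter> chart_dom c')) (transition c c'))"

definition smooth_function ::
  "('q, 'e::euclidean_space) chart set \<Rightarrow> ('q \<Rightarrow> real) \<Rightarrow> bool" where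
  "smooth_function A V \<longleftrightarrow> (\<forall>c\<in>A. smooth_on (chart_img c) (V \<circ> chart_inv c))"

text \<open>
  A tangent vector at \<open>p\<close> is given by its coordinate vectors in all charts around \<open>p\<close>, which
  have to transform by the derivatives of the transition maps. The value is fixed to be \<open>0\<close> at
  all other arguments, so that equality of tangent vectors is equality of functions.
\<close>
type_synonym ('q, 'e) tangent = "('q, 'e) chart \<Rightarrow> 'e"

definition tangent_space ::
  "('q, 'e::euclidean_space) chart set \<Rightarrow> 'q \<Rightarrow> ('q, 'e) tangent set" where
  "tangent_space A p =
     {v. (\<forall>c. c \<notin> A \<or> p \<notin> chart_dom c \<longrightarrow> v c = 0) \<and>
         (\<forall>c\<in>A. \<forall>c'\<in>A. p \<in> chart_dom c \<and> p \<in> chart_dom c' \<longrightarrow>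
            v c' = frechet_derivative (transition c c') (at (chart_map c p)) (v c))}"

definition tangent_bundle ::
  "('q, 'e::euclidean_space) chart set \<Rightarrow> ('q \<times> ('q, 'e) tangent) set" where
  "tangent_bundle A = Sigma UNIV (tangent_space A)"

text \<open>The tangent vector at \<open>p\<close> whose coordinate vector in the chart \<open>c\<close> is \<open>u\<close>.\<close>
definition tangent_of ::
  "('q, 'e::euclidean_space) chart set \<Rightarrow> ('q, 'e) chart \<Rightarrow> 'q \<Rightarrow> 'e \<Rightarrow> ('q, 'e) tangent" where
  "tangent_of A c p u = (\<lambda>c'. if c' \<in> A \<and> p \<in> chart_dom c'
     then frechet_derivative (transition c c') (at (chart_map c p)) u else 0)"

type_synonym ('q, 'e) metric = "'q \<Rightarrow> ('q, 'e) tangent \<Rightarrow> ('q, 'e) tangent \<Rightarrow> real"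

text \<open>The metric in the coordinates of \<open>c\<close>, at the point with coordinates \<open>x\<close>.\<close>
definition metric_coord ::
  "('q, 'e::euclidean_space) chart set \<Rightarrow> ('q, 'e) metric \<Rightarrow> ('q, 'e) chart \<Rightarrow>
    'e \<Rightarrow> 'e \<Rightarrow> 'e \<Rightarrow> real" where
  "metric_coord A g c x u v =
     g (chart_inv c x) (tangent_of A c (chart_inv c x) u) (tangent_of A c (chart_inv c x) v)"

definition riemannian_metric ::
  "('q, 'e::euclidean_space) chart set \<Rightarrow> ('q, 'e) metric \<Rightarrow> bool" where
  "riemannian_metric A g \<longleftrightarrow>
     (\<forall>p. \<forall>u\<in>tangent_space A p. \<forall>v\<in>tangent_space A p.
        (\<forall>w\<in>tangent_space A p. g p (\<lambda>c. u c + v c) w = g p u w + g p v w) \<and>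
        (\<forall>r. g p (\<lambda>c. r *\<^sub>R u c) v = r * g p u v) \<and>
        g p u v = g p v u \<and>
        (u \<noteq> (\<lambda>c. 0) \<longrightarrow> g p u u > 0)) \<and>
     (\<forall>c\<in>A. \<forall>u v. smooth_on (chart_img c) (\<lambda>x. metric_coord A g c x u v))"

text \<open>
  Given the metric \<open>G\<close> at a point and its derivative \<open>D z\<close> in each direction \<open>z\<close>, both in
  the coordinates of a chart, \<open>\<Gamma>\<close> are the Christoffel symbols \<open>\<Gamma> u v = \<nabla>\<^sub>u v\<close> (constant
  coordinate vector fields) of a torsion-free metric connection.
\<close>
definition torsion_free_metric ::
  "('e::euclidean_space \<Rightarrow> 'e \<Rightarrow> real) \<Rightarrow> ('e \<Rightarrow> 'e \<Rightarrow> 'e \<Rightarrow> real) \<Rightarrow> ('e \<Rightarrow> 'e \<Rightarrow> 'e) \<Rightarrow> bool" where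
  "torsion_free_metric G D \<Gamma> \<longleftrightarrow>
     bilinear \<Gamma> \<and> (\<forall>u v. \<Gamma> u v = \<Gamma> v u) \<and>
     (\<forall>z u v. D z u v = G (\<Gamma> z u) v + G u (\<Gamma> z v))"

lemma torsion_free_metric_ex1:
  fixes G :: "'e::euclidean_space \<Rightarrow> 'e \<Rightarrow> real"
  assumes G: "bilinear G" and sym: "\<And>u v. G u v = G v u" and pos: "\<And>u. u \<noteq> 0 \<Longrightarrow> G u u > 0"
    and D1: "\<And>u v. linear (\<lambda>z. D z u v)" and D2: "\<And>z. bilinear (D z)"
    and Dsym: "\<And>z u v. D z u v = D z v u"
  shows "\<exists>!\<Gamma>. torsion_free_metric G D \<Gamma>"
proof -
  have lG: "linear (\<lambda>w. G w z)" "linear (G w)" for w z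
    using G by (auto simp: bilinear_def)
  have nondeg: "w = w'" if "\<And>z. G w z = G w' z" for w w'
  proof -
    have "G (w - w') (w - w') = 0"
      using that[of "w - w'"] linear_diff[OF lG(1)] by simp
    then show ?thesis using pos[of "w - w'"] by force
  qed
  have riesz: "\<exists>w. \<forall>z. G w z = f z" if f: "linear f" for f :: "'e \<Rightarrow> real"
  proof -
    define L where "L w = (\<Sum>b\<in>Basis. G w b *\<^sub>R b)" for w
    have G_L: "G w z = L w \<bullet> z" for w z
    proof -
      have "G w z = G w (\<Sum>b\<in>Basis. (z \<bullet> b) *\<^sub>R b)" by (simp add: euclidean_representation)
      also have "\<dots> = (\<Sum>b\<in>Basis. (z \<bullet> b) * G w b)"
        by (simp add: linear_sum[OF lG(2)] linear_cmul[OF lG(2)])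
      finally show ?thesis by (simp add: L_def inner_sum_left inner_sum_right inner_commute mult.commute)
    qed
    have "linear L"
      unfolding L_def
      by (rule linearI) (simp_all add: linear_add[OF lG(1)] linear_cmul[OF lG(1)] scaleR_add_left
        sum.distrib scaleR_sum_right)
    moreover have "inj L" by (intro injI nondeg) (simp add: G_L)
    ultimately have "surj L" by (rule linear_inj_imp_surj)
    then obtain w where w: "L w = (\<Sum>b\<in>Basis. f b *\<^sub>R b)" by (metis surjD)
    have "G w z = f z" for z
    proof -
      have "f z = f (\<Sum>b\<in>Basis. (z \<bullet> b) *\<^sub>R b)" by (simp add: euclidean_representation)
      also have "\<dots> = (\<Sum>b\<in>Basis. (z \<bullet> b) * f b)"
        by (simp add: linear_sum[OF f] linear_cmul[OF f])
      finally show ?thesis by (simp add: G_L w inner_sum_left inner_sum_right inner_commute mult.commute)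
    qed
    then show ?thesis by blast
  qed
  note lD = D1 conjunct1[OF D2[unfolded bilinear_def], rule_format]
    conjunct2[OF D2[unfolded bilinear_def], rule_format]
  note add = linear_add[OF lD(1)] linear_add[OF lD(2)] linear_add[OF lD(3)]
    linear_add[OF lG(1)] linear_add[OF lG(2)]
  note cmul = linear_cmul[OF lD(1)] linear_cmul[OF lD(2)] linear_cmul[OF lD(3)]
    linear_cmul[OF lG(1)] linear_cmul[OF lG(2)]
  define K where "K u v z = (D u v z + D v u z - D z u v) / 2" for u v z
  have "linear (K u v)" for u v
    by (rule linearI) (simp_all add: K_def add cmul field_simps)
  then have "\<forall>u v. \<exists>w. \<forall>z. G w z = K u v z" using riesz by blast
  then obtain \<Gamma> where \<Gamma>: "\<And>u v z. G (\<Gamma> u v) z = K u v z" by metis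
  show ?thesis
  proof (rule ex1I[of _ \<Gamma>])
    have "bilinear \<Gamma>"
      unfolding bilinear_def
      by (intro conjI allI linearI nondeg)
        (simp_all add: \<Gamma> add cmul, simp_all add: K_def add cmul field_simps)
    moreover have "\<Gamma> u v = \<Gamma> v u" for u v
      by (rule nondeg) (simp add: \<Gamma> K_def Dsym[of _ u v] add.commute)
    moreover have "D z u v = G (\<Gamma> z u) v + G u (\<Gamma> z v)" for z u v
      by (simp add: sym[of u] \<Gamma>) (simp add: K_def Dsym[of _ v] Dsym[of _ u z] field_simps)
    ultimately show "torsion_free_metric G D \<Gamma>"
      by (simp add: torsion_free_metric_def)
  next
    fix \<Gamma>' assume "torsion_free_metric G D \<Gamma>'"
    then have s: "\<And>u v. \<Gamma>' u v = \<Gamma>' v u"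
      and c: "\<And>z u v. D z u v = G (\<Gamma>' z u) v + G u (\<Gamma>' z v)"
      by (auto simp: torsion_free_metric_def)
    have "G (\<Gamma>' u v) z = K u v z" for u v z
      by (simp add: K_def c[of u v z] c[of v u z] c[of z u v] s[of v u] s[of z u] s[of z v]
        sym[of v "\<Gamma>' u z"])
    then have "\<Gamma>' u v = \<Gamma> u v" for u v by (intro nondeg) (simp add: \<Gamma>)
    then show "\<Gamma>' = \<Gamma>" by blast
  qed
qed

definition christoffel ::
  "('q, 'e::euclidean_space) chart set \<Rightarrow> ('q, 'e) metric \<Rightarrow> ('q, 'e) chart \<Rightarrow>
    'e \<Rightarrow> 'e \<Rightarrow> 'e \<Rightarrow> 'e" where
  "christoffel A g c x = (THE \<Gamma>. torsion_free_metric (metric_coord A g c x)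
     (\<lambda>z u v. frechet_derivative (\<lambda>y. metric_coord A g c y u v) (at x) z) \<Gamma>)"

definition Ck_curve ::
  "('q::topological_space, 'e::euclidean_space) chart set \<Rightarrow> nat \<Rightarrow> real set \<Rightarrow> (real \<Rightarrow> 'q) \<Rightarrow> bool" where
  "Ck_curve A k I \<gamma> \<longleftrightarrow>
     continuous_on I \<gamma> \<and>
     (\<forall>c\<in>A. Ck_on k {t \<in> I. \<gamma> t \<in> chart_dom c} (chart_map c \<circ> \<gamma>))"

definition smooth_curve ::
  "('q::topological_space, 'e::euclidean_space) chart set \<Rightarrow> real set \<Rightarrow> (real \<Rightarrow> 'q) \<Rightarrow> bool" where
  "smooth_curve A I \<gamma> \<longleftrightarrow> (\<forall>k. Ck_curve A k I \<gamma>)"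

definition piecewise_smooth_C1_curve ::
  "('q::topological_space, 'e::euclidean_space) chart set \<Rightarrow> real \<Rightarrow> real \<Rightarrow> (real \<Rightarrow> 'q) \<Rightarrow> bool" where
  "piecewise_smooth_C1_curve A a b \<gamma> \<longleftrightarrow>
     Ck_curve A 1 {a..b} \<gamma> \<and>
     (\<exists>(n::nat) \<tau>. \<tau> 0 = a \<and> \<tau> n = b \<and>
        (\<forall>i<n. \<tau> i < \<tau> (Suc i) \<and> smooth_curve A {\<tau> i..\<tau> (Suc i)} \<gamma>))"

text \<open>
  Derivatives are taken within the parameter interval \<open>I\<close>, hence are one-sided at its end points.
\<close>
definition velocity ::
  "('q, 'e::euclidean_space) chart set \<Rightarrow> real set \<Rightarrow> (real \<Rightarrow> 'q) \<Rightarrow> real \<Rightarrow> ('q, 'e) tangent" where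
  "velocity A I \<gamma> t = (\<lambda>c. if c \<in> A \<and> \<gamma> t \<in> chart_dom c
     then vector_derivative (chart_map c \<circ> \<gamma>) (at t within I) else 0)"

definition covariant_derivative ::
  "('q, 'e::euclidean_space) chart set \<Rightarrow> ('q, 'e) metric \<Rightarrow> real set \<Rightarrow> (real \<Rightarrow> 'q) \<Rightarrow>
    (real \<Rightarrow> ('q, 'e) tangent) \<Rightarrow> real \<Rightarrow> ('q, 'e) tangent" where
  "covariant_derivative A g I \<gamma> X t = (\<lambda>c. if c \<in> A \<and> \<gamma> t \<in> chart_dom c
     then vector_derivative (\<lambda>s. X s c) (at t within I)
        + christoffel A g c (chart_map c (\<gamma> t)) (velocity A I \<gamma> t c) (X t c)
     else 0)"

definition acceleration ::
  "('q, 'e::euclidean_space) chart set \<Rightarrow> ('q, 'e) metric \<Rightarrow> real set \<Rightarrow> (real \<Rightarrow> 'q) \<Rightarrow>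
    real \<Rightarrow> ('q, 'e) tangent" where
  "acceleration A g I \<gamma> = covariant_derivative A g I \<gamma> (velocity A I \<gamma>)"

definition geodesically_complete ::
  "('q::topological_space, 'e::euclidean_space) chart set \<Rightarrow> ('q, 'e) metric \<Rightarrow> bool" where
  "geodesically_complete A g \<longleftrightarrow>
     (\<forall>(p, v)\<in>tangent_bundle A. \<exists>\<gamma>. smooth_curve A UNIV \<gamma> \<and>
        \<gamma> 0 = p \<and> velocity A UNIV \<gamma> 0 = v \<and> (\<forall>t. acceleration A g UNIV \<gamma> t = (\<lambda>c. 0)))"

text \<open>
  Curves on \<open>[a, b]\<close> are functions that are \<open>undefined\<close> outside \<open>[a, b]\<close>, so that equality of
  curves is equality of functions and \<open>restrict\<close> is the restriction to a subinterval.
\<close>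
definition admissible_curves ::
  "('q::topological_space, 'e::euclidean_space) chart set \<Rightarrow> real \<Rightarrow> real \<Rightarrow>
    'q \<times> ('q, 'e) tangent \<Rightarrow> 'q \<times> ('q, 'e) tangent \<Rightarrow> (real \<Rightarrow> 'q) set" where
  "admissible_curves A a b \<xi> \<eta> =
     {\<gamma> \<in> extensional {a..b}. piecewise_smooth_C1_curve A a b \<gamma> \<and>
        (\<gamma> a, velocity A {a..b} \<gamma> a) = \<xi> \<and> (\<gamma> b, velocity A {a..b} \<gamma> b) = \<eta>}"

text \<open>
  For a piecewise smooth \<open>C\<^sup>1\<close> curve the integrand is meaningful except at the finitely many
  break points, which do not affect the integral.
\<close>
definition J_functional ::
  "('q, 'e::euclidean_space) chart set \<Rightarrow> ('q, 'e) metric \<Rightarrow> ('q \<Rightarrow> real) \<Rightarrow> real \<Rightarrow> real \<Rightarrow>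
    (real \<Rightarrow> 'q) \<Rightarrow> real" where
  "J_functional A g V a b \<gamma> = integral {a..b} (\<lambda>t.
     1 / 2 * g (\<gamma> t) (acceleration A g {a..b} \<gamma> t) (acceleration A g {a..b} \<gamma> t) + V (\<gamma> t))"

definition global_minimizer ::
  "('q::topological_space, 'e::euclidean_space) chart set \<Rightarrow> ('q, 'e) metric \<Rightarrow> ('q \<Rightarrow> real) \<Rightarrow>
    real \<Rightarrow> real \<Rightarrow> 'q \<times> ('q, 'e) tangent \<Rightarrow> 'q \<times> ('q, 'e) tangent \<Rightarrow> (real \<Rightarrow> 'q) \<Rightarrow> bool" where
  "global_minimizer A g V a b \<xi> \<eta> \<gamma> \<longleftrightarrow>
     \<gamma> \<in> admissible_curves A a b \<xi> \<eta> \<and>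
     (\<forall>\<gamma>'\<in>admissible_curves A a b \<xi> \<eta>. J_functional A g V a b \<gamma> \<le> J_functional A g V a b \<gamma>')"

end

theory Submission
  imports Defs
begin

text \<open>
  The restriction of \<open>q\<close> is a minimizer because a competitor with the same end data can be spliced into
  \<open>q\<close>: the result is admissible on the whole interval, and the action is additive over adjacent
  intervals (\<open>admissible_splice\<close>, \<open>action_splice\<close>, \<open>minimizer_restrict\<close>).

  For uniqueness let \<open>r\<close> be another minimizer for the data induced by \<open>q\<close>. Spliced into \<open>q\<close> it gives a
  second minimizer on the whole interval. As the subinterval is proper, the two share a
  nondegenerate interval. So it is enough that two minimizers with the same end data which
  agree on a nondegenerate interval agree everywhere (\<open>minimizers_unique\<close>). Agreement is a closed
  condition, and the point is to continue it across a parameter \<open>T\<close> (\<open>minimizers_agree_beyond\<close>).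

  The continuation does not pass through the Euler-Lagrange equation, the regularity of minimizers
  at break points and uniqueness for fourth order differential equations, but compares actions
  directly (\<open>difference_vanishes\<close>). In a chart let \<open>x\<close>, \<open>y\<close> be the coordinates of the two minimizers and
  \<open>z = y - x\<close>, which vanishes on one side of \<open>T\<close>. On an interval \<open>D\<close> of length \<open>\<delta>\<close> on the other side
  subtract from \<open>z\<close> the affine function with the same value and derivative at the far end of \<open>D\<close>, and
  cut this function off where \<open>z = 0\<close>. The result \<open>\<phi>\<close> vanishes to first order at both ends, so
  \<open>x + \<phi>/2\<close> and \<open>y - \<phi>/2\<close> are competitors of \<open>x\<close> and \<open>y\<close>. On \<open>D\<close> both have second derivative
  \<open>(x'' + y'')/2\<close>. The Lagrangian is strongly convex in the second derivative, so the sum of the two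
  actions drops by a multiple of the integral of \<open>|z''|\<^sup>2\<close> over \<open>D\<close>, which is at least \<open>S\<^sup>2/\<delta>\<close>, where \<open>S\<close>
  is the integral of \<open>|z''|\<close>. All other changes are of order \<open>S\<^sup>2\<close>, because \<open>z\<close>, \<open>z'\<close>, \<open>\<phi>\<close> and
  \<open>\<phi>'\<close> are bounded by \<open>S\<close> on \<open>D\<close>. Both curves being minimal, \<open>S = 0\<close> for small \<open>\<delta>\<close>.

  Two facts about the geometry enter. The integrand of the action can be computed in any chart, as the
  covariant acceleration is a tangent vector (\<open>christoffel_transition\<close>, \<open>acceleration_tangent_of\<close>). And
  the Lagrangian in a chart has bounded second differences (\<open>lagr_sd_bounded\<close>); this class of functions
  is closed under sums, products and the solution of uniformly positive definite linear systems, hence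
  contains the Christoffel symbols (\<open>sd_bounded_solve\<close>).
\<close>

section \<open>Maps of class \<open>C\<^sup>k\<close>\<close>

text \<open>
  The coordinate directions accumulate at every point of \<open>S\<close>. This is the criterion that makes
  derivatives within \<open>S\<close> unique; open sets and nondegenerate intervals satisfy it, and, unlike
  uniqueness of derivatives, it does not quantify over the codomain.
\<close>
definition diff_dom :: "'a::euclidean_space set \<Rightarrow> bool" where
  "diff_dom S \<longleftrightarrow> (\<forall>x\<in>S. \<forall>i\<in>Basis. \<forall>e>0. \<exists>d. 0 < \<bar>d\<bar> \<and> \<bar>d\<bar> < e \<and> x + d *\<^sub>R i \<in> S)"

lemma diff_dom_open:
  assumes "open S" shows "diff_dom S"
  unfolding diff_dom_def
proof (intro ballI allI impI)
  fix x i :: 'a and e :: real assume x: "x \<in> S" "i \<in> Basis" "0 < e"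
  obtain r where r: "r > 0" "ball x r \<subseteq> S" using assms x by (meson openE)
  have "x + (min r e / 2) *\<^sub>R i \<in> ball x r" using x r by (auto simp: dist_norm)
  then show "\<exists>d. 0 < \<bar>d\<bar> \<and> \<bar>d\<bar> < e \<and> x + d *\<^sub>R i \<in> S"
    using x r by (intro exI[of _ "min r e / 2"]) auto
qed

lemma diff_dom_real:
  fixes S :: "real set"
  assumes "\<And>t. t \<in> S \<Longrightarrow> t islimpt S" shows "diff_dom S"
  unfolding diff_dom_def
proof (intro ballI allI impI)
  fix x i :: real and e :: real assume x: "x \<in> S" "i \<in> Basis" "0 < e"
  then obtain y where "y \<in> S" "y \<noteq> x" "\<bar>y - x\<bar> < e"
    using assms[of x] by (auto simp: islimpt_approachable dist_real_def)
  then show "\<exists>d. 0 < \<bar>d\<bar> \<and> \<bar>d\<bar> < e \<and> x + d *\<^sub>R i \<in> S"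
    using x by (intro exI[of _ "y - x"]) auto
qed

lemma diff_dom_unique:
  assumes "diff_dom S" "x \<in> S" "(f has_derivative f') (at x within S)"
    "(f has_derivative f'') (at x within S)"
  shows "f' = f''"
  by (rule frechet_derivative_unique_within[OF assms(3,4)]) (use assms(1,2) diff_dom_def in blast)

lemma Ck_on_cong:
  assumes "\<And>x. x \<in> S \<Longrightarrow> f x = g x" "Ck_on k S f"
  shows "Ck_on k S g"
  using assms
proof (induction k arbitrary: f g)
  case 0
  then show ?case by (simp add: continuous_on_eq)
next
  case (Suc k)
  have eq: "(f has_derivative F) (at x within S) \<longleftrightarrow> (g has_derivative F) (at x within S)" if "x \<in> S" for x F
    using Suc.prems(1) that by (metis has_derivative_transform)
  then have fr: "frechet_derivative f (at x within S) = frechet_derivative g (at x within S)" if "x \<in> S" for x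
    using that by (simp add: frechet_derivative_def)
  have "g differentiable_on S"
    using Suc.prems(2) eq by (simp add: differentiable_on_def differentiable_def)
  moreover have "Ck_on k S (\<lambda>x. frechet_derivative g (at x within S) v)" for v
    by (rule Suc.IH[of "\<lambda>x. frechet_derivative f (at x within S) v"]) (use fr Suc.prems(2) in auto)
  ultimately show ?case by simp
qed

text \<open>
  Uniqueness of derivatives allows any family of derivatives to take the place of
  \<open>frechet_derivative\<close>, so that the closure properties below follow from the rules of calculus
  by induction on \<open>k\<close>.
\<close>
lemma Ck_on_SucI:
  assumes "diff_dom S" "\<And>x. x \<in> S \<Longrightarrow> (f has_derivative F x) (at x within S)"
    "\<And>v. Ck_on k S (\<lambda>x. F x v)"
  shows "Ck_on (Suc k) S f"
proof -
  have "frechet_derivative f (at x within S) = F x" if "x \<in> S" for x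
    using assms(1,2) that diff_dom_unique frechet_derivative_works differentiable_def by metis
  then have "Ck_on k S (\<lambda>x. frechet_derivative f (at x within S) v)" for v
    by (intro Ck_on_cong[OF _ assms(3)[of v]]) simp
  then show ?thesis
    using assms(2) by (auto simp: differentiable_on_def differentiable_def)
qed

lemma Ck_on_SucE:
  assumes "Ck_on (Suc k) S f"
  obtains F where "\<And>x. x \<in> S \<Longrightarrow> (f has_derivative F x) (at x within S)"
    "\<And>v. Ck_on k S (\<lambda>x. F x v)"
  using assms that[of "\<lambda>x. frechet_derivative f (at x within S)"]
  by (auto simp: differentiable_on_def frechet_derivative_works)

lemma Ck_on_Suc_imp: "Ck_on (Suc k) S f \<Longrightarrow> Ck_on k S f"
proof (induction k arbitrary: f)
  case 0
  then show ?case by (simp add: differentiable_imp_continuous_on)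
next
  case (Suc k)
  then have "f differentiable_on S" "\<And>v. Ck_on (Suc k) S (\<lambda>x. frechet_derivative f (at x within S) v)"
    by simp_all
  then show ?case using Suc.IH by simp
qed

lemma Ck_on_mono: "Ck_on k S f \<Longrightarrow> j \<le> k \<Longrightarrow> Ck_on j S f"
  by (induction k) (use Ck_on_Suc_imp le_Suc_eq in blast)+

lemma Ck_on_continuous: "Ck_on k S f \<Longrightarrow> continuous_on S f"
  using Ck_on_mono[of k S f 0] by simp

lemma Ck_on_const:
  assumes "diff_dom S" shows "Ck_on k S (\<lambda>_. c)"
proof (induction k arbitrary: c)
  case (Suc k)
  show ?case by (rule Ck_on_SucI[OF assms has_derivative_const Suc])
qed simp

lemma Ck_on_bounded_linear:
  assumes S: "diff_dom S" and L: "bounded_linear L" and "Ck_on k S f"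
  shows "Ck_on k S (\<lambda>x. L (f x))"
  using assms(3)
proof (induction k arbitrary: f)
  case 0
  then show ?case using L by (simp add: bounded_linear.continuous_on)
next
  case (Suc k)
  from Suc.prems obtain F where F: "\<And>x. x \<in> S \<Longrightarrow> (f has_derivative F x) (at x within S)"
    "\<And>v. Ck_on k S (\<lambda>x. F x v)" by (rule Ck_on_SucE) blast
  show ?case
    by (rule Ck_on_SucI[OF S bounded_linear.has_derivative[OF L F(1)] Suc.IH[OF F(2)]])
qed

lemma Ck_on_linear:
  assumes S: "diff_dom S" and L: "bounded_linear L"
  shows "Ck_on k S L"
proof (cases k)
  case 0
  then show ?thesis using L by (simp add: linear_continuous_on)
next
  case (Suc j)
  show ?thesis
    unfolding Suc by (rule Ck_on_SucI[OF S bounded_linear_imp_has_derivative[OF L] Ck_on_const[OF S]])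
qed

lemma Ck_on_add:
  assumes S: "diff_dom S" and "Ck_on k S f" "Ck_on k S g"
  shows "Ck_on k S (\<lambda>x. f x + g x)"
  using assms(2,3)
proof (induction k arbitrary: f g)
  case 0
  then show ?case by (simp add: continuous_on_add)
next
  case (Suc k)
  from Suc.prems(1) obtain F where F: "\<And>x. x \<in> S \<Longrightarrow> (f has_derivative F x) (at x within S)"
    "\<And>v. Ck_on k S (\<lambda>x. F x v)" by (rule Ck_on_SucE) blast
  from Suc.prems(2) obtain G where G: "\<And>x. x \<in> S \<Longrightarrow> (g has_derivative G x) (at x within S)"
    "\<And>v. Ck_on k S (\<lambda>x. G x v)" by (rule Ck_on_SucE) blast
  show ?case
    by (rule Ck_on_SucI[OF S has_derivative_add[OF F(1) G(1)] Suc.IH[OF F(2) G(2)]])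
qed

lemma Ck_on_sum:
  assumes S: "diff_dom S" and "\<And>i. i \<in> I \<Longrightarrow> Ck_on k S (f i)"
  shows "Ck_on k S (\<lambda>x. \<Sum>i\<in>I. f i x)"
  using assms(2)
  by (induction I rule: infinite_finite_induct) (auto intro: Ck_on_const[OF S] Ck_on_add[OF S])

lemma Ck_on_bilinear:
  assumes S: "diff_dom S" and P: "bounded_bilinear B" and "Ck_on k S f" "Ck_on k S g"
  shows "Ck_on k S (\<lambda>x. B (f x) (g x))"
  using assms(3,4)
proof (induction k arbitrary: f g)
  case 0
  then show ?case using bounded_bilinear.continuous_on[OF P] by simp
next
  case (Suc k)
  from Suc.prems(1) obtain F where F: "\<And>x. x \<in> S \<Longrightarrow> (f has_derivative F x) (at x within S)"
    "\<And>v. Ck_on k S (\<lambda>x. F x v)" by (rule Ck_on_SucE) blast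
  from Suc.prems(2) obtain G where G: "\<And>x. x \<in> S \<Longrightarrow> (g has_derivative G x) (at x within S)"
    "\<And>v. Ck_on k S (\<lambda>x. G x v)" by (rule Ck_on_SucE) blast
  show ?case
  proof (rule Ck_on_SucI[OF S bounded_bilinear.FDERIV[OF P F(1) G(1)]])
    show "Ck_on k S (\<lambda>x. B (f x) (G x v) + B (F x v) (g x))" for v
      by (intro Ck_on_add[OF S] Suc.IH F G Suc.prems Ck_on_Suc_imp)
  qed
qed

lemma Ck_on_subset:
  assumes S: "diff_dom S'" and sub: "S' \<subseteq> S" and "Ck_on k S f"
  shows "Ck_on k S' f"
  using assms(3)
proof (induction k arbitrary: f)
  case 0
  then show ?case using sub by (simp add: continuous_on_subset)
next
  case (Suc k)
  from Suc.prems obtain F where F: "\<And>x. x \<in> S \<Longrightarrow> (f has_derivative F x) (at x within S)"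
    "\<And>v. Ck_on k S (\<lambda>x. F x v)" by (rule Ck_on_SucE) blast
  show ?case
  proof (rule Ck_on_SucI[OF S, where F = F])
    show "(f has_derivative F x) (at x within S')" if "x \<in> S'" for x
      using has_derivative_subset[OF F(1) sub] sub that by blast
    show "Ck_on k S' (\<lambda>x. F x v)" for v by (rule Suc.IH[OF F(2)])
  qed
qed

text \<open>
  By the chain rule the derivative of \<open>f \<circ> u\<close> in the direction \<open>v\<close> is a sum over the basis of
  products of a partial derivative of \<open>f\<close> along \<open>u\<close> with a coordinate of \<open>u' v\<close>; the induction
  hypothesis applies to the former.
\<close>
lemma Ck_on_compose:
  fixes f :: "'b::euclidean_space \<Rightarrow> 'c::real_normed_vector" and u :: "'a::euclidean_space \<Rightarrow> 'b"
  assumes S: "diff_dom S" and W: "open W" and "Ck_on k W f" "Ck_on k S u" and sub: "u ` S \<subseteq> W"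
  shows "Ck_on k S (\<lambda>x. f (u x))"
  using assms(3,4)
proof (induction k arbitrary: f)
  case 0
  then show ?case using sub by (simp add: continuous_on_compose2)
next
  case (Suc k)
  from Suc.prems(1) obtain F where F: "\<And>x. x \<in> W \<Longrightarrow> (f has_derivative F x) (at x within W)"
    "\<And>v. Ck_on k W (\<lambda>x. F x v)" by (rule Ck_on_SucE) blast
  from Suc.prems(2) obtain U where U: "\<And>x. x \<in> S \<Longrightarrow> (u has_derivative U x) (at x within S)"
    "\<And>v. Ck_on k S (\<lambda>x. U x v)" by (rule Ck_on_SucE) blast
  have d: "((\<lambda>x. f (u x)) has_derivative (\<lambda>v. \<Sum>b\<in>Basis. (U x v \<bullet> b) *\<^sub>R F (u x) b)) (at x within S)"
    if x: "x \<in> S" for x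
  proof -
    have Fx: "(f has_derivative F (u x)) (at (u x))"
      using F(1) x sub W at_within_open by (metis image_subset_iff)
    have comp: "((\<lambda>x. f (u x)) has_derivative (\<lambda>v. F (u x) (U x v))) (at x within S)"
      by (rule has_derivative_compose[OF U(1)[OF x] Fx])
    have eq: "F (u x) w = (\<Sum>b\<in>Basis. (w \<bullet> b) *\<^sub>R F (u x) b)" for w
    proof -
      have "linear (F (u x))" using Fx has_derivative_linear by blast
      then have "F (u x) (\<Sum>b\<in>Basis. (w \<bullet> b) *\<^sub>R b) = (\<Sum>b\<in>Basis. (w \<bullet> b) *\<^sub>R F (u x) b)"
        by (simp add: linear_sum linear_cmul)
      then show ?thesis by (simp add: euclidean_representation)
    qed
    show ?thesis
      by (rule has_derivative_eq_rhs[OF comp]) (rule ext, rule eq)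
  qed
  show ?case
  proof (rule Ck_on_SucI[OF S d])
    fix v
    have "Ck_on k S (\<lambda>x. U x v \<bullet> b)" for b
      by (rule Ck_on_bounded_linear[OF S bounded_linear_inner_left U(2)])
    moreover have "Ck_on k S (\<lambda>x. F (u x) b)" for b
      by (rule Suc.IH[OF F(2) Ck_on_Suc_imp[OF Suc.prems(2)]])
    ultimately show "Ck_on k S (\<lambda>x. \<Sum>b\<in>Basis. (U x v \<bullet> b) *\<^sub>R F (u x) b)"
      by (intro Ck_on_sum[OF S] Ck_on_bilinear[OF S bounded_bilinear_scaleR])
  qed
qed

lemma Ck_on_open_derivative:
  assumes "Ck_on (Suc k) S f" "open S"
  shows "\<And>x. x \<in> S \<Longrightarrow> (f has_derivative frechet_derivative f (at x)) (at x)"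
    "\<And>v. Ck_on k S (\<lambda>x. frechet_derivative f (at x) v)"
proof -
  show "(f has_derivative frechet_derivative f (at x)) (at x)" if "x \<in> S" for x
  proof -
    have "f differentiable (at x within S)"
      using assms(1) that by (simp add: differentiable_on_def)
    then show ?thesis
      unfolding at_within_open[OF that assms(2)] using frechet_derivative_works by blast
  qed
  show "Ck_on k S (\<lambda>x. frechet_derivative f (at x) v)" for v
  proof (rule Ck_on_cong[of S "\<lambda>x. frechet_derivative f (at x within S) v"])
    show "frechet_derivative f (at x within S) v = frechet_derivative f (at x) v" if "x \<in> S" for x
      unfolding at_within_open[OF that assms(2)] ..
  qed (use assms(1) in simp)
qed

lemma smooth_on_Ck: "smooth_on S f \<Longrightarrow> Ck_on k S f"
  by (simp add: smooth_on_def)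

lemma smooth_on_derivative:
  assumes "smooth_on S f" "open S"
  shows "smooth_on S (\<lambda>x. frechet_derivative f (at x) v)"
  using Ck_on_open_derivative(2)[OF smooth_on_Ck[OF assms(1)] assms(2)] by (simp add: smooth_on_def)

lemma smooth_on_has_derivative:
  assumes "smooth_on S f" "open S" "x \<in> S"
  shows "(f has_derivative frechet_derivative f (at x)) (at x)"
  using Ck_on_open_derivative(1)[OF smooth_on_Ck[OF assms(1), of 1, simplified One_nat_def] assms(2,3)] .

text \<open>
  For a real parameter the derivative in the direction \<open>r\<close> is \<open>r\<close> times the vector derivative,
  so it suffices to look at one function instead of a family.
\<close>
lemma Ck_on_real_Suc:
  fixes f :: "real \<Rightarrow> 'b::real_normed_vector"
  assumes S: "diff_dom S"
  shows "Ck_on (Suc k) S f \<longleftrightarrow> (\<exists>f'. (\<forall>t\<in>S. (f has_vector_derivative f' t) (at t within S)) \<and> Ck_on k S f')"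
proof
  assume "Ck_on (Suc k) S f"
  then obtain F where F: "\<And>x. x \<in> S \<Longrightarrow> (f has_derivative F x) (at x within S)"
    "\<And>v. Ck_on k S (\<lambda>x. F x v)" by (rule Ck_on_SucE) blast
  have "(f has_vector_derivative F t 1) (at t within S)" if "t \<in> S" for t
  proof -
    have "linear (F t)" using F(1)[OF that] has_derivative_linear by blast
    then have "F t = (\<lambda>x. x *\<^sub>R F t 1)"
      by (metis (no_types, opaque_lifting) linear_cmul mult.right_neutral real_scaleR_def)
    then show ?thesis using F(1)[OF that] by (simp add: has_vector_derivative_def)
  qed
  then show "\<exists>f'. (\<forall>t\<in>S. (f has_vector_derivative f' t) (at t within S)) \<and> Ck_on k S f'"
    using F(2)[of 1] by (intro exI[of _ "\<lambda>t. F t 1"]) auto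
next
  assume "\<exists>f'. (\<forall>t\<in>S. (f has_vector_derivative f' t) (at t within S)) \<and> Ck_on k S f'"
  then obtain f' where f': "\<And>t. t \<in> S \<Longrightarrow> (f has_vector_derivative f' t) (at t within S)" "Ck_on k S f'"
    by blast
  show "Ck_on (Suc k) S f"
    by (rule Ck_on_SucI[OF S f'(1)[unfolded has_vector_derivative_def]])
      (use Ck_on_bounded_linear[OF S bounded_linear_scaleR_right f'(2)] in auto)
qed

section \<open>Second differences and mixed second derivatives\<close>

lemma has_derivative_linearity:
  assumes "(f has_derivative f') F" shows "f' (r *\<^sub>R u) = r *\<^sub>R f' u" "f' (u + v) = f' u + f' v"
  using has_derivative_linear[OF assms] by (simp_all add: linear_cmul linear_add)

text \<open>
  Two applications of the mean value theorem, in the direction \<open>h\<close> to the difference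
  \<open>f (\<cdot> + k) - f\<close> and then in the direction \<open>k\<close> to the derivative along \<open>h\<close>. It serves both for
  the symmetry of second derivatives and for bounds on second differences.
\<close>
lemma second_difference_mean_value:
  fixes f :: "'a::euclidean_space \<Rightarrow> real"
  assumes S: "open S" and f: "Ck_on 2 S f"
    and sub: "\<And>s t. \<lbrakk>0 \<le> s; s \<le> 1; 0 \<le> t; t \<le> 1\<rbrakk> \<Longrightarrow> p + s *\<^sub>R h + t *\<^sub>R k \<in> S"
  obtains s t where "0 \<le> s" "s \<le> 1" "0 \<le> t" "t \<le> 1"
    "f (p + h + k) - f (p + h) - f (p + k) + f p =
     frechet_derivative (\<lambda>y. frechet_derivative f (at y) h) (at (p + s *\<^sub>R h + t *\<^sub>R k)) k"
proof -
  let ?D = "\<lambda>y. frechet_derivative f (at y) h"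
  have f2: "Ck_on (Suc 1) S f" using f by (simp add: numeral_2_eq_2)
  note Df = Ck_on_open_derivative(1)[OF f2 S]
  have "Ck_on (Suc 0) S ?D" using Ck_on_open_derivative(2)[OF f2 S] by simp
  note DD = Ck_on_open_derivative(1)[OF this S]
  have line: "((\<lambda>s. F (q + s *\<^sub>R w)) has_real_derivative F' w) (at s)"
    if "(F has_derivative F') (at (q + s *\<^sub>R w))" for F :: "'a \<Rightarrow> real" and F' q w s
  proof -
    have "((\<lambda>s. F (q + s *\<^sub>R w)) has_derivative (\<lambda>r. F' (r *\<^sub>R w))) (at s)"
      by (rule has_derivative_compose[where f = "\<lambda>s. q + s *\<^sub>R w" and g = F])
        (auto intro!: derivative_eq_intros that)
    then show ?thesis
      unfolding has_field_derivative_def has_derivative_linearity(1)[OF that]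
      by (rule has_derivative_eq_rhs) (simp add: fun_eq_iff)
  qed
  have "\<exists>z>0. z < 1 \<and> (f (p + 1 *\<^sub>R h + k) - f (p + 1 *\<^sub>R h)) - (f (p + 0 *\<^sub>R h + k) - f (p + 0 *\<^sub>R h))
      = (1 - 0) * (?D (p + z *\<^sub>R h + k) - ?D (p + z *\<^sub>R h))"
  proof (rule MVT2)
    fix s :: real assume s: "0 \<le> s" "s \<le> 1"
    have "((\<lambda>s. f (p + k + s *\<^sub>R h)) has_real_derivative ?D (p + k + s *\<^sub>R h)) (at s)"
      by (rule line[OF Df]) (use sub[of s 1] s in \<open>simp add: algebra_simps\<close>)
    moreover have "((\<lambda>s. f (p + s *\<^sub>R h)) has_real_derivative ?D (p + s *\<^sub>R h)) (at s)"
      by (rule line[OF Df]) (use sub[of s 0] s in \<open>simp add: algebra_simps\<close>)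
    ultimately show "((\<lambda>s. f (p + s *\<^sub>R h + k) - f (p + s *\<^sub>R h)) has_real_derivative
        ?D (p + s *\<^sub>R h + k) - ?D (p + s *\<^sub>R h)) (at s)"
      using DERIV_diff by (simp add: algebra_simps)
  qed simp
  then obtain s where s: "0 < s" "s < 1"
    and e1: "f (p + h + k) - f (p + h) - (f (p + k) - f p) = ?D (p + s *\<^sub>R h + k) - ?D (p + s *\<^sub>R h)"
    by auto
  have "\<exists>z>0. z < 1 \<and> ?D (p + s *\<^sub>R h + 1 *\<^sub>R k) - ?D (p + s *\<^sub>R h + 0 *\<^sub>R k)
      = (1 - 0) * frechet_derivative ?D (at (p + s *\<^sub>R h + z *\<^sub>R k)) k"
  proof (rule MVT2)
    fix t :: real assume t: "0 \<le> t" "t \<le> 1"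
    show "((\<lambda>t. ?D (p + s *\<^sub>R h + t *\<^sub>R k)) has_real_derivative
        frechet_derivative ?D (at (p + s *\<^sub>R h + t *\<^sub>R k)) k) (at t)"
      by (rule line[OF DD]) (use sub[of s t] s t in simp)
  qed simp
  then obtain t where t: "0 < t" "t < 1"
    and e2: "?D (p + s *\<^sub>R h + k) - ?D (p + s *\<^sub>R h) =
      frechet_derivative ?D (at (p + s *\<^sub>R h + t *\<^sub>R k)) k"
    by auto
  show ?thesis by (rule that[of s t]) (use s t e1 e2 in auto)
qed

lemma second_derivative_scale:
  fixes f :: "'a::euclidean_space \<Rightarrow> 'b::real_normed_vector"
  assumes S: "open S" and f: "Ck_on 2 S f" and y: "y \<in> S"
  shows "frechet_derivative (\<lambda>y. frechet_derivative f (at y) (r *\<^sub>R u)) (at y) (s *\<^sub>R v) =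
    (r * s) *\<^sub>R frechet_derivative (\<lambda>y. frechet_derivative f (at y) u) (at y) v"
proof -
  have f2: "Ck_on (Suc 1) S f" using f by (simp add: numeral_2_eq_2)
  note Df = Ck_on_open_derivative(1)[OF f2 S]
  have "Ck_on (Suc 0) S (\<lambda>y. frechet_derivative f (at y) u)" for u
    using Ck_on_open_derivative(2)[OF f2 S] by simp
  note DD = Ck_on_open_derivative(1)[OF this S]
  have "((\<lambda>y. r *\<^sub>R frechet_derivative f (at y) u) has_derivative
      (\<lambda>w. r *\<^sub>R frechet_derivative (\<lambda>y. frechet_derivative f (at y) u) (at y) w)) (at y)"
    by (rule has_derivative_scaleR_right[OF DD[OF y]])
  then have "((\<lambda>y. frechet_derivative f (at y) (r *\<^sub>R u)) has_derivative
      (\<lambda>w. r *\<^sub>R frechet_derivative (\<lambda>y. frechet_derivative f (at y) u) (at y) w)) (at y)"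
    by (rule has_derivative_transform_within_open[OF _ S y])
      (simp add: has_derivative_linearity(1)[OF Df])
  then show ?thesis
    by (simp add: frechet_derivative_at[symmetric] has_derivative_linearity(1)[OF DD[OF y]])
qed

text \<open>
  The second difference quotient over the parallelogram spanned by \<open>t u\<close> and \<open>t v\<close> is symmetric in
  \<open>u\<close> and \<open>v\<close>, and it tends to either mixed derivative.
\<close>
lemma second_derivative_symmetric_real:
  fixes f :: "'a::euclidean_space \<Rightarrow> real"
  assumes S: "open S" and f: "Ck_on 2 S f" and x: "x \<in> S"
  shows "frechet_derivative (\<lambda>y. frechet_derivative f (at y) u) (at x) v =
    frechet_derivative (\<lambda>y. frechet_derivative f (at y) v) (at x) u"
proof -
  define DD where "DD u v y = frechet_derivative (\<lambda>y. frechet_derivative f (at y) u) (at y) v" for u v y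
  have f2: "Ck_on (Suc (Suc 0)) S f" using f by (simp add: numeral_2_eq_2)
  have cont: "isCont (DD u v) x" for u v
    using Ck_on_open_derivative(2)[OF Ck_on_open_derivative(2)[OF f2 S] S, of u v] x S
    by (simp add: DD_def[abs_def] continuous_on_eq_continuous_at)
  (* The difference quotient is a mixed derivative at a point that tends to x. *)
  have approx: "\<exists>d>0. \<forall>t. 0 < t \<and> t < d \<longrightarrow>
      \<bar>(f (x + t *\<^sub>R u + t *\<^sub>R v) - f (x + t *\<^sub>R u) - f (x + t *\<^sub>R v) + f x) / t\<^sup>2 - DD u v x\<bar> < e"
    if e: "e > 0" for u v and e :: real
  proof -
    obtain r where r: "r > 0" "ball x r \<subseteq> S" using S x openE by blast
    obtain r' where r': "r' > 0" "\<And>y. dist y x < r' \<Longrightarrow> \<bar>DD u v y - DD u v x\<bar> < e"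
      using cont[of u v] e unfolding continuous_at_eps_delta by (auto simp: dist_real_def)
    define R where "R = min r r'"
    define d where "d = R / (norm u + norm v + 1)"
    have R: "R > 0" using r r' by (simp add: R_def)
    have nz: "norm u + norm v + 1 > 0" by (simp add: add_nonneg_pos)
    then have d: "d > 0" using R by (simp add: d_def)
    have "\<bar>(f (x + t *\<^sub>R u + t *\<^sub>R v) - f (x + t *\<^sub>R u) - f (x + t *\<^sub>R v) + f x) / t\<^sup>2 - DD u v x\<bar> < e"
      if t: "0 < t" "t < d" for t
    proof -
      have near: "dist (x + \<sigma> *\<^sub>R t *\<^sub>R u + \<tau> *\<^sub>R t *\<^sub>R v) x < R"
        if "0 \<le> \<sigma>" "\<sigma> \<le> 1" "0 \<le> \<tau>" "\<tau> \<le> 1" for \<sigma> \<tau>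
      proof -
        have "norm (\<sigma> *\<^sub>R t *\<^sub>R u + \<tau> *\<^sub>R t *\<^sub>R v) \<le> \<sigma> * (t * norm u) + \<tau> * (t * norm v)"
          using that t norm_triangle_ineq[of "\<sigma> *\<^sub>R t *\<^sub>R u" "\<tau> *\<^sub>R t *\<^sub>R v"] by simp
        also have "\<dots> \<le> t * norm u + t * norm v"
          using that t by (intro add_mono mult_left_le_one_le) auto
        also have "\<dots> < t * (norm u + norm v + 1)" using t by (simp add: algebra_simps)
        also have "\<dots> < R" using t nz by (simp add: d_def field_simps)
        finally show ?thesis by (simp add: dist_norm add.assoc)
      qed
      have inS: "x + \<sigma> *\<^sub>R t *\<^sub>R u + \<tau> *\<^sub>R t *\<^sub>R v \<in> S" if "0 \<le> \<sigma>" "\<sigma> \<le> 1" "0 \<le> \<tau>" "\<tau> \<le> 1" for \<sigma> \<tau>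
        using near[OF that] r(2) by (auto simp: R_def dist_commute)
      obtain \<sigma> \<tau> where st: "0 \<le> \<sigma>" "\<sigma> \<le> 1" "0 \<le> \<tau>" "\<tau> \<le> 1"
        and eq: "f (x + t *\<^sub>R u + t *\<^sub>R v) - f (x + t *\<^sub>R u) - f (x + t *\<^sub>R v) + f x =
          DD (t *\<^sub>R u) (t *\<^sub>R v) (x + \<sigma> *\<^sub>R t *\<^sub>R u + \<tau> *\<^sub>R t *\<^sub>R v)"
        unfolding DD_def by (rule second_difference_mean_value[OF S f inS])
      let ?y = "x + \<sigma> *\<^sub>R t *\<^sub>R u + \<tau> *\<^sub>R t *\<^sub>R v"
      have "?y \<in> S" using near[OF st] r(2) by (auto simp: R_def dist_commute)
      then have "DD (t *\<^sub>R u) (t *\<^sub>R v) ?y = t\<^sup>2 * DD u v ?y"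
        using second_derivative_scale[OF S f] by (simp add: DD_def power2_eq_square)
      then have "(f (x + t *\<^sub>R u + t *\<^sub>R v) - f (x + t *\<^sub>R u) - f (x + t *\<^sub>R v) + f x) / t\<^sup>2 = DD u v ?y"
        using eq t by simp
      then show ?thesis using r'(2)[of ?y] near[OF st] by (simp add: R_def)
    qed
    then show ?thesis using d by blast
  qed
  have "\<bar>DD u v x - DD v u x\<bar> < e" if e: "e > 0" for e
  proof -
    obtain d where d: "d > 0" "\<And>t. 0 < t \<Longrightarrow> t < d \<Longrightarrow>
      \<bar>(f (x + t *\<^sub>R u + t *\<^sub>R v) - f (x + t *\<^sub>R u) - f (x + t *\<^sub>R v) + f x) / t\<^sup>2 - DD u v x\<bar> < e/2"
      using approx[of "e/2" u v] e by auto
    obtain d' where d': "d' > 0" "\<And>t. 0 < t \<Longrightarrow> t < d' \<Longrightarrow>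
      \<bar>(f (x + t *\<^sub>R v + t *\<^sub>R u) - f (x + t *\<^sub>R v) - f (x + t *\<^sub>R u) + f x) / t\<^sup>2 - DD v u x\<bar> < e/2"
      using approx[of "e/2" v u] e by auto
    define t where "t = min d d' / 2"
    have t: "0 < t" "t < d" "t < d'" using d d' by (auto simp: t_def)
    have e: "f (x + t *\<^sub>R v + t *\<^sub>R u) - f (x + t *\<^sub>R v) - f (x + t *\<^sub>R u) + f x =
      f (x + t *\<^sub>R u + t *\<^sub>R v) - f (x + t *\<^sub>R u) - f (x + t *\<^sub>R v) + f x"
      by (simp add: add.assoc add.commute[of "t *\<^sub>R v"])
    show ?thesis using d(2)[OF t(1,2)] d'(2)[OF t(1,3), unfolded e] by linarith
  qed
  from this[of "\<bar>DD u v x - DD v u x\<bar>"] have "DD u v x = DD v u x" by fastforce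
  then show ?thesis by (simp add: DD_def)
qed

lemma second_derivative_symmetric:
  fixes f :: "'a::euclidean_space \<Rightarrow> 'b::euclidean_space"
  assumes S: "open S" and f: "Ck_on 2 S f" and x: "x \<in> S"
  shows "frechet_derivative (\<lambda>y. frechet_derivative f (at y) u) (at x) v =
    frechet_derivative (\<lambda>y. frechet_derivative f (at y) v) (at x) u"
proof (rule euclidean_eqI)
  fix b :: 'b assume "b \<in> Basis"
  have f2: "Ck_on (Suc 1) S f" using f by (simp add: numeral_2_eq_2)
  note Df = Ck_on_open_derivative(1)[OF f2 S]
  have "Ck_on (Suc 0) S (\<lambda>y. frechet_derivative f (at y) u)" for u
    using Ck_on_open_derivative(2)[OF f2 S] by simp
  note DD = Ck_on_open_derivative(1)[OF this S]
  have D1: "frechet_derivative (\<lambda>y. f y \<bullet> b) (at y) u = frechet_derivative f (at y) u \<bullet> b"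
    if "y \<in> S" for y u
    using frechet_derivative_at[OF has_derivative_inner_left[OF Df[OF that], of b]] by metis
  have "frechet_derivative (\<lambda>y. frechet_derivative (\<lambda>y. f y \<bullet> b) (at y) u) (at x) v =
      frechet_derivative (\<lambda>y. frechet_derivative f (at y) u) (at x) v \<bullet> b" for u v
  proof -
    have "((\<lambda>y. frechet_derivative (\<lambda>y. f y \<bullet> b) (at y) u) has_derivative
       (\<lambda>v. frechet_derivative (\<lambda>y. frechet_derivative f (at y) u) (at x) v \<bullet> b)) (at x)"
      by (rule has_derivative_transform_within_open[OF has_derivative_inner_left[OF DD[OF x]] S x])
        (simp add: D1)
    then show ?thesis using frechet_derivative_at by metis
  qed
  moreover have "Ck_on 2 S (\<lambda>y. f y \<bullet> b)"
    by (rule Ck_on_bounded_linear[OF diff_dom_open[OF S] bounded_linear_inner_left f])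
  from second_derivative_symmetric_real[OF S this x, of u v]
  have "frechet_derivative (\<lambda>y. frechet_derivative (\<lambda>y. f y \<bullet> b) (at y) u) (at x) v =
    frechet_derivative (\<lambda>y. frechet_derivative (\<lambda>y. f y \<bullet> b) (at y) v) (at x) u" .
  ultimately show "frechet_derivative (\<lambda>y. frechet_derivative f (at y) u) (at x) v \<bullet> b =
      frechet_derivative (\<lambda>y. frechet_derivative f (at y) v) (at x) u \<bullet> b"
    by simp
qed

section \<open>Curves in charts\<close>

text \<open>
  The parameters for which a curve stays in an open set form a relatively open set, so that
  derivatives within it are derivatives within the whole parameter interval.
\<close>
lemma at_within_preimage:
  assumes "continuous_on I \<gamma>" "open U" "t \<in> I" "\<gamma> t \<in> U"
  shows "at t within {s \<in> I. \<gamma> s \<in> U} = at t within I"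
proof -
  obtain O' where O': "open O'" "O' \<inter> I = \<gamma> -` U \<inter> I"
    using assms(1,2) unfolding continuous_on_open_invariant by blast
  show ?thesis
    by (rule at_within_nhd[of _ O']) (use O' assms in auto)
qed

lemma at_within_Icc_neq_bot:
  fixes t :: real
  assumes "s < e" "t \<in> {s..e}" shows "at t within {s..e} \<noteq> bot"
  using assms by (simp add: trivial_limit_within islimpt_Icc)

lemma diff_dom_preimage:
  fixes \<gamma> :: "real \<Rightarrow> 'q::topological_space"
  assumes "s < e" "continuous_on {s..e} \<gamma>" "open U"
  shows "diff_dom {t \<in> {s..e}. \<gamma> t \<in> U}"
proof (rule diff_dom_real)
  fix t assume t: "t \<in> {t \<in> {s..e}. \<gamma> t \<in> U}"
  then have "at t within {t \<in> {s..e}. \<gamma> t \<in> U} \<noteq> bot"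
    using at_within_preimage[OF assms(2,3), of t] at_within_Icc_neq_bot[OF assms(1), of t] by simp
  then show "t islimpt {t \<in> {s..e}. \<gamma> t \<in> U}" by (simp add: trivial_limit_within)
qed

lemma diff_dom_Icc: "s < e \<Longrightarrow> diff_dom {s..e::real}"
  by (rule diff_dom_real) (simp add: islimpt_Icc)

lemma vector_derivative_Icc:
  fixes t :: real
  assumes "s < e" "t \<in> {s..e}" "(f has_vector_derivative f') (at t within {s..e})"
  shows "vector_derivative f (at t within {s..e}) = f'"
  using vector_derivative_within[OF at_within_Icc_neq_bot] assms by blast

lemma has_vector_derivative_compose:
  assumes "(u has_vector_derivative u') (at t within I)" "(f has_derivative F) (at (u t))"
  shows "((\<lambda>s. f (u s)) has_vector_derivative F u') (at t within I)"
proof -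
  have "((\<lambda>s. f (u s)) has_derivative (\<lambda>r. F (r *\<^sub>R u'))) (at t within I)"
    using has_derivative_compose[OF assms(1)[unfolded has_vector_derivative_def] assms(2)] by simp
  then show ?thesis
    by (simp add: has_vector_derivative_def has_derivative_linearity(1)[OF assms(2)])
qed

lemma Ck_curve_subset:
  assumes "Ck_curve A k I \<gamma>" "{s..e} \<subseteq> I" "s < e" "\<And>c. c \<in> A \<Longrightarrow> open (chart_dom c)"
  shows "Ck_curve A k {s..e} \<gamma>"
proof -
  have c: "continuous_on {s..e} \<gamma>"
    using assms(1,2) by (auto simp: Ck_curve_def intro: continuous_on_subset)
  have "Ck_on k {t \<in> {s..e}. \<gamma> t \<in> chart_dom c} (chart_map c \<circ> \<gamma>)" if "c \<in> A" for c
    by (rule Ck_on_subset[OF diff_dom_preimage[OF assms(3) c assms(4)[OF that]],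
          where S = "{t \<in> I. \<gamma> t \<in> chart_dom c}"])
      (use assms(1,2) that in \<open>auto simp: Ck_curve_def\<close>)
  then show ?thesis using c by (simp add: Ck_curve_def)
qed

lemma Ck_curve_cong:
  assumes "\<And>t. t \<in> I \<Longrightarrow> \<gamma> t = \<gamma>' t" "Ck_curve A k I \<gamma>"
  shows "Ck_curve A k I \<gamma>'"
proof -
  have "continuous_on I \<gamma>'" using assms by (auto simp: Ck_curve_def intro: continuous_on_eq)
  moreover have "Ck_on k {t \<in> I. \<gamma>' t \<in> chart_dom c} (chart_map c \<circ> \<gamma>')" if "c \<in> A" for c
  proof -
    have eq: "{t \<in> I. \<gamma>' t \<in> chart_dom c} = {t \<in> I. \<gamma> t \<in> chart_dom c}" using assms(1) by auto
    show ?thesis unfolding eq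
      by (rule Ck_on_cong[of _ "chart_map c \<circ> \<gamma>"]) (use assms that in \<open>auto simp: Ck_curve_def\<close>)
  qed
  ultimately show ?thesis by (simp add: Ck_curve_def)
qed

lemma velocity_cong:
  fixes A :: "('q, 'e::euclidean_space) chart set"
  assumes "\<And>t. t \<in> I \<Longrightarrow> \<gamma> t = \<gamma>' t" "t \<in> I"
  shows "velocity A I \<gamma> t = velocity A I \<gamma>' t"
proof
  fix c :: "('q, 'e) chart"
  have "((chart_map c \<circ> \<gamma>) has_vector_derivative v) (at t within I) \<longleftrightarrow>
    ((chart_map c \<circ> \<gamma>') has_vector_derivative v) (at t within I)" for v
    using assms has_vector_derivative_transform[of t I "chart_map c \<circ> \<gamma>" "chart_map c \<circ> \<gamma>'" v]
      has_vector_derivative_transform[of t I "chart_map c \<circ> \<gamma>'" "chart_map c \<circ> \<gamma>" v]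
    by auto
  then show "velocity A I \<gamma> t c = velocity A I \<gamma>' t c"
    using assms by (simp add: velocity_def vector_derivative_def)
qed

text \<open>
  The definition of a \<open>C\<^sup>k\<close> curve differentiates within the set of parameters for which the curve
  stays in the chart, that of the velocity within the whole parameter interval; the two agree.
\<close>
lemma velocity_derivative:
  assumes C: "Ck_curve A (Suc k) {s..e} \<gamma>" and se: "s < e" and c: "c \<in> A" "open (chart_dom c)"
  shows "\<And>t. \<lbrakk>t \<in> {s..e}; \<gamma> t \<in> chart_dom c\<rbrakk> \<Longrightarrow>
      ((chart_map c \<circ> \<gamma>) has_vector_derivative velocity A {s..e} \<gamma> t c) (at t within {s..e})"
    "Ck_on k {t \<in> {s..e}. \<gamma> t \<in> chart_dom c} (\<lambda>t. velocity A {s..e} \<gamma> t c)"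
proof -
  let ?S = "{t \<in> {s..e}. \<gamma> t \<in> chart_dom c}"
  have cont: "continuous_on {s..e} \<gamma>" using C by (simp add: Ck_curve_def)
  note S = diff_dom_preimage[OF se cont c(2)]
  have "Ck_on (Suc k) ?S (chart_map c \<circ> \<gamma>)" using C c by (simp add: Ck_curve_def)
  then obtain f' where f': "\<And>t. t \<in> ?S \<Longrightarrow> ((chart_map c \<circ> \<gamma>) has_vector_derivative f' t) (at t within ?S)"
    "Ck_on k ?S f'"
    unfolding Ck_on_real_Suc[OF S] by blast
  have d: "((chart_map c \<circ> \<gamma>) has_vector_derivative f' t) (at t within {s..e})"
    if "t \<in> {s..e}" "\<gamma> t \<in> chart_dom c" for t
    using f'(1)[of t] that at_within_preimage[OF cont c(2) that] by simp
  have v: "velocity A {s..e} \<gamma> t c = f' t" if "t \<in> {s..e}" "\<gamma> t \<in> chart_dom c" for t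
    using vector_derivative_Icc[OF se that(1) d[OF that]] that c by (simp add: velocity_def)
  show "\<And>t. \<lbrakk>t \<in> {s..e}; \<gamma> t \<in> chart_dom c\<rbrakk> \<Longrightarrow>
      ((chart_map c \<circ> \<gamma>) has_vector_derivative velocity A {s..e} \<gamma> t c) (at t within {s..e})"
    using d v by simp
  show "Ck_on k ?S (\<lambda>t. velocity A {s..e} \<gamma> t c)"
    by (rule Ck_on_cong[OF _ f'(2)]) (simp add: v)
qed

lemma velocity_subset:
  assumes C: "Ck_curve A 1 {a..b} \<gamma>" and sub: "{s..e} \<subseteq> {a..b}" and se: "s < e" and t: "t \<in> {s..e}"
    and op: "\<And>c. c \<in> A \<Longrightarrow> open (chart_dom c)"
  shows "velocity A {s..e} \<gamma> t = velocity A {a..b} \<gamma> t"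
proof
  fix c
  have ab: "a < b" using sub se by auto
  show "velocity A {s..e} \<gamma> t c = velocity A {a..b} \<gamma> t c"
  proof (cases "c \<in> A \<and> \<gamma> t \<in> chart_dom c")
    case True
    have C1: "Ck_curve A (Suc 0) {a..b} \<gamma>" using C by simp
    have "((chart_map c \<circ> \<gamma>) has_vector_derivative velocity A {a..b} \<gamma> t c) (at t within {a..b})"
      using velocity_derivative(1)[OF C1 ab] True op t sub by blast
    then have "((chart_map c \<circ> \<gamma>) has_vector_derivative velocity A {a..b} \<gamma> t c) (at t within {s..e})"
      using sub has_vector_derivative_within_subset by blast
    then show ?thesis
      using vector_derivative_Icc[OF se t] True by (simp add: velocity_def)
  qed (auto simp: velocity_def)
qed

lemma has_vector_derivative_outside_Icc:
  fixes t :: real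
  assumes "l < m" "t \<notin> {l..m}" shows "(f has_vector_derivative d) (at t within {l..m})"
proof -
  have "at t within {l..m} = bot" using assms by (simp add: trivial_limit_within islimpt_Icc)
  then show ?thesis by (simp add: has_vector_derivative_def has_derivative_def bounded_linear_scaleR_left)
qed

lemma has_vector_derivative_Un:
  "\<lbrakk>(f has_vector_derivative d) (at t within S); (f has_vector_derivative d) (at t within S')\<rbrakk> \<Longrightarrow>
    (f has_vector_derivative d) (at t within (S \<union> S'))"
  by (simp add: has_vector_derivative_def has_derivative_within Lim_within_Un)

text \<open>
  Since the two velocities agree at \<open>m\<close>, the one-sided derivatives there are both equal to the
  derivative on the union, and the velocities join to a continuous function.
\<close>
lemma Ck_curve_glue:
  assumes am: "a < m" and mb: "m < b"
    and C1: "Ck_curve A 1 {a..m} \<gamma>" and C2: "Ck_curve A 1 {m..b} \<gamma>"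
    and v: "velocity A {a..m} \<gamma> m = velocity A {m..b} \<gamma> m"
    and op: "\<And>c. c \<in> A \<Longrightarrow> open (chart_dom c)"
  shows "Ck_curve A 1 {a..b} \<gamma>"
proof -
  have ab: "{a..b} = {a..m} \<union> {m..b}" using am mb by auto
  have cont: "continuous_on {a..b} \<gamma>"
    using C1 C2 unfolding ab by (intro continuous_on_closed_Un) (auto simp: Ck_curve_def)
  have "Ck_on (Suc 0) {t \<in> {a..b}. \<gamma> t \<in> chart_dom c} (chart_map c \<circ> \<gamma>)" if c: "c \<in> A" for c
  proof -
    let ?S = "{t \<in> {a..b}. \<gamma> t \<in> chart_dom c}"
    let ?S1 = "{t \<in> {a..m}. \<gamma> t \<in> chart_dom c}" and ?S2 = "{t \<in> {m..b}. \<gamma> t \<in> chart_dom c}"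
    let ?v1 = "\<lambda>t. velocity A {a..m} \<gamma> t c" and ?v2 = "\<lambda>t. velocity A {m..b} \<gamma> t c"
    let ?f = "chart_map c \<circ> \<gamma>"
    have SU: "?S = ?S1 \<union> ?S2" using am mb by auto
    note d1 = velocity_derivative[OF C1[unfolded One_nat_def] am c op[OF c]]
    note d2 = velocity_derivative[OF C2[unfolded One_nat_def] mb c op[OF c]]
    (* Both velocities are defined at m, where they agree. *)
    define v where "v t = (if t \<le> m then ?v1 t else ?v2 t)" for t
    have vm: "?v1 m = ?v2 m" using v by simp
    have v1: "v t = ?v1 t" if "t \<in> {a..m}" for t using that by (simp add: v_def)
    have v2: "v t = ?v2 t" if "t \<in> {m..b}" for t using that vm by (cases "t = m") (auto simp: v_def)
    have contv: "continuous_on ?S v"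
    proof -
      have S12: "?S1 = ?S \<inter> {a..m}" "?S2 = ?S \<inter> {m..b}" using am mb by auto
      have "closedin (top_of_set ?S) ?S1" "closedin (top_of_set ?S) ?S2"
        unfolding S12 by (rule closedin_closed_Int; simp)+
      moreover have "continuous_on ?S1 v"
        by (rule continuous_on_eq[of _ ?v1]) (use d1(2) v1 in auto)
      moreover have "continuous_on ?S2 v"
        by (rule continuous_on_eq[of _ ?v2]) (use d2(2) v2 in auto)
      ultimately show ?thesis
        using continuous_on_Un_local[of ?S1 ?S2 v] unfolding SU by simp
    qed
    have "(?f has_vector_derivative v t) (at t within {a..b})" if t: "t \<in> ?S" for t
    proof -
      have "(?f has_vector_derivative v t) (at t within {a..m})"
        using d1(1)[of t] v1[of t] t has_vector_derivative_outside_Icc[OF am, of t]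
        by (cases "t \<in> {a..m}") auto
      moreover have "(?f has_vector_derivative v t) (at t within {m..b})"
        using d2(1)[of t] v2[of t] t has_vector_derivative_outside_Icc[OF mb, of t]
        by (cases "t \<in> {m..b}") auto
      ultimately show ?thesis unfolding ab by (rule has_vector_derivative_Un)
    qed
    then have "\<forall>t\<in>?S. (?f has_vector_derivative v t) (at t within ?S)"
      using has_vector_derivative_within_subset by (metis (no_types, lifting) mem_Collect_eq subsetI)
    then show ?thesis
      unfolding Ck_on_real_Suc[OF diff_dom_preimage[OF less_trans[OF am mb] cont op[OF c]]]
      using contv by auto
  qed
  then show ?thesis using cont by (simp add: Ck_curve_def)
qed

locale chart_atlas =
  fixes A :: "('q::{t2_space, second_countable_topology}, 'e::euclidean_space) chart set"
  assumes atlas: "smooth_atlas A"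
begin

lemma dom_open: "c \<in> A \<Longrightarrow> open (chart_dom c)"
  and img_open: "c \<in> A \<Longrightarrow> open (chart_img c)"
  and chart_homeo: "c \<in> A \<Longrightarrow> homeomorphism (chart_dom c) (chart_img c) (chart_map c) (chart_inv c)"
  and dom_cover: "\<exists>c\<in>A. p \<in> chart_dom c"
  and transition_smooth: "\<lbrakk>c \<in> A; c' \<in> A\<rbrakk> \<Longrightarrow>
    smooth_on (chart_map c ` (chart_dom c \<inter> chart_dom c')) (transition c c')"
  using atlas by (auto simp: smooth_atlas_def)

lemma chart_inv_map: "\<lbrakk>c \<in> A; p \<in> chart_dom c\<rbrakk> \<Longrightarrow> chart_inv c (chart_map c p) = p"
    and chart_map_img: "p \<in> chart_dom c \<Longrightarrow> chart_map c p \<in> chart_img c"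
  and chart_map_cont: "c \<in> A \<Longrightarrow> continuous_on (chart_dom c) (chart_map c)"
  and chart_inv_cont: "c \<in> A \<Longrightarrow> continuous_on (chart_img c) (chart_inv c)"
  using chart_homeo[of c] by (simp_all add: homeomorphism_def chart_img_def)

lemma chart_inv_dom: "\<lbrakk>c \<in> A; y \<in> chart_img c\<rbrakk> \<Longrightarrow> chart_inv c y \<in> chart_dom c"
  using chart_homeo[of c] by (auto simp del: split_paired_All split_paired_Ex simp: homeomorphism_def)

lemma chart_map_inv: "\<lbrakk>c \<in> A; y \<in> chart_img c\<rbrakk> \<Longrightarrow> chart_map c (chart_inv c y) = y"
  using chart_homeo[of c] unfolding homeomorphism_def by blast

text \<open>
  The coordinates in \<open>c\<close> of the points that also lie in the chart \<open>c'\<close>: the domain on which the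
  transition map is smooth.
\<close>
definition overlap :: "('q, 'e) chart \<Rightarrow> ('q, 'e) chart \<Rightarrow> 'e set" where "overlap c c' = chart_map c ` (chart_dom c \<inter> chart_dom c')"

lemma overlap_iff: "c \<in> A \<Longrightarrow> y \<in> overlap c c' \<longleftrightarrow> y \<in> chart_img c \<and> chart_inv c y \<in> chart_dom c'"
proof -
  assume c: "c \<in> A"
  have "y \<in> chart_img c \<and> chart_inv c y \<in> chart_dom c'" if "y \<in> overlap c c'"
    using that chart_inv_map[OF c] unfolding overlap_def chart_img_def by force
  moreover have "y \<in> overlap c c'" if "y \<in> chart_img c \<and> chart_inv c y \<in> chart_dom c'"
    unfolding overlap_def
    by (rule image_eqI[of _ _ "chart_inv c y"]) (use that chart_map_inv[OF c] chart_inv_dom[OF c] in auto)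
  ultimately show "y \<in> overlap c c' \<longleftrightarrow> y \<in> chart_img c \<and> chart_inv c y \<in> chart_dom c'" by blast
qed

lemma overlap_open: assumes "c \<in> A" "c' \<in> A" shows "open (overlap c c')"
proof -
  have "overlap c c' = chart_img c \<inter> chart_inv c -` chart_dom c'"
    using overlap_iff[OF assms(1), of _ c'] by blast
  then show ?thesis
    using continuous_open_preimage[OF chart_inv_cont img_open dom_open] assms by metis
qed

lemma transition_derivative:
  assumes "c \<in> A" "c' \<in> A" "y \<in> overlap c c'"
  shows "(transition c c' has_derivative frechet_derivative (transition c c') (at y)) (at y)"
  using smooth_on_has_derivative transition_smooth overlap_open assms unfolding overlap_def by blast

lemma transition_Ck: "\<lbrakk>c \<in> A; c' \<in> A\<rbrakk> \<Longrightarrow> Ck_on k (overlap c c') (transition c c')"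
  using transition_smooth smooth_on_Ck unfolding overlap_def by blast

abbreviation Dtrans where "Dtrans c c' y \<equiv> frechet_derivative (transition c c') (at y)"

lemma map_overlap: "\<lbrakk>p \<in> chart_dom c; p \<in> chart_dom c'\<rbrakk> \<Longrightarrow> chart_map c p \<in> overlap c c'"
  by (simp add: overlap_def)

lemma transition_map: "\<lbrakk>c \<in> A; p \<in> chart_dom c\<rbrakk> \<Longrightarrow> transition c c' (chart_map c p) = chart_map c' p"
  by (simp add: transition_def chart_inv_map)

lemma Dtrans_linear: "\<lbrakk>c \<in> A; c' \<in> A; p \<in> chart_dom c; p \<in> chart_dom c'\<rbrakk> \<Longrightarrow>
    linear (Dtrans c c' (chart_map c p))"
  using transition_derivative[OF _ _ map_overlap] has_derivative_linear by blast

text \<open>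
  The chain rule for the composition of two transition maps, which is a transition map itself.
\<close>
lemma Dtrans_cocycle:
  assumes c: "c \<in> A" "c' \<in> A" "c'' \<in> A"
    and p: "p \<in> chart_dom c" "p \<in> chart_dom c'" "p \<in> chart_dom c''"
  shows "Dtrans c c'' (chart_map c p) u = Dtrans c' c'' (chart_map c' p) (Dtrans c c' (chart_map c p) u)"
proof -
  let ?y = "chart_map c p"
  have "((\<lambda>y. transition c' c'' (transition c c' y)) has_derivative
      (\<lambda>u. Dtrans c' c'' (chart_map c' p) (Dtrans c c' ?y u))) (at ?y)"
    using has_derivative_compose[OF transition_derivative[OF c(1,2) map_overlap[OF p(1,2)]]]
      transition_derivative[OF c(2,3) map_overlap[OF p(2,3)]] transition_map[OF c(1) p(1), of c'] by simp
  then have "(transition c c'' has_derivative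
      (\<lambda>u. Dtrans c' c'' (chart_map c' p) (Dtrans c c' ?y u))) (at ?y)"
  proof (rule has_derivative_transform_within_open)
    show "open (overlap c c')" by (rule overlap_open[OF c(1,2)])
    show "?y \<in> overlap c c'" by (rule map_overlap[OF p(1,2)])
    show "transition c' c'' (transition c c' y) = transition c c'' y" if "y \<in> overlap c c'" for y
      using that overlap_iff[OF c(1), of y c'] c by (simp add: transition_def chart_inv_map)
  qed
  from fun_cong[OF frechet_derivative_at[OF this], of u] show ?thesis by (rule sym)
qed

lemma Dtrans_id:
  assumes c: "c \<in> A" and p: "p \<in> chart_dom c"
  shows "Dtrans c c (chart_map c p) u = u"
proof -
  have "(transition c c has_derivative (\<lambda>u. u)) (at (chart_map c p))"
    by (rule has_derivative_transform_within_open[OF has_derivative_ident img_open[OF c] chart_map_img[OF p]])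
      (simp add: transition_def chart_map_inv c)
  from fun_cong[OF frechet_derivative_at[OF this], of u] show ?thesis by (rule sym)
qed

text \<open>
  A tangent vector may be described in any chart around its base point. This and
  \<open>tangent_of_in\<close> are the cocycle identity of the derivatives of the transition maps.
\<close>
lemma tangent_of_Dtrans:
  assumes c: "c \<in> A" "c' \<in> A" and p: "p \<in> chart_dom c" "p \<in> chart_dom c'"
  shows "tangent_of A c p u = tangent_of A c' p (Dtrans c c' (chart_map c p) u)"
proof
  fix c''
  show "tangent_of A c p u c'' = tangent_of A c' p (Dtrans c c' (chart_map c p) u) c''"
    unfolding tangent_of_def using Dtrans_cocycle[OF c, of c'' p u] p by (rule_tac if_cong) blast+
qed

lemma tangent_of_in:
  assumes c: "c \<in> A" and p: "p \<in> chart_dom c"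
  shows "tangent_of A c p u \<in> tangent_space A p"
  unfolding tangent_space_def
proof (intro CollectI conjI allI ballI impI)
  show "tangent_of A c p u c' = 0" if "c' \<notin> A \<or> p \<notin> chart_dom c'" for c'
    using that by (auto simp: tangent_of_def)
  show "tangent_of A c p u c'' = Dtrans c' c'' (chart_map c' p) (tangent_of A c p u c')"
    if "c' \<in> A" "c'' \<in> A" "p \<in> chart_dom c' \<and> p \<in> chart_dom c''" for c' c''
    using that Dtrans_cocycle[OF c that(1,2) p, of u] by (simp only: tangent_of_def) simp
qed

lemma tangent_of_self: "\<lbrakk>c \<in> A; p \<in> chart_dom c\<rbrakk> \<Longrightarrow> tangent_of A c p u c = u"
  by (simp add: tangent_of_def Dtrans_id)

lemma tangent_of_add:
  assumes c: "c \<in> A" and p: "p \<in> chart_dom c"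
  shows "tangent_of A c p (u + v) = (\<lambda>c'. tangent_of A c p u c' + tangent_of A c p v c')"
  using Dtrans_linear[OF c _ p] by (auto simp: tangent_of_def linear_add)

lemma tangent_of_scale:
  assumes c: "c \<in> A" and p: "p \<in> chart_dom c"
  shows "tangent_of A c p (r *\<^sub>R u) = (\<lambda>c'. r *\<^sub>R tangent_of A c p u c')"
  using Dtrans_linear[OF c _ p] by (auto simp: tangent_of_def linear_cmul)

text \<open>
  The velocity is a tangent vector, hence is determined by its coordinates in one chart.
\<close>
lemma velocity_tangent_of:
  assumes se: "s < e" and cont: "continuous_on {s..e} \<gamma>" and t: "t \<in> {s..e}"
    and c: "c \<in> A" "\<gamma> t \<in> chart_dom c"
    and d: "((chart_map c \<circ> \<gamma>) has_vector_derivative u) (at t within {s..e})"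
  shows "velocity A {s..e} \<gamma> t = tangent_of A c (\<gamma> t) u"
proof
  fix c'
  show "velocity A {s..e} \<gamma> t c' = tangent_of A c (\<gamma> t) u c'"
  proof (cases "c' \<in> A \<and> \<gamma> t \<in> chart_dom c'")
    case True
    let ?S = "{r \<in> {s..e}. \<gamma> r \<in> chart_dom c \<inter> chart_dom c'}"
    have at: "at t within ?S = at t within {s..e}"
      by (rule at_within_preimage[OF cont open_Int[OF dom_open dom_open]]) (use True c t in auto)
    have d': "((\<lambda>s. transition c c' ((chart_map c \<circ> \<gamma>) s)) has_vector_derivative
        Dtrans c c' ((chart_map c \<circ> \<gamma>) t) u) (at t within ?S)"
      unfolding at
      by (rule has_vector_derivative_compose[OF d transition_derivative])
        (use True c map_overlap in auto)
    have "((chart_map c' \<circ> \<gamma>) has_vector_derivative Dtrans c c' (chart_map c (\<gamma> t)) u) (at t within ?S)"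
    proof (rule has_vector_derivative_transform[OF _ _ d'[unfolded o_def]])
      show "t \<in> ?S" using True c t by auto
      show "(chart_map c' \<circ> \<gamma>) r = transition c c' (chart_map c (\<gamma> r))" if "r \<in> ?S" for r
        using that transition_map[OF c(1), of "\<gamma> r" c'] by simp
    qed
    from vector_derivative_Icc[OF se t this[unfolded at]]
    show ?thesis using True by (simp add: velocity_def tangent_of_def)
  qed (auto simp: velocity_def tangent_of_def)
qed

text \<open>
  A curve that is \<open>C\<^sup>k\<close> in the coordinates of one chart is \<open>C\<^sup>k\<close> in those of every other, as
  the coordinates change by a smooth transition map.
\<close>
lemma Ck_curve_chart:
  assumes c: "c \<in> A" and se: "s < e" and u: "Ck_on k {s..e} u" "u ` {s..e} \<subseteq> chart_img c"
  shows "Ck_curve A k {s..e} (chart_inv c \<circ> u)"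
proof -
  have cont: "continuous_on {s..e} (chart_inv c \<circ> u)"
    by (intro continuous_on_compose continuous_on_subset[OF chart_inv_cont[OF c] u(2)]
        Ck_on_continuous[OF u(1)])
  have "Ck_on k {t \<in> {s..e}. (chart_inv c \<circ> u) t \<in> chart_dom c'} (chart_map c' \<circ> (chart_inv c \<circ> u))"
    (is "Ck_on k ?S _") if c': "c' \<in> A" for c'
  proof -
    have S: "diff_dom ?S" by (rule diff_dom_preimage[OF se cont dom_open[OF c']])
    have "Ck_on k ?S (\<lambda>t. transition c c' (u t))"
    proof (rule Ck_on_compose[OF S overlap_open[OF c c'] transition_Ck[OF c c']])
      show "Ck_on k ?S u" by (rule Ck_on_subset[OF S _ u(1)]) auto
      show "u ` ?S \<subseteq> overlap c c'"
      proof (intro image_subsetI)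
        fix t assume "t \<in> ?S"
        then have "u t \<in> chart_img c" "chart_inv c (u t) \<in> chart_dom c'" using u(2) by auto
        then show "u t \<in> overlap c c'" using overlap_iff[OF c, of "u t" c'] by blast
      qed
    qed
    moreover have "chart_map c' \<circ> (chart_inv c \<circ> u) = (\<lambda>t. transition c c' (u t))"
      by (simp add: transition_def o_def)
    ultimately show ?thesis by metis
  qed
  then show ?thesis
    unfolding Ck_curve_def by (intro conjI ballI cont)
qed

end

section \<open>Christoffel symbols and acceleration under change of chart\<close>

lemma linear_expand:
  fixes L :: "'a::euclidean_space \<Rightarrow> 'b::real_normed_vector"
  assumes "linear L" shows "L u = (\<Sum>i\<in>Basis. (u \<bullet> i) *\<^sub>R L i)"
proof -
  have "L u = L (\<Sum>i\<in>Basis. (u \<bullet> i) *\<^sub>R i)" by (simp add: euclidean_representation)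
  also have "\<dots> = (\<Sum>i\<in>Basis. (u \<bullet> i) *\<^sub>R L i)" by (simp add: linear_sum[OF assms] linear_cmul[OF assms])
  finally show ?thesis .
qed

lemma bilinear_expand:
  fixes B :: "'a::euclidean_space \<Rightarrow> 'a \<Rightarrow> 'b::real_normed_vector"
  assumes "bilinear B" shows "B u v = (\<Sum>i\<in>Basis. \<Sum>j\<in>Basis. ((u \<bullet> i) * (v \<bullet> j)) *\<^sub>R B i j)"
proof -
  have 1: "linear (\<lambda>u. B u v)" and 2: "\<And>u. linear (B u)" for v
    using assms by (auto simp: bilinear_def)
  have "B u v = (\<Sum>i\<in>Basis. (u \<bullet> i) *\<^sub>R B i v)" by (rule linear_expand[OF 1])
  also have "\<dots> = (\<Sum>i\<in>Basis. (u \<bullet> i) *\<^sub>R (\<Sum>j\<in>Basis. (v \<bullet> j) *\<^sub>R B i j))"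
    by (intro sum.cong refl arg_cong[where f = "scaleR _"] linear_expand[OF 2])
  finally show ?thesis by (simp add: scaleR_sum_right)
qed

locale riemannian_atlas = chart_atlas A
  for A :: "('q::{t2_space, second_countable_topology}, 'e::euclidean_space) chart set" +
  fixes g :: "('q, 'e) metric"
  assumes metric: "riemannian_metric A g"
begin

abbreviation G where "G c x u v \<equiv> metric_coord A g c x u v"

abbreviation DG where "DG c x z u v \<equiv> frechet_derivative (\<lambda>y. G c y u v) (at x) z"

lemma G_smooth: "c \<in> A \<Longrightarrow> smooth_on (chart_img c) (\<lambda>x. G c x u v)"
  using metric unfolding riemannian_metric_def by blast

lemma G_facts:
  assumes c: "c \<in> A" and x: "x \<in> chart_img c"
  shows G_add: "G c x (u + v) w = G c x u w + G c x v w"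
    and G_scale: "G c x (r *\<^sub>R u) w = r * G c x u w"
    and G_sym: "G c x u v = G c x v u"
    and G_pos: "u \<noteq> 0 \<Longrightarrow> G c x u u > 0"
proof -
  let ?p = "chart_inv c x"
  have p: "?p \<in> chart_dom c" by (rule chart_inv_dom[OF c x])
  note T = tangent_of_in[OF c p]
  have m: "\<forall>u\<in>tangent_space A ?p. \<forall>v\<in>tangent_space A ?p.
        (\<forall>w\<in>tangent_space A ?p. g ?p (\<lambda>c. u c + v c) w = g ?p u w + g ?p v w) \<and>
        (\<forall>r. g ?p (\<lambda>c. r *\<^sub>R u c) v = r * g ?p u v) \<and>
        g ?p u v = g ?p v u \<and> (u \<noteq> (\<lambda>c. 0) \<longrightarrow> g ?p u u > 0)"
    using metric unfolding riemannian_metric_def by blast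
  show "G c x (u + v) w = G c x u w + G c x v w"
    unfolding metric_coord_def tangent_of_add[OF c p] using m T by blast
  show "G c x (r *\<^sub>R u) w = r * G c x u w"
    unfolding metric_coord_def tangent_of_scale[OF c p] using m T by blast
  show "G c x u v = G c x v u"
    unfolding metric_coord_def using m T by blast
  assume "u \<noteq> 0"
  then have "tangent_of A c ?p u \<noteq> (\<lambda>c. 0)"
    using tangent_of_self[OF c p, of u] by metis
  then show "G c x u u > 0"
    unfolding metric_coord_def using m T by blast
qed

lemma G_bilinear:
  assumes c: "c \<in> A" and x: "x \<in> chart_img c"
  shows "bilinear (G c x)"
proof -
  have 1: "linear (\<lambda>u. G c x u v)" for v
    by (rule linearI) (simp_all add: G_add[OF c x] G_scale[OF c x])
  then have "linear (G c x u)" for u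
    using G_sym[OF c x, of u] by simp
  then show ?thesis using 1 by (simp add: bilinear_def)
qed

lemma G_has_derivative:
  assumes c: "c \<in> A" and x: "x \<in> chart_img c"
  shows "((\<lambda>y. G c y u v) has_derivative (\<lambda>z. DG c x z u v)) (at x)"
  by (rule smooth_on_has_derivative[OF G_smooth[OF c] img_open[OF c] x])

lemma DG_facts:
  assumes c: "c \<in> A" and x: "x \<in> chart_img c"
  shows DG_linear: "linear (\<lambda>z. DG c x z u v)"
    and DG_sym: "DG c x z u v = DG c x z v u"
    and DG_bilinear: "bilinear (DG c x z)"
proof -
  show "linear (\<lambda>z. DG c x z u v)"
    using G_has_derivative[OF c x] has_derivative_linear by blast
  have eqI: "DG c x z u v = f' z" if "((\<lambda>y. f y) has_derivative f') (at x)"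
    "\<And>y. y \<in> chart_img c \<Longrightarrow> f y = G c y u v" for f f' z u v
    using frechet_derivative_at[OF has_derivative_transform_within_open[OF that(1) img_open[OF c] x that(2)]]
    by simp
  have sym: "DG c x z u v = DG c x z v u" for z u v
    by (rule eqI[OF G_has_derivative[OF c x]]) (rule G_sym[OF c])
  then show "DG c x z u v = DG c x z v u" .
  have 1: "linear (\<lambda>u. DG c x z u v)" for v
  proof (rule linearI)
    show "DG c x z (u + w) v = DG c x z u v + DG c x z w v" for u w
      by (rule eqI[OF has_derivative_add[OF G_has_derivative[OF c x] G_has_derivative[OF c x]]])
        (simp add: G_add[OF c])
    show "DG c x z (r *\<^sub>R u) v = r *\<^sub>R DG c x z u v" for r u
      by (rule eqI[OF has_derivative_scaleR_right[OF G_has_derivative[OF c x]]])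
        (simp add: G_scale[OF c])
  qed
  have "linear (\<lambda>v. DG c x z u v)" for u
  proof -
    have "(\<lambda>v. DG c x z u v) = (\<lambda>v. DG c x z v u)" by (intro ext sym)
    then show ?thesis using 1[of u] by simp
  qed
  then show "bilinear (DG c x z)" using 1 by (simp add: bilinear_def)
qed

lemma christoffel_torsion_free:
  assumes c: "c \<in> A" and x: "x \<in> chart_img c"
  shows "torsion_free_metric (G c x) (DG c x) (christoffel A g c x)"
    and christoffel_unique: "torsion_free_metric (G c x) (DG c x) \<Gamma> \<Longrightarrow> christoffel A g c x = \<Gamma>"
proof -
  have ex1: "\<exists>!\<Gamma>. torsion_free_metric (G c x) (DG c x) \<Gamma>"
    by (rule torsion_free_metric_ex1[OF G_bilinear[OF c x] G_sym[OF c x] G_pos[OF c x]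
          DG_linear[OF c x] DG_bilinear[OF c x] DG_sym[OF c x]])
  show "torsion_free_metric (G c x) (DG c x) (christoffel A g c x)"
    using theI'[OF ex1] by (simp add: christoffel_def)
  show "torsion_free_metric (G c x) (DG c x) \<Gamma> \<Longrightarrow> christoffel A g c x = \<Gamma>"
    using the1_equality[OF ex1, of \<Gamma>] by (simp add: christoffel_def)
qed

lemma christoffel_bilinear: "\<lbrakk>c \<in> A; x \<in> chart_img c\<rbrakk> \<Longrightarrow> bilinear (christoffel A g c x)"
  using christoffel_torsion_free(1) by (simp add: torsion_free_metric_def)

text \<open>
  The Koszul formula: up to lowering an index the Christoffel symbols are linear in the first
  derivatives of the metric.
\<close>
lemma koszul:
  assumes c: "c \<in> A" and x: "x \<in> chart_img c"
  shows "G c x (christoffel A g c x u v) z = (DG c x u v z + DG c x v u z - DG c x z u v) / 2"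
proof -
  let ?C = "christoffel A g c x"
  have s: "\<And>u v. ?C u v = ?C v u" and m: "\<And>z u v. DG c x z u v = G c x (?C z u) v + G c x u (?C z v)"
    using christoffel_torsion_free(1)[OF c x] unfolding torsion_free_metric_def by blast+
  show ?thesis
    unfolding m s[of v u] s[of z u] s[of z v] G_sym[OF c x, of v "?C u z"] by simp
qed

lemma G_transition:
  assumes c: "c \<in> A" "c' \<in> A" and x: "x \<in> overlap c c'"
  shows "G c x u v = G c' (transition c c' x) (Dtrans c c' x u) (Dtrans c c' x v)"
proof -
  let ?p = "chart_inv c x"
  have x': "x \<in> chart_img c" and p: "?p \<in> chart_dom c'" using x overlap_iff[OF c(1), of x c'] by auto
  have p': "?p \<in> chart_dom c" by (rule chart_inv_dom[OF c(1) x'])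
  have xp: "chart_map c ?p = x" by (rule chart_map_inv[OF c(1) x'])
  have "chart_inv c' (transition c c' x) = ?p"
    using chart_inv_map[OF c(2) p] by (simp add: transition_def)
  then show ?thesis
    using tangent_of_Dtrans[OF c p' p] by (simp add: metric_coord_def xp)
qed

abbreviation D2trans where "D2trans c c' y u v \<equiv> frechet_derivative (\<lambda>y. Dtrans c c' y u) (at y) v"

lemma D2trans_has_derivative:
  assumes c: "c \<in> A" "c' \<in> A" and y: "y \<in> overlap c c'"
  shows "((\<lambda>y. Dtrans c c' y u) has_derivative D2trans c c' y u) (at y)"
  using smooth_on_has_derivative[OF smooth_on_derivative overlap_open[OF c] y]
    transition_smooth[OF c] overlap_open[OF c] unfolding overlap_def by blast

lemma D2trans_sym:
  assumes c: "c \<in> A" "c' \<in> A" and y: "y \<in> overlap c c'"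
  shows "D2trans c c' y u v = D2trans c c' y v u"
  by (rule second_derivative_symmetric[OF overlap_open[OF c] transition_Ck[OF c] y])

lemma D2trans_bilinear:
  assumes c: "c \<in> A" "c' \<in> A" and y: "y \<in> overlap c c'"
  shows "bilinear (D2trans c c' y)"
proof -
  have 1: "linear (D2trans c c' y u)" for u
    using D2trans_has_derivative[OF c y] has_derivative_linear by blast
  have "linear (\<lambda>u. D2trans c c' y u v)" for v
    using 1[of v] D2trans_sym[OF c y, of _ v] by simp
  then show ?thesis using 1 by (simp add: bilinear_def)
qed

text \<open>
  The product rule for \<open>G (x) (U, W)\<close>, obtained by expanding the bilinear form in the basis.
\<close>
lemma G_derivative_along:
  assumes c: "c \<in> A" and x: "x t \<in> chart_img c"
    and d: "(x has_derivative X) (at t)" "(U has_derivative U') (at t)" "(W has_derivative W') (at t)"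
    and S: "open S" "t \<in> S" "x ` S \<subseteq> chart_img c"
  shows "((\<lambda>s. G c (x s) (U s) (W s)) has_derivative
     (\<lambda>h. DG c (x t) (X h) (U t) (W t) + G c (x t) (U' h) (W t) + G c (x t) (U t) (W' h))) (at t)"
proof -
  let ?F = "\<lambda>s. \<Sum>i\<in>Basis. \<Sum>j\<in>Basis. ((U s \<bullet> i) * (W s \<bullet> j)) *\<^sub>R G c (x s) i j"
  have dG: "((\<lambda>s. G c (x s) i j) has_derivative (\<lambda>h. DG c (x t) (X h) i j)) (at t)" for i j
    by (rule has_derivative_compose[OF d(1) G_has_derivative[OF c x]])
  have "(?F has_derivative (\<lambda>h. \<Sum>i\<in>Basis. \<Sum>j\<in>Basis.
      ((U t \<bullet> i) * (W t \<bullet> j)) *\<^sub>R DG c (x t) (X h) i j +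
      ((U t \<bullet> i) * (W' h \<bullet> j) + (U' h \<bullet> i) * (W t \<bullet> j)) *\<^sub>R G c (x t) i j)) (at t)"
    by (intro has_derivative_sum has_derivative_scaleR has_derivative_mult has_derivative_inner_left d dG)
  then have "(?F has_derivative (\<lambda>h. DG c (x t) (X h) (U t) (W t) + G c (x t) (U' h) (W t) + G c (x t) (U t) (W' h))) (at t)"
  proof (rule has_derivative_eq_rhs, intro ext)
    fix h
    show "(\<Sum>i\<in>Basis. \<Sum>j\<in>Basis.
      ((U t \<bullet> i) * (W t \<bullet> j)) *\<^sub>R DG c (x t) (X h) i j +
      ((U t \<bullet> i) * (W' h \<bullet> j) + (U' h \<bullet> i) * (W t \<bullet> j)) *\<^sub>R G c (x t) i j) =
      DG c (x t) (X h) (U t) (W t) + G c (x t) (U' h) (W t) + G c (x t) (U t) (W' h)"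
      unfolding bilinear_expand[OF G_bilinear[OF c x], of "U' h" "W t"]
        bilinear_expand[OF G_bilinear[OF c x], of "U t" "W' h"]
        bilinear_expand[OF DG_bilinear[OF c x, of "X h"], of "U t" "W t"]
      by (simp add: sum.distrib algebra_simps)
  qed
  then show ?thesis
  proof (rule has_derivative_transform_within_open[OF _ S(1,2)])
    show "?F s = G c (x s) (U s) (W s)" if "s \<in> S" for s
      by (rule bilinear_expand[OF G_bilinear[OF c], symmetric]) (use S(3) that in auto)
  qed
qed

text \<open>
  The right-hand side, as a function of the transformed vectors, is symmetric because second
  derivatives are, and metric by differentiating the transformation rule of the metric.
  Uniqueness of the torsion-free metric connection identifies it with the Christoffel symbols of
  the other chart.
\<close>
lemma christoffel_transition:
  assumes c: "c \<in> A" "c' \<in> A" and p: "p \<in> chart_dom c" "p \<in> chart_dom c'"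
  shows "christoffel A g c' (chart_map c' p) (Dtrans c c' (chart_map c p) u) (Dtrans c c' (chart_map c p) v) =
    Dtrans c c' (chart_map c p) (christoffel A g c (chart_map c p) u v) - D2trans c c' (chart_map c p) u v"
proof -
  let ?x = "chart_map c p" and ?y = "chart_map c' p"
  define T where "T = Dtrans c c' ?x"
  define E where "E = Dtrans c' c ?y"
  define H where "H = D2trans c c' ?x"
  define C where "C = christoffel A g c ?x"
  have x: "?x \<in> overlap c c'" "?x \<in> chart_img c" and y: "?y \<in> chart_img c'"
    using map_overlap chart_map_img p by auto
  have yx: "transition c c' ?x = ?y" by (rule transition_map[OF c(1) p(1)])
  have ET: "E (T u) = u" for u
    using Dtrans_cocycle[OF c c(1) p p(1), of u] Dtrans_id[OF c(1) p(1), of u] by (simp add: T_def E_def)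
  have TE: "T (E u) = u" for u
    using Dtrans_cocycle[OF c(2,1,2) p(2,1,2), of u] Dtrans_id[OF c(2) p(2), of u] by (simp add: T_def E_def)
  have lin: "linear T" "linear E"
    unfolding T_def E_def using Dtrans_linear c p by blast+
  have Cb: "bilinear C" and Csym: "\<And>u v. C u v = C v u"
    and Cm: "\<And>z u v. DG c ?x z u v = G c ?x (C z u) v + G c ?x u (C z v)"
    using christoffel_torsion_free(1)[OF c(1) x(2)] unfolding torsion_free_metric_def C_def by blast+
  have Hb: "bilinear H" unfolding H_def by (rule D2trans_bilinear[OF c x(1)])
  have Hsym: "H u v = H v u" for u v unfolding H_def by (rule D2trans_sym[OF c x(1)])
  have GT: "G c ?x u v = G c' ?y (T u) (T v)" for u v
    using G_transition[OF c x(1)] by (simp add: T_def yx)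
  (* Differentiate the identity G_transition in the direction z. *)
  have key: "DG c ?x z u v = DG c' ?y (T z) (T u) (T v) + G c' ?y (H u z) (T v) + G c' ?y (T u) (H v z)" for z u v
  proof -
    have img: "transition c c' ` overlap c c' \<subseteq> chart_img c'"
    proof (intro image_subsetI)
      fix r assume "r \<in> overlap c c'"
      then have "chart_inv c r \<in> chart_dom c'" using overlap_iff[OF c(1), of r c'] by blast
      then show "transition c c' r \<in> chart_img c'" by (simp add: transition_def chart_map_img)
    qed
    have "((\<lambda>r. G c' (transition c c' r) (Dtrans c c' r u) (Dtrans c c' r v)) has_derivative
      (\<lambda>z. DG c' ?y (T z) (T u) (T v) + G c' ?y (H u z) (T v) + G c' ?y (T u) (H v z))) (at ?x)"
      using G_derivative_along[OF c(2) _ transition_derivative[OF c x(1)] D2trans_has_derivative[OF c x(1)]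
        D2trans_has_derivative[OF c x(1)] overlap_open[OF c] x(1) img, of u v] y
      by (simp add: yx T_def H_def)
    then have "((\<lambda>r. G c r u v) has_derivative
      (\<lambda>z. DG c' ?y (T z) (T u) (T v) + G c' ?y (H u z) (T v) + G c' ?y (T u) (H v z))) (at ?x)"
      by (rule has_derivative_transform_within_open[OF _ overlap_open[OF c] x(1)])
        (rule G_transition[OF c, symmetric])
    from fun_cong[OF frechet_derivative_at[OF this], of z] show ?thesis by (rule sym)
  qed
  (* The claimed transformation law, read as a definition in the chart c'; E inverts T. *)
  define \<Gamma> where "\<Gamma> u v = T (C (E u) (E v)) - H (E u) (E v)" for u v
  have "torsion_free_metric (G c' ?y) (DG c' ?y) \<Gamma>"
    unfolding torsion_free_metric_def
  proof (intro conjI allI)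
    have l: "linear (\<lambda>u. C u w)" "linear (C w)" "linear (\<lambda>u. H u w)" "linear (H w)" for w
      using Cb Hb by (auto simp: bilinear_def)
    show "bilinear \<Gamma>"
      unfolding bilinear_def \<Gamma>_def
      by (intro conjI allI linearI)
        (simp_all add: l[THEN linear_add] l[THEN linear_cmul] lin[THEN linear_add] lin[THEN linear_cmul] algebra_simps)
    show "\<Gamma> u v = \<Gamma> v u" for u v
      by (simp add: \<Gamma>_def Csym[of "E u"] Hsym[of "E u"])
    fix z u v
    have b: "G c' ?y (a - b) w = G c' ?y a w - G c' ?y b w" "G c' ?y w (a - b) = G c' ?y w a - G c' ?y w b" for a b w
      by (rule bilinear_lsub[OF G_bilinear[OF c(2) y]] bilinear_rsub[OF G_bilinear[OF c(2) y]])+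
    have 1: "G c' ?y (\<Gamma> z u) v = G c ?x (C (E z) (E u)) (E v) - G c' ?y (H (E z) (E u)) v"
      unfolding \<Gamma>_def b GT TE ..
    have 2: "G c' ?y u (\<Gamma> z v) = G c ?x (E u) (C (E z) (E v)) - G c' ?y u (H (E z) (E v))"
      unfolding \<Gamma>_def b GT TE ..
    show "DG c' ?y z u v = G c' ?y (\<Gamma> z u) v + G c' ?y u (\<Gamma> z v)"
      using key[where z = "E z" and u = "E u" and v = "E v"] Cm[where z = "E z" and u = "E u" and v = "E v"]
      unfolding 1 2 TE Hsym[of "E z"] by linarith
  qed
  from christoffel_unique[OF c(2) y this]
  have "christoffel A g c' ?y (T u) (T v) = T (C u v) - H u v"
    by (simp add: \<Gamma>_def ET)
  then show ?thesis by (simp add: T_def C_def H_def)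
qed

text \<open>
  The acceleration is a tangent vector. The second derivative of the transition map that appears
  when the velocity is differentiated in the chart \<open>c'\<close> cancels the inhomogeneous term of
  \<open>christoffel_transition\<close>. This matters because the axioms of the metric say nothing about \<open>g\<close>
  outside the tangent spaces.
\<close>
lemma acceleration_tangent_of:
  assumes se: "s < e" and C1: "Ck_curve A 1 {s..e} \<gamma>" and t: "t \<in> {s..e}"
    and c: "c \<in> A" "\<gamma> t \<in> chart_dom c"
    and d2: "((\<lambda>r. velocity A {s..e} \<gamma> r c) has_vector_derivative w) (at t within {s..e})"
  defines "v \<equiv> velocity A {s..e} \<gamma> t c"
  shows "acceleration A g {s..e} \<gamma> t =
    tangent_of A c (\<gamma> t) (w + christoffel A g c (chart_map c (\<gamma> t)) v v)"
proof
  fix c'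
  let ?I = "{s..e}" and ?x = "chart_map c (\<gamma> t)"
  have C1': "Ck_curve A (Suc 0) ?I \<gamma>" using C1 by simp
  have cont: "continuous_on ?I \<gamma>" using C1 by (simp add: Ck_curve_def)
  note vel = velocity_derivative(1)[OF C1' se c(1) dom_open[OF c(1)]]
  have vt: "velocity A ?I \<gamma> r = tangent_of A c (\<gamma> r) (velocity A ?I \<gamma> r c)"
    if "r \<in> ?I" "\<gamma> r \<in> chart_dom c" for r
    by (rule velocity_tangent_of[OF se cont that(1) c(1) that(2) vel[OF that]])
  show "acceleration A g ?I \<gamma> t c' = tangent_of A c (\<gamma> t) (w + christoffel A g c ?x v v) c'"
  proof (cases "c' \<in> A \<and> \<gamma> t \<in> chart_dom c'")
    case True
    then have c': "c' \<in> A" "\<gamma> t \<in> chart_dom c'" by auto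
    define S where "S = {r \<in> ?I. \<gamma> r \<in> chart_dom c \<inter> chart_dom c'}"
    have at: "at t within S = at t within ?I"
      unfolding S_def
      by (rule at_within_preimage[OF cont open_Int[OF dom_open dom_open]]) (use c c' t in auto)
    have tS: "t \<in> S" using t c c' by (auto simp: S_def)
    have x: "?x \<in> overlap c c'" by (rule map_overlap[OF c(2) c'(2)])
    let ?F = "\<lambda>r. \<Sum>b\<in>Basis. (velocity A ?I \<gamma> r c \<bullet> b) *\<^sub>R Dtrans c c' ((chart_map c \<circ> \<gamma>) r) b"
    have vF: "velocity A ?I \<gamma> r c' = ?F r" if "r \<in> S" for r
    proof -
      have r: "r \<in> ?I" "\<gamma> r \<in> chart_dom c" "\<gamma> r \<in> chart_dom c'" using that by (auto simp: S_def)
      have "velocity A ?I \<gamma> r c' = Dtrans c c' (chart_map c (\<gamma> r)) (velocity A ?I \<gamma> r c)"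
        by (subst vt[OF r(1,2)]) (simp add: tangent_of_def c' r)
      also have "\<dots> = ?F r"
        unfolding o_def by (rule linear_expand[OF Dtrans_linear[OF c(1) c'(1) r(2,3)]])
      finally show ?thesis .
    qed
    have dv: "((\<lambda>r. velocity A ?I \<gamma> r c \<bullet> b) has_vector_derivative w \<bullet> b) (at t within ?I)" for b
      using bounded_linear.has_vector_derivative[OF bounded_linear_inner_left d2] .
    have dT: "((\<lambda>r. Dtrans c c' ((chart_map c \<circ> \<gamma>) r) b) has_vector_derivative D2trans c c' ?x b v) (at t within ?I)" for b
      using has_vector_derivative_compose[OF vel[OF t c(2)] D2trans_has_derivative[OF c(1) c'(1), of _ b]] x
      by (simp add: v_def)
    have "(?F has_vector_derivative (\<Sum>b\<in>Basis. (v \<bullet> b) *\<^sub>R D2trans c c' ?x b v + (w \<bullet> b) *\<^sub>R Dtrans c c' ?x b))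
        (at t within ?I)"
      unfolding v_def
      by (intro has_vector_derivative_sum)
       (use bounded_bilinear.has_vector_derivative[OF bounded_bilinear_scaleR dv dT] in \<open>simp add: v_def\<close>)
    moreover have "(\<Sum>b\<in>Basis. (v \<bullet> b) *\<^sub>R D2trans c c' ?x b v + (w \<bullet> b) *\<^sub>R Dtrans c c' ?x b) =
        D2trans c c' ?x v v + Dtrans c c' ?x w"
    proof -
      have l: "linear (\<lambda>b. D2trans c c' ?x b v)"
        using D2trans_bilinear[OF c(1) c'(1) x] by (simp add: bilinear_def)
      show ?thesis
        unfolding linear_expand[OF l, of v] linear_expand[OF Dtrans_linear[OF c(1) c'(1) c(2) c'(2)], of w]
        by (simp add: sum.distrib)
    qed
    ultimately have dF: "(?F has_vector_derivative (D2trans c c' ?x v v + Dtrans c c' ?x w)) (at t within S)"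
      by (simp add: at)
    have "((\<lambda>r. velocity A ?I \<gamma> r c') has_vector_derivative (D2trans c c' ?x v v + Dtrans c c' ?x w)) (at t within ?I)"
      using has_vector_derivative_transform[OF tS vF dF] by (simp add: at)
    from vector_derivative_Icc[OF se t this]
    have d': "vector_derivative (\<lambda>r. velocity A ?I \<gamma> r c') (at t within ?I) = D2trans c c' ?x v v + Dtrans c c' ?x w" .
    have v': "velocity A ?I \<gamma> t c' = Dtrans c c' ?x v"
      by (subst vt[OF t c(2)]) (simp add: tangent_of_def c' v_def)
    show ?thesis
      unfolding acceleration_def covariant_derivative_def d' v'
      using christoffel_transition[OF c(1) c'(1) c(2) c'(2), of v v] c'
      by (simp add: tangent_of_def linear_add[OF Dtrans_linear[OF c(1) c'(1) c(2) c'(2)]])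
  qed (auto simp: acceleration_def covariant_derivative_def tangent_of_def)
qed

text \<open>
  Hence the integrand of the action can be computed in any chart.
\<close>
lemma acceleration_norm:
  assumes se: "s < e" and C1: "Ck_curve A 1 {s..e} \<gamma>" and t: "t \<in> {s..e}"
    and c: "c \<in> A" "\<gamma> t \<in> chart_dom c"
    and d2: "((\<lambda>r. velocity A {s..e} \<gamma> r c) has_vector_derivative w) (at t within {s..e})"
  defines "v \<equiv> velocity A {s..e} \<gamma> t c" and "x \<equiv> chart_map c (\<gamma> t)"
  shows "g (\<gamma> t) (acceleration A g {s..e} \<gamma> t) (acceleration A g {s..e} \<gamma> t) =
    G c x (w + christoffel A g c x v v) (w + christoffel A g c x v v)"
  unfolding acceleration_tangent_of[OF se C1 t c d2] metric_coord_def x_def v_def chart_inv_map[OF c] ..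

end

section \<open>Functions with bounded second differences\<close>

text \<open>
  A quantitative form of being \<open>C\<^sup>1\<close> with Lipschitz derivative that mentions no derivatives. The
  last clause bounds the second difference over every parallelogram with corners in \<open>K\<close> by the
  product of its side lengths. Comparing the values of the Lagrangian at nearby points needs
  nothing more than this.
\<close>
definition sd_bound :: "real \<Rightarrow> 'a::real_normed_vector set \<Rightarrow> ('a \<Rightarrow> real) \<Rightarrow> bool" where
  "sd_bound M K f \<longleftrightarrow> 0 \<le> M \<and> (\<forall>p\<in>K. \<bar>f p\<bar> \<le> M) \<and> (\<forall>p\<in>K. \<forall>q\<in>K. \<bar>f p - f q\<bar> \<le> M * norm (p - q)) \<and>
    (\<forall>p h k. p \<in> K \<and> p + h \<in> K \<and> p + k \<in> K \<and> p + h + k \<in> K \<longrightarrow>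
      \<bar>f (p + h + k) - f (p + h) - f (p + k) + f p\<bar> \<le> M * norm h * norm k)"

lemma sd_boundD:
  assumes "sd_bound M K f"
  shows "0 \<le> M" "p \<in> K \<Longrightarrow> \<bar>f p\<bar> \<le> M" "\<lbrakk>p \<in> K; q \<in> K\<rbrakk> \<Longrightarrow> \<bar>f p - f q\<bar> \<le> M * norm (p - q)"
    "\<lbrakk>p \<in> K; p + h \<in> K; p + k \<in> K; p + h + k \<in> K\<rbrakk> \<Longrightarrow>
      \<bar>f (p + h + k) - f (p + h) - f (p + k) + f p\<bar> \<le> M * norm h * norm k"
  using assms by (auto simp: sd_bound_def)

lemma sd_bound_mono: "sd_bound M K f \<Longrightarrow> M \<le> M' \<Longrightarrow> sd_bound M' K f"
  unfolding sd_bound_def by (meson mult_right_mono norm_ge_zero order_trans)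

definition sd_bounded :: "'a::real_normed_vector set \<Rightarrow> ('a \<Rightarrow> real) \<Rightarrow> bool" where
  "sd_bounded K f \<longleftrightarrow> (\<exists>M. sd_bound M K f)"

lemma sd_bounded_const: "sd_bounded K (\<lambda>_. c)"
  unfolding sd_bounded_def sd_bound_def by (intro exI[of _ "\<bar>c\<bar>"]) auto

lemma sd_bounded_add:
  assumes "sd_bounded K f" "sd_bounded K g" shows "sd_bounded K (\<lambda>p. f p + g p)"
proof -
  obtain M N where M: "sd_bound M K f" and N: "sd_bound N K g"
    using assms by (auto simp: sd_bounded_def)
  have "sd_bound (M + N) K (\<lambda>p. f p + g p)"
    unfolding sd_bound_def
  proof (intro conjI ballI allI impI)
    show "0 \<le> M + N" using sd_boundD(1)[OF M] sd_boundD(1)[OF N] by simp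
    show "\<bar>f p + g p\<bar> \<le> M + N" if "p \<in> K" for p
      using sd_boundD(2)[OF M that] sd_boundD(2)[OF N that] by linarith
    show "\<bar>f p + g p - (f q + g q)\<bar> \<le> (M + N) * norm (p - q)" if "p \<in> K" "q \<in> K" for p q
      using sd_boundD(3)[OF M that] sd_boundD(3)[OF N that] unfolding distrib_right by linarith
    fix p h k assume a: "p \<in> K \<and> p + h \<in> K \<and> p + k \<in> K \<and> p + h + k \<in> K"
    show "\<bar>f (p + h + k) + g (p + h + k) - (f (p + h) + g (p + h)) - (f (p + k) + g (p + k)) + (f p + g p)\<bar>
        \<le> (M + N) * norm h * norm k"
      using sd_boundD(4)[OF M, of p h k] sd_boundD(4)[OF N, of p h k] a unfolding distrib_right by linarith
  qed
  then show ?thesis by (auto simp: sd_bounded_def)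
qed

lemma sd_bounded_sum:
  assumes "\<And>i. i \<in> I \<Longrightarrow> sd_bounded K (f i)" shows "sd_bounded K (\<lambda>p. \<Sum>i\<in>I. f i p)"
  using assms by (induction I rule: infinite_finite_induct) (auto intro: sd_bounded_const sd_bounded_add)

text \<open>
  The product rule for second differences; the indices are the corners of a parallelogram.
\<close>
lemma second_difference_product:
  fixes f00 :: real
  shows "f11 * g11 - f10 * g10 - f01 * g01 + f00 * g00 =
    (f11 - f10 - f01 + f00) * g11 + (f10 - f00) * (g11 - g10) + (f01 - f00) * (g11 - g01)
      + f00 * (g11 - g10 - g01 + g00)"
  by (simp add: algebra_simps)

lemma sd_bounded_mult:
  assumes "sd_bounded K f" "sd_bounded K g" shows "sd_bounded K (\<lambda>p. f p * g p)"
proof -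
  obtain M N where M: "sd_bound M K f" and N: "sd_bound N K g"
    using assms by (auto simp: sd_bounded_def)
  have pos: "0 \<le> M" "0 \<le> N" using sd_boundD(1)[OF M] sd_boundD(1)[OF N] by simp_all
  have "sd_bound (4 * M * N) K (\<lambda>p. f p * g p)"
    unfolding sd_bound_def
  proof (intro conjI ballI allI impI)
    show "0 \<le> 4 * M * N" using pos by simp
    show "\<bar>f p * g p\<bar> \<le> 4 * M * N" if "p \<in> K" for p
    proof -
      have "\<bar>f p * g p\<bar> \<le> M * N"
        unfolding abs_mult by (intro mult_mono sd_boundD(2)[OF M that] sd_boundD(2)[OF N that] pos) simp
      then show ?thesis using mult_nonneg_nonneg[OF pos] by linarith
    qed
    show "\<bar>f p * g p - f q * g q\<bar> \<le> 4 * M * N * norm (p - q)" if p: "p \<in> K" "q \<in> K" for p q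
    proof -
      have "\<bar>(f p - f q) * g p\<bar> \<le> (M * norm (p - q)) * N" "\<bar>f q * (g p - g q)\<bar> \<le> M * (N * norm (p - q))"
        unfolding abs_mult using pos
        by (intro mult_mono sd_boundD(2)[OF M] sd_boundD(3)[OF M] sd_boundD(2)[OF N] sd_boundD(3)[OF N] p; simp)+
      moreover have "f p * g p - f q * g q = (f p - f q) * g p + f q * (g p - g q)" by (simp add: algebra_simps)
      moreover have "0 \<le> M * N * norm (p - q)" using pos by simp
      ultimately show ?thesis by (simp add: algebra_simps)
    qed
    fix p h k assume a: "p \<in> K \<and> p + h \<in> K \<and> p + k \<in> K \<and> p + h + k \<in> K"
    note ff = sd_boundD(2,3)[OF M] and gg = sd_boundD(2,3)[OF N]
    let ?n = "norm h" and ?m = "norm k"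
    have d: "\<bar>f (p + h) - f p\<bar> \<le> M * ?n" "\<bar>f (p + k) - f p\<bar> \<le> M * ?m"
      "\<bar>g (p + h + k) - g (p + h)\<bar> \<le> N * ?m" "\<bar>g (p + h + k) - g (p + k)\<bar> \<le> N * ?n"
      using ff(2)[of "p + h" p] ff(2)[of "p + k" p] gg(2)[of "p + h + k" "p + h"] gg(2)[of "p + h + k" "p + k"] a
      by (simp_all add: algebra_simps)
    have 1: "\<bar>(f (p + h + k) - f (p + h) - f (p + k) + f p) * g (p + h + k)\<bar> \<le> (M * ?n * ?m) * N"
      unfolding abs_mult using sd_boundD(4)[OF M, of p h k] gg(1)[of "p + h + k"] a pos
      by (intro mult_mono) auto
    have 2: "\<bar>(f (p + h) - f p) * (g (p + h + k) - g (p + h))\<bar> \<le> (M * ?n) * (N * ?m)"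
      unfolding abs_mult using d pos by (intro mult_mono) auto
    have 3: "\<bar>(f (p + k) - f p) * (g (p + h + k) - g (p + k))\<bar> \<le> (M * ?m) * (N * ?n)"
      unfolding abs_mult using d pos by (intro mult_mono) auto
    have 4: "\<bar>f p * (g (p + h + k) - g (p + h) - g (p + k) + g p)\<bar> \<le> M * (N * ?n * ?m)"
      unfolding abs_mult using sd_boundD(4)[OF N, of p h k] ff(1)[of p] a pos
      by (intro mult_mono) auto
    have "(M * ?n * ?m) * N + (M * ?n) * (N * ?m) + (M * ?m) * (N * ?n) + M * (N * ?n * ?m) = 4 * M * N * ?n * ?m"
      by (simp add: algebra_simps)
    then show "\<bar>f (p + h + k) * g (p + h + k) - f (p + h) * g (p + h) - f (p + k) * g (p + k) + f p * g p\<bar>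
        \<le> 4 * M * N * norm h * norm k"
      unfolding second_difference_product using 1 2 3 4 by linarith
  qed
  then show ?thesis by (auto simp: sd_bounded_def)
qed

lemma sd_bounded_compose_linear:
  assumes L: "bounded_linear L" and "L ` K' \<subseteq> K" and "sd_bounded K f"
  shows "sd_bounded K' (\<lambda>p. f (L p))"
proof -
  obtain M where M: "sd_bound M K f" using assms by (auto simp: sd_bounded_def)
  obtain B where B: "B \<ge> 0" "\<And>x. norm (L x) \<le> norm x * B"
    using bounded_linear.nonneg_bounded[OF L] by blast
  define N where "N = max M (max (M * B) (M * B * B))"
  have N: "M \<le> N" "M * B \<le> N" "M * B * B \<le> N" by (auto simp: N_def)
  have M0: "0 \<le> M" by (rule sd_boundD(1)[OF M])
  note add = linear_add[OF bounded_linear.linear[OF L]] and diff = linear_diff[OF bounded_linear.linear[OF L]]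
  have im: "L p \<in> K" if "p \<in> K'" for p using that assms(2) by auto
  have "sd_bound N K' (\<lambda>p. f (L p))"
    unfolding sd_bound_def
  proof (intro conjI ballI allI impI)
    show "0 \<le> N" using M0 N by simp
    show "\<bar>f (L p)\<bar> \<le> N" if "p \<in> K'" for p
      using sd_boundD(2)[OF M im[OF that]] N by simp
    show "\<bar>f (L p) - f (L q)\<bar> \<le> N * norm (p - q)" if "p \<in> K'" "q \<in> K'" for p q
    proof -
      have "\<bar>f (L p) - f (L q)\<bar> \<le> M * norm (L (p - q))"
        using sd_boundD(3)[OF M im[OF that(1)] im[OF that(2)]] by (simp add: diff)
      also have "\<dots> \<le> M * (norm (p - q) * B)" by (intro mult_left_mono B M0)
      also have "\<dots> = (M * B) * norm (p - q)" by simp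
      also have "\<dots> \<le> N * norm (p - q)" by (intro mult_right_mono N) simp
      finally show ?thesis .
    qed
    fix p h k assume a: "p \<in> K' \<and> p + h \<in> K' \<and> p + k \<in> K' \<and> p + h + k \<in> K'"
    then have "\<bar>f (L p + L h + L k) - f (L p + L h) - f (L p + L k) + f (L p)\<bar> \<le> M * norm (L h) * norm (L k)"
      by (intro sd_boundD(4)[OF M]) (simp_all add: im flip: add)
    also have "\<dots> \<le> M * (norm h * B) * (norm k * B)"
      using B M0 by (intro mult_mono) auto
    also have "\<dots> = (M * B * B) * (norm h * norm k)" by simp
    also have "\<dots> \<le> N * (norm h * norm k)" by (intro mult_right_mono N) simp
    finally show "\<bar>f (L (p + h + k)) - f (L (p + h)) - f (L (p + k)) + f (L p)\<bar> \<le> N * norm h * norm k"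
      by (simp add: add mult.assoc)
  qed
  then show ?thesis by (auto simp: sd_bounded_def)
qed

lemma sd_bounded_linear:
  fixes L :: "'a::real_normed_vector \<Rightarrow> real"
  assumes L: "bounded_linear L" and K: "bounded K"
  shows "sd_bounded K L"
proof -
  obtain r where r: "\<And>x. x \<in> K \<Longrightarrow> norm x \<le> r" using K by (auto simp: bounded_iff)
  obtain B where B: "B \<ge> 0" "\<And>x. norm (L x) \<le> norm x * B"
    using bounded_linear.nonneg_bounded[OF L] by blast
  note add = linear_add[OF bounded_linear.linear[OF L]] and diff = linear_diff[OF bounded_linear.linear[OF L]]
  have "sd_bound (max B (r * B)) K L"
    unfolding sd_bound_def
  proof (intro conjI ballI allI impI)
    show "0 \<le> max B (r * B)" using B by simp
    show "\<bar>L p\<bar> \<le> max B (r * B)" if "p \<in> K" for p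
      using B(2)[of p] mult_right_mono[OF r[OF that] B(1)] by simp
    show "\<bar>L p - L q\<bar> \<le> max B (r * B) * norm (p - q)" for p q
      using B(2)[of "p - q"] mult_right_mono[of B "max B (r * B)" "norm (p - q)"] by (simp add: diff mult.commute)
    show "\<bar>L (p + h + k) - L (p + h) - L (p + k) + L p\<bar> \<le> max B (r * B) * norm h * norm k" for p h k
      using B by (simp add: add max_def)
  qed
  then show ?thesis by (auto simp: sd_bounded_def)
qed

lemma sd_bounded_family:
  assumes "finite I" "\<And>i. i \<in> I \<Longrightarrow> sd_bounded K (f i)"
  shows "\<exists>M. 0 \<le> M \<and> (\<forall>i\<in>I. sd_bound M K (f i))"
  using assms
proof (induction I)
  case empty
  then show ?case by (intro exI[of _ 0]) auto
next
  case (insert i I)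
  then obtain M N where "0 \<le> M" "\<forall>i\<in>I. sd_bound M K (f i)" "sd_bound N K (f i)"
    unfolding sd_bounded_def by blast
  then show ?case by (intro exI[of _ "max M N"]) (auto intro: sd_bound_mono)
qed

lemma abs_sum_le:
  fixes F :: "'i \<Rightarrow> real"
  assumes "\<And>i. i \<in> I \<Longrightarrow> \<bar>F i\<bar> \<le> c" shows "\<bar>\<Sum>i\<in>I. F i\<bar> \<le> of_nat (card I) * c"
  using order_trans[OF sum_abs sum_bounded_above[of I "\<lambda>i. \<bar>F i\<bar>" c, OF assms]] .

text \<open>
  Testing \<open>B u\<close> with \<open>u\<close> itself bounds \<open>u\<close> by the components of \<open>B u\<close>.
\<close>
lemma coercive_bound:
  fixes B :: "'e::euclidean_space \<Rightarrow> 'e \<Rightarrow> real"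
  assumes B: "bilinear B" and lam: "0 < lam" "\<And>u. lam * (norm u)\<^sup>2 \<le> B u u"
    and m: "\<And>j. j \<in> Basis \<Longrightarrow> \<bar>B u j\<bar> \<le> m"
  shows "norm u \<le> of_nat DIM('e) * m / lam"
proof (cases "u = 0")
  case True
  obtain j :: 'e where "j \<in> Basis" using nonempty_Basis by blast
  from m[OF this] have "0 \<le> m" by simp
  then show ?thesis using True lam by simp
next
  case False
  have l: "linear (B u)" using B by (simp add: bilinear_def)
  have "lam * (norm u)\<^sup>2 \<le> B u u" by (rule lam)
  also have "\<dots> = (\<Sum>j\<in>Basis. (u \<bullet> j) * B u j)" using linear_expand[OF l, of u] by simp
  also have "\<dots> \<le> (\<Sum>j\<in>(Basis::'e set). norm u * m)"
  proof (rule sum_mono)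
    fix j :: 'e assume j: "j \<in> Basis"
    have "(u \<bullet> j) * B u j \<le> \<bar>u \<bullet> j\<bar> * \<bar>B u j\<bar>" by (metis abs_ge_self abs_mult)
    also have "\<dots> \<le> norm u * m"
      using Basis_le_norm[OF j, of u] m[OF j] by (intro mult_mono) auto
    finally show "(u \<bullet> j) * B u j \<le> norm u * m" .
  qed
  also have "\<dots> = norm u * (of_nat DIM('e) * m)" by simp
  finally have "norm u * (lam * norm u) \<le> norm u * (of_nat DIM('e) * m)"
    by (simp add: power2_eq_square mult_ac)
  then have "lam * norm u \<le> of_nat DIM('e) * m" using False by simp
  then show ?thesis using lam by (simp add: field_simps)
qed

text \<open>
  The class contains the solutions of linear systems with uniformly positive definite coefficients
  in the class: differences of the equation \<open>B \<Gamma> = R\<close> express \<open>B\<close> applied to a difference of \<open>\<Gamma>\<close>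
  by quantities already controlled, and \<open>coercive_bound\<close> inverts \<open>B\<close>. Through the Koszul formula
  this covers the Christoffel symbols, without a formula for the inverse of the metric.
\<close>
lemma sd_bounded_solve:
  fixes B :: "'a::real_normed_vector \<Rightarrow> 'e::euclidean_space \<Rightarrow> 'e \<Rightarrow> real" and \<Gamma> :: "'a \<Rightarrow> 'e"
  assumes bil: "\<And>p. p \<in> K \<Longrightarrow> bilinear (B p)"
    and lam: "0 < lam" "\<And>p u. p \<in> K \<Longrightarrow> lam * (norm u)\<^sup>2 \<le> B p u u"
    and B: "\<And>i j. \<lbrakk>i \<in> Basis; j \<in> Basis\<rbrakk> \<Longrightarrow> sd_bounded K (\<lambda>p. B p i j)"
    and R: "\<And>j. j \<in> Basis \<Longrightarrow> sd_bounded K (\<lambda>p. B p (\<Gamma> p) j)"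
    and b: "b \<in> Basis"
  shows "sd_bounded K (\<lambda>p. \<Gamma> p \<bullet> b)"
proof -
  have "\<exists>M. 0 \<le> M \<and> (\<forall>ij\<in>Basis \<times> Basis. sd_bound M K (\<lambda>p. B p (fst ij) (snd ij)))"
    by (rule sd_bounded_family) (auto intro: B)
  then obtain M1 where M1: "\<And>i j. \<lbrakk>i \<in> Basis; j \<in> Basis\<rbrakk> \<Longrightarrow> sd_bound M1 K (\<lambda>p. B p i j)" by fastforce
  have "\<exists>M. 0 \<le> M \<and> (\<forall>j\<in>Basis. sd_bound M K (\<lambda>p. B p (\<Gamma> p) j))"
    by (rule sd_bounded_family) (auto intro: R)
  then obtain M2 where M2: "\<And>j. j \<in> Basis \<Longrightarrow> sd_bound M2 K (\<lambda>p. B p (\<Gamma> p) j)" by blast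
  define N where "N = max M1 M2"
  have NB: "sd_bound N K (\<lambda>p. B p i j)" if "i \<in> Basis" "j \<in> Basis" for i j
    using sd_bound_mono[OF M1[OF that]] by (simp add: N_def)
  have NR: "sd_bound N K (\<lambda>p. B p (\<Gamma> p) j)" if "j \<in> Basis" for j
    using sd_bound_mono[OF M2[OF that]] by (simp add: N_def)
  have N0: "0 \<le> N" using sd_boundD(1)[OF NB[OF b b]] .
  define D where "D = real DIM('e)"
  have D: "0 \<le> D" by (simp add: D_def)
  have sumD: "\<bar>\<Sum>i\<in>(Basis::'e set). F i\<bar> \<le> D * c" if "\<And>i. i \<in> Basis \<Longrightarrow> \<bar>F i\<bar> \<le> c" for F c
    unfolding D_def by (rule abs_sum_le[OF that])
  have cb: "norm u \<le> D * m / lam" if "p \<in> K" "\<And>j. j \<in> Basis \<Longrightarrow> \<bar>B p u j\<bar> \<le> m" for p u m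
    unfolding D_def by (rule coercive_bound[OF bil[OF that(1)] lam(1) lam(2)[OF that(1)] that(2)])
  have ex: "B p u j = (\<Sum>i\<in>Basis. (u \<bullet> i) * B p i j)" if "p \<in> K" for p u j
    using linear_expand[of "\<lambda>u. B p u j" u] bil[OF that] by (simp add: bilinear_def)
  define g0 where "g0 = D * N / lam"
  have g0: "norm (\<Gamma> p) \<le> g0" if "p \<in> K" for p
    unfolding g0_def by (rule cb[OF that]) (rule sd_boundD(2)[OF NR that])
  have g0': "0 \<le> g0" using N0 D lam by (simp add: g0_def)
  define L where "L = D * (N + D * (g0 * N)) / lam"
  have L0: "0 \<le> L" using N0 D lam g0' by (simp add: L_def)
  have Lip: "norm (\<Gamma> p - \<Gamma> q) \<le> L * norm (p - q)" if p: "p \<in> K" "q \<in> K" for p q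
  proof -
    have "norm (\<Gamma> p - \<Gamma> q) \<le> D * ((N + D * (g0 * N)) * norm (p - q)) / lam"
    proof (rule cb[OF p(1)])
      fix j :: 'e assume j: "j \<in> Basis"
      have "B p (\<Gamma> p - \<Gamma> q) j = (B p (\<Gamma> p) j - B q (\<Gamma> q) j) - (\<Sum>i\<in>Basis. (\<Gamma> q \<bullet> i) * (B p i j - B q i j))"
        unfolding ex[OF p(1), of "\<Gamma> p - \<Gamma> q"] ex[OF p(1), of "\<Gamma> p"] ex[OF p(2), of "\<Gamma> q"]
        by (simp add: algebra_simps sum_subtractf)
      moreover have "\<bar>B p (\<Gamma> p) j - B q (\<Gamma> q) j\<bar> \<le> N * norm (p - q)"
        by (rule sd_boundD(3)[OF NR[OF j] p])
      moreover have "\<bar>\<Sum>i\<in>Basis. (\<Gamma> q \<bullet> i) * (B p i j - B q i j)\<bar> \<le> D * (g0 * (N * norm (p - q)))"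
      proof (rule sumD)
        fix i :: 'e assume i: "i \<in> Basis"
        have "\<bar>\<Gamma> q \<bullet> i\<bar> \<le> g0" using Basis_le_norm[OF i, of "\<Gamma> q"] g0[OF p(2)] by simp
        then show "\<bar>(\<Gamma> q \<bullet> i) * (B p i j - B q i j)\<bar> \<le> g0 * (N * norm (p - q))"
          unfolding abs_mult by (intro mult_mono sd_boundD(3)[OF NB[OF i j] p] g0') simp_all
      qed
      ultimately show "\<bar>B p (\<Gamma> p - \<Gamma> q) j\<bar> \<le> (N + D * (g0 * N)) * norm (p - q)"
        by (simp add: algebra_simps)
    qed
    then show ?thesis by (simp add: L_def)
  qed
  define L2 where "L2 = D * (N + D * (L * N + L * N + g0 * N)) / lam"
  have L20: "0 \<le> L2" using N0 D lam g0' L0 by (simp add: L2_def)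
  have sd: "norm (\<Gamma> (p + h + k) - \<Gamma> (p + h) - \<Gamma> (p + k) + \<Gamma> p) \<le> L2 * norm h * norm k"
    if p: "p \<in> K" "p + h \<in> K" "p + k \<in> K" "p + h + k \<in> K" for p h k
  proof -
    let ?n = "norm h * norm k"
    let ?p = "p + h + k"
    let ?\<Delta> = "\<Gamma> ?p - \<Gamma> (p + h) - \<Gamma> (p + k) + \<Gamma> p"
    have "norm ?\<Delta> \<le> D * ((N + D * (L * N + L * N + g0 * N)) * ?n) / lam"
    proof (rule cb[OF p(4)])
      fix j :: 'e assume j: "j \<in> Basis"
      let ?E = "\<lambda>i. ((\<Gamma> (p + h) - \<Gamma> p) \<bullet> i) * (B ?p i j - B (p + h) i j) +
        ((\<Gamma> (p + k) - \<Gamma> p) \<bullet> i) * (B ?p i j - B (p + k) i j) +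
        (\<Gamma> p \<bullet> i) * (B ?p i j - B (p + h) i j - B (p + k) i j + B p i j)"
      have "B ?p (\<Gamma> ?p) j - B (p + h) (\<Gamma> (p + h)) j - B (p + k) (\<Gamma> (p + k)) j + B p (\<Gamma> p) j =
        (\<Sum>i\<in>Basis. (\<Gamma> ?p \<bullet> i) * B ?p i j - (\<Gamma> (p + h) \<bullet> i) * B (p + h) i j -
          (\<Gamma> (p + k) \<bullet> i) * B (p + k) i j + (\<Gamma> p \<bullet> i) * B p i j)"
        unfolding ex[OF p(1), of "\<Gamma> p"] ex[OF p(2), of "\<Gamma> (p + h)"] ex[OF p(3), of "\<Gamma> (p + k)"] ex[OF p(4), of "\<Gamma> ?p"]
        by (simp add: sum_subtractf sum.distrib)
      also have "\<dots> = (\<Sum>i\<in>Basis. (?\<Delta> \<bullet> i) * B ?p i j + ?E i)"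
        unfolding second_difference_product by (simp add: inner_diff_left inner_add_left add.assoc)
      also have "\<dots> = B ?p ?\<Delta> j + (\<Sum>i\<in>Basis. ?E i)"
        unfolding ex[OF p(4), of ?\<Delta>] by (simp add: sum.distrib)
      (* The unknown second difference appears only with the coefficient at the far corner. *)
      finally have eq: "B ?p ?\<Delta> j = (B ?p (\<Gamma> ?p) j - B (p + h) (\<Gamma> (p + h)) j - B (p + k) (\<Gamma> (p + k)) j + B p (\<Gamma> p) j)
          - (\<Sum>i\<in>Basis. ?E i)" by simp
      have 1: "\<bar>B ?p (\<Gamma> ?p) j - B (p + h) (\<Gamma> (p + h)) j - B (p + k) (\<Gamma> (p + k)) j + B p (\<Gamma> p) j\<bar> \<le> N * ?n"
        using sd_boundD(4)[OF NR[OF j] p] by (simp add: mult.assoc)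
      have 2: "\<bar>\<Sum>i\<in>Basis. ?E i\<bar> \<le> D * ((L * N + L * N + g0 * N) * ?n)"
      proof (rule sumD)
        fix i :: 'e assume i: "i \<in> Basis"
        have b: "\<bar>u \<bullet> i\<bar> \<le> norm u" for u by (rule Basis_le_norm[OF i])
        have l: "\<bar>(\<Gamma> (p + h) - \<Gamma> p) \<bullet> i\<bar> \<le> L * norm h" "\<bar>(\<Gamma> (p + k) - \<Gamma> p) \<bullet> i\<bar> \<le> L * norm k"
          using order_trans[OF b Lip[OF p(2,1)]] order_trans[OF b Lip[OF p(3,1)]] by simp_all
        have m: "\<bar>B ?p i j - B (p + h) i j\<bar> \<le> N * norm k" "\<bar>B ?p i j - B (p + k) i j\<bar> \<le> N * norm h"
          using sd_boundD(3)[OF NB[OF i j] p(4,2)] sd_boundD(3)[OF NB[OF i j] p(4,3)] by (simp_all add: algebra_simps)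
        have "\<bar>((\<Gamma> (p + h) - \<Gamma> p) \<bullet> i) * (B ?p i j - B (p + h) i j)\<bar> \<le> (L * norm h) * (N * norm k)"
          "\<bar>((\<Gamma> (p + k) - \<Gamma> p) \<bullet> i) * (B ?p i j - B (p + k) i j)\<bar> \<le> (L * norm k) * (N * norm h)"
          unfolding abs_mult using l m L0 N0 by (intro mult_mono; simp)+
        moreover have "\<bar>(\<Gamma> p \<bullet> i) * (B ?p i j - B (p + h) i j - B (p + k) i j + B p i j)\<bar> \<le> g0 * (N * norm h * norm k)"
          unfolding abs_mult using order_trans[OF b g0[OF p(1)]] sd_boundD(4)[OF NB[OF i j] p] g0'
          by (intro mult_mono) auto
        ultimately have "\<bar>?E i\<bar> \<le> (L * norm h) * (N * norm k) + (L * norm k) * (N * norm h) + g0 * (N * norm h * norm k)"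
          by linarith
        then show "\<bar>?E i\<bar> \<le> (L * N + L * N + g0 * N) * ?n" by (simp add: algebra_simps)
      qed
      have "(N + D * (L * N + L * N + g0 * N)) * ?n = N * ?n + D * ((L * N + L * N + g0 * N) * ?n)"
        by (simp add: algebra_simps)
      then show "\<bar>B ?p ?\<Delta> j\<bar> \<le> (N + D * (L * N + L * N + g0 * N)) * ?n"
        unfolding eq using 1 2 by linarith
    qed
    then show ?thesis by (simp add: L2_def mult.assoc)
  qed
  define M where "M = max g0 (max L L2)"
  have M: "g0 \<le> M" "L \<le> M" "L2 \<le> M" by (auto simp: M_def)
  have bn: "\<bar>u \<bullet> b\<bar> \<le> norm u" for u by (rule Basis_le_norm[OF b])
  have "sd_bound M K (\<lambda>p. \<Gamma> p \<bullet> b)"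
    unfolding sd_bound_def
  proof (intro conjI ballI allI impI)
    show "0 \<le> M" using g0' M by simp
    show "\<bar>\<Gamma> p \<bullet> b\<bar> \<le> M" if "p \<in> K" for p
      using bn[of "\<Gamma> p"] g0[OF that] M by simp
    show "\<bar>\<Gamma> p \<bullet> b - \<Gamma> q \<bullet> b\<bar> \<le> M * norm (p - q)" if "p \<in> K" "q \<in> K" for p q
      using order_trans[OF order_trans[OF bn Lip[OF that]] mult_right_mono[OF M(2)]]
      by (simp add: inner_diff_left)
    fix p h k assume a: "p \<in> K \<and> p + h \<in> K \<and> p + k \<in> K \<and> p + h + k \<in> K"
    have "\<bar>(\<Gamma> (p + h + k) - \<Gamma> (p + h) - \<Gamma> (p + k) + \<Gamma> p) \<bullet> b\<bar> \<le> L2 * norm h * norm k"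
      using order_trans[OF bn sd] a by blast
    also have "\<dots> \<le> M * norm h * norm k" by (intro mult_right_mono M) auto
    finally show "\<bar>\<Gamma> (p + h + k) \<bullet> b - \<Gamma> (p + h) \<bullet> b - \<Gamma> (p + k) \<bullet> b + \<Gamma> p \<bullet> b\<bar> \<le> M * norm h * norm k"
      by (simp add: inner_diff_left inner_add_left)
  qed
  then show ?thesis by (auto simp: sd_bounded_def)
qed

lemma bounded_on_compact:
  fixes f :: "'a::metric_space \<Rightarrow> real"
  assumes "compact K" "continuous_on K f"
  obtains C where "0 \<le> C" "\<And>x. x \<in> K \<Longrightarrow> \<bar>f x\<bar> \<le> C"
proof -
  have "bounded (f ` K)" using assms compact_continuous_image compact_imp_bounded by blast
  then obtain C where "\<And>x. x \<in> K \<Longrightarrow> \<bar>f x\<bar> \<le> C" by (auto simp: bounded_iff)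
  then show ?thesis by (intro that[of "max C 0"]) (auto simp: le_max_iff_disj)
qed

lemma abs_linear_le:
  fixes L :: "'e::euclidean_space \<Rightarrow> real"
  assumes "linear L" "\<And>i. i \<in> Basis \<Longrightarrow> \<bar>L i\<bar> \<le> c"
  shows "\<bar>L u\<bar> \<le> norm u * (of_nat DIM('e) * c)"
proof -
  have "\<bar>L u\<bar> = \<bar>\<Sum>i\<in>Basis. (u \<bullet> i) * L i\<bar>" using linear_expand[OF assms(1), of u] by simp
  also have "\<dots> \<le> of_nat DIM('e) * (norm u * c)"
    by (rule abs_sum_le) (auto simp: abs_mult intro!: mult_mono Basis_le_norm assms(2))
  finally show ?thesis by (simp add: mult_ac)
qed

text \<open>
  On a compact convex set the first derivatives bound differences, and the second derivatives bound
  second differences by \<open>second_difference_mean_value\<close>.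
\<close>
lemma sd_bounded_Ck2:
  fixes f :: "'e::euclidean_space \<Rightarrow> real"
  assumes U: "open U" and f: "Ck_on 2 U f" and K: "compact K" "convex K" "K \<subseteq> U"
  shows "sd_bounded K f"
proof -
  define D where "D = (\<lambda>u y. frechet_derivative f (at y) u)"
  define DD where "DD = (\<lambda>u v y. frechet_derivative (D u) (at y) v)"
  have f2: "Ck_on (Suc (Suc 0)) U f" using f by (simp add: numeral_2_eq_2)
  have Df: "(f has_derivative (\<lambda>u. D u x)) (at x)" if "x \<in> U" for x
    using Ck_on_open_derivative(1)[OF f2 U that] by (simp add: D_def)
  have CD: "Ck_on (Suc 0) U (D u)" for u
    using Ck_on_open_derivative(2)[OF f2 U] by (simp add: D_def)
  have DDf: "(D u has_derivative (\<lambda>v. DD u v x)) (at x)" if "x \<in> U" for x u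
    using Ck_on_open_derivative(1)[OF CD U that] by (simp add: DD_def)
  have cDD: "continuous_on K (DD u v)" for u v
    using Ck_on_open_derivative(2)[OF CD U] K(3) by (auto simp: DD_def[abs_def] intro: continuous_on_subset)
  have cD: "continuous_on K (D u)" for u
    using Ck_on_continuous[OF CD] K(3) continuous_on_subset by blast
  have cf: "continuous_on K f" using Ck_on_continuous[OF f] K(3) continuous_on_subset by blast
  have DDsym: "DD u v x = DD v u x" if "x \<in> U" for u v x
    using second_derivative_symmetric_real[OF U f that] by (simp add: DD_def D_def)
  obtain C0 where C0: "0 \<le> C0" "\<And>x. x \<in> K \<Longrightarrow> \<bar>f x\<bar> \<le> C0" using bounded_on_compact[OF K(1) cf] by blast
  have "\<forall>i. \<exists>C. 0 \<le> C \<and> (\<forall>x\<in>K. \<bar>D i x\<bar> \<le> C)" using bounded_on_compact[OF K(1) cD] by metis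
  then obtain C1 where C1: "\<And>i. 0 \<le> C1 i" "\<And>i x. x \<in> K \<Longrightarrow> \<bar>D i x\<bar> \<le> C1 i" by metis
  have "\<forall>i j. \<exists>C. 0 \<le> C \<and> (\<forall>x\<in>K. \<bar>DD i j x\<bar> \<le> C)" using bounded_on_compact[OF K(1) cDD] by metis
  then obtain C2 where C2: "\<And>i j. 0 \<le> C2 i j" "\<And>i j x. x \<in> K \<Longrightarrow> \<bar>DD i j x\<bar> \<le> C2 i j" by metis
  define n where "n = real DIM('e)"
  define A1 where "A1 = (\<Sum>i\<in>Basis. C1 i)"
  define A2 where "A2 = (\<Sum>i\<in>Basis. \<Sum>j\<in>Basis. C2 i j)"
  have A1: "\<bar>D i x\<bar> \<le> A1" if "x \<in> K" "i \<in> Basis" for i x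
    using order_trans[OF C1(2)[OF that(1)] member_le_sum[of i Basis C1]] that C1(1) by (simp add: A1_def)
  have A2: "\<bar>DD i j x\<bar> \<le> A2" if "x \<in> K" "i \<in> Basis" "j \<in> Basis" for i j x
  proof -
    have "\<bar>DD i j x\<bar> \<le> C2 i j" by (rule C2(2)[OF that(1)])
    also have "\<dots> \<le> (\<Sum>j\<in>Basis. C2 i j)" using that C2(1) by (intro member_le_sum) auto
    also have "\<dots> \<le> A2" unfolding A2_def using that C2(1)
      by (intro member_le_sum[of i Basis "\<lambda>i. \<Sum>j\<in>Basis. C2 i j"]) (auto intro: sum_nonneg)
    finally show ?thesis .
  qed
  have nonneg: "0 \<le> A1" "0 \<le> A2" "0 \<le> n"
    using C1(1) C2(1) by (auto simp: A1_def A2_def n_def intro!: sum_nonneg)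
  have Dlin: "\<bar>D u x\<bar> \<le> norm u * (n * A1)" if "x \<in> K" for u x
    unfolding n_def
    by (rule abs_linear_le[of "\<lambda>u. D u x"]) (use that A1 K(3) Df has_derivative_linear in blast)+
  have DDlin: "\<bar>DD u v x\<bar> \<le> norm u * (n * (norm v * (n * A2)))" if "x \<in> K" for u v x
    unfolding n_def
  proof (rule abs_linear_le[of "\<lambda>u. DD u v x"])
    have l: "linear (\<lambda>v. DD u v x)" for u using that K(3) DDf has_derivative_linear by blast
    have "(\<lambda>u. DD u v x) = (\<lambda>u. DD v u x)" using that K(3) DDsym by blast
    then show "linear (\<lambda>u. DD u v x)" using l[of v] by simp
    show "\<bar>DD i v x\<bar> \<le> norm v * (of_nat DIM('e) * A2)" if "i \<in> Basis" for i
      by (rule abs_linear_le[OF l[of i]]) (rule A2[OF \<open>x \<in> K\<close> that])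
  qed
  define M where "M = max C0 (max (n * A1) (n * (n * A2)))"
  have M: "C0 \<le> M" "n * A1 \<le> M" "n * (n * A2) \<le> M" by (auto simp: M_def)
  have "sd_bound M K f"
    unfolding sd_bound_def
  proof (intro conjI ballI allI impI)
    show "0 \<le> M" using C0 M by linarith
    show "\<bar>f p\<bar> \<le> M" if "p \<in> K" for p using C0(2)[OF that] M by linarith
    show "\<bar>f p - f q\<bar> \<le> M * norm (p - q)" if "p \<in> K" "q \<in> K" for p q
    proof -
      have "norm (f p - f q) \<le> (n * A1) * norm (p - q)"
      proof (rule differentiable_bound[OF K(2) _ _ that])
        show "(f has_derivative (\<lambda>u. D u x)) (at x within K)" if "x \<in> K" for x
          using Df[of x] that K(3) has_derivative_at_withinI by blast
        show "onorm (\<lambda>u. D u x) \<le> n * A1" if "x \<in> K" for x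
          by (rule onorm_le) (use Dlin[OF that] in \<open>simp add: mult_ac\<close>)
      qed
      also have "\<dots> \<le> M * norm (p - q)" by (intro mult_right_mono M) simp
      finally show ?thesis by simp
    qed
    fix p h k assume a: "p \<in> K \<and> p + h \<in> K \<and> p + k \<in> K \<and> p + h + k \<in> K"
    have inK: "p + s *\<^sub>R h + t *\<^sub>R k \<in> K" if "0 \<le> s" "s \<le> 1" "0 \<le> t" "t \<le> 1" for s t
    proof -
      have 1: "(1 - s) *\<^sub>R p + s *\<^sub>R (p + h) \<in> K" "(1 - s) *\<^sub>R (p + k) + s *\<^sub>R (p + h + k) \<in> K"
        using K(2) a that by (auto intro!: convexD_alt)
      have "(1 - t) *\<^sub>R ((1 - s) *\<^sub>R p + s *\<^sub>R (p + h)) + t *\<^sub>R ((1 - s) *\<^sub>R (p + k) + s *\<^sub>R (p + h + k)) \<in> K"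
        using convexD_alt[OF K(2) 1 that(3,4)] .
      moreover have "(1 - t) *\<^sub>R ((1 - s) *\<^sub>R p + s *\<^sub>R (p + h)) + t *\<^sub>R ((1 - s) *\<^sub>R (p + k) + s *\<^sub>R (p + h + k))
        = p + s *\<^sub>R h + t *\<^sub>R k" by (simp add: algebra_simps)
      ultimately show ?thesis by simp
    qed
    then have inU: "p + s *\<^sub>R h + t *\<^sub>R k \<in> U" if "0 \<le> s" "s \<le> 1" "0 \<le> t" "t \<le> 1" for s t
      using that K(3) by blast
    obtain s t where st: "0 \<le> s" "s \<le> 1" "0 \<le> t" "t \<le> 1" and
      eq: "f (p + h + k) - f (p + h) - f (p + k) + f p = DD h k (p + s *\<^sub>R h + t *\<^sub>R k)"
      unfolding DD_def D_def by (rule second_difference_mean_value[OF U f inU])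
    have "\<bar>f (p + h + k) - f (p + h) - f (p + k) + f p\<bar> \<le> norm h * (n * (norm k * (n * A2)))"
      unfolding eq by (rule DDlin[OF inK[OF st]])
    also have "\<dots> = (n * (n * A2)) * (norm h * norm k)" by simp
    also have "\<dots> \<le> M * (norm h * norm k)" by (intro mult_right_mono M) simp
    finally show "\<bar>f (p + h + k) - f (p + h) - f (p + k) + f p\<bar> \<le> M * norm h * norm k" by simp
  qed
  then show ?thesis by (auto simp: sd_bounded_def)
qed

section \<open>The Lagrangian in a chart\<close>

lemma sd_bounded_continuous: "sd_bounded K f \<Longrightarrow> continuous_on K f"
proof -
  assume "sd_bounded K f"
  then obtain M where M: "sd_bound M K f" by (auto simp: sd_bounded_def)
  have "M-lipschitz_on K f"
    using sd_boundD(1,3)[OF M] by (auto simp: lipschitz_on_def dist_norm)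
  then show ?thesis by (rule lipschitz_on_continuous_on)
qed

lemma sd_bounded_cong:
  assumes "\<And>p. p \<in> K \<Longrightarrow> f p = f' p" "sd_bounded K f"
  shows "sd_bounded K f'"
proof -
  obtain M where "sd_bound M K f" using assms(2) by (auto simp: sd_bounded_def)
  then have "sd_bound M K f'" unfolding sd_bound_def by (simp add: assms(1))
  then show ?thesis by (auto simp: sd_bounded_def)
qed

text \<open>
  The central inequality. The states \<open>(x, v, a)\<close> and \<open>(y, w, b)\<close> are moved towards each other so
  that both accelerations become the mean of \<open>a\<close> and \<open>b\<close>. Strong convexity in the acceleration then
  lowers the sum of the two values by a multiple of the square of \<open>b - a\<close>. Everything else is a
  second difference: either the positions and velocities contribute two factors of size \<open>S\<close>, or
  they contribute one and the acceleration the other.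
\<close>
lemma crossed_midpoint_estimate:
  fixes f :: "'e::euclidean_space \<times> 'e \<times> 'e \<Rightarrow> real"
  assumes M: "sd_bound M (K1 \<times> K2 \<times> K3) f" and cvx: "convex K3"
    and conv: "2 * f (x, v, (1/2) *\<^sub>R (a + b)) - f (x, v, a) - f (x, v, b) \<le> - lam * (norm (b - a))\<^sup>2"
    and K1: "x \<in> K1" "y \<in> K1" "x + (1/2) *\<^sub>R \<phi> \<in> K1" "y - (1/2) *\<^sub>R \<phi> \<in> K1"
    and K2: "v \<in> K2" "w \<in> K2" "v + (1/2) *\<^sub>R \<phi>' \<in> K2" "w - (1/2) *\<^sub>R \<phi>' \<in> K2"
    and K3: "a \<in> K3" "b \<in> K3"
    and S: "norm (y - x) \<le> S" "norm (w - v) \<le> S" "norm \<phi> \<le> S" "norm \<phi>' \<le> S"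
  shows "f (x + (1/2) *\<^sub>R \<phi>, v + (1/2) *\<^sub>R \<phi>', a + (1/2) *\<^sub>R (b - a)) + f (y - (1/2) *\<^sub>R \<phi>, w - (1/2) *\<^sub>R \<phi>', b - (1/2) *\<^sub>R (b - a))
     - f (x, v, a) - f (y, w, b) \<le> - lam * (norm (b - a))\<^sup>2 + M * (3 * S\<^sup>2 + S * norm (b - a))"
proof -
  define m where "m = (1/2) *\<^sub>R (a + b)"
  have m1: "a + (1/2) *\<^sub>R (b - a) = m" and m2: "b - (1/2) *\<^sub>R (b - a) = m"
    by (simp_all add: m_def algebra_simps flip: scaleR_add_left)
  have mK: "m \<in> K3"
    using convexD[OF cvx K3, of "1/2" "1/2"] by (simp add: m_def scaleR_add_right)
  have M0: "0 \<le> M" and S0: "0 \<le> S" using sd_boundD(1)[OF M] order_trans[OF norm_ge_zero S(1)] by auto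
  have pn: "norm (p, q, r) \<le> norm p + norm q + norm r" for p q r :: 'e
    using order_trans[OF norm_Pair_le add_left_mono[OF norm_Pair_le]] by (simp add: add.assoc)
  define \<psi> where "\<psi> = ((1/2) *\<^sub>R \<phi>, (1/2) *\<^sub>R \<phi>', 0 :: 'e)"
  define k where "k = (y - x - (1/2) *\<^sub>R \<phi>, w - v - (1/2) *\<^sub>R \<phi>', 0 :: 'e)"
  have n1: "norm \<psi> \<le> S"
    unfolding \<psi>_def by (rule order_trans[OF pn]) (use S in simp)
  have n2: "norm k \<le> 3 * S"
    unfolding k_def
    by (rule order_trans[OF pn])
      (use S norm_triangle_ineq4[of "y - x" "(1/2) *\<^sub>R \<phi>"] norm_triangle_ineq4[of "w - v" "(1/2) *\<^sub>R \<phi>'"] in simp)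
  (* Undo the perturbation of position and velocity at the common acceleration m. *)
  have "\<bar>f ((x, v, m) + \<psi> + k) - f ((x, v, m) + \<psi>) - f ((x, v, m) + k) + f (x, v, m)\<bar> \<le> M * norm \<psi> * norm k"
    by (rule sd_boundD(4)[OF M]) (use K1 K2 mK in \<open>simp_all add: \<psi>_def k_def algebra_simps\<close>)
  also have "\<dots> \<le> M * S * (3 * S)"
    using n1 n2 M0 S0 by (intro mult_mono) auto
  finally have 1: "f (x + (1/2) *\<^sub>R \<phi>, v + (1/2) *\<^sub>R \<phi>', m) + f (y - (1/2) *\<^sub>R \<phi>, w - (1/2) *\<^sub>R \<phi>', m)
      \<le> f (y, w, m) + f (x, v, m) + M * S * (3 * S)"
    by (simp add: \<psi>_def k_def algebra_simps)
  define h where "h = (0 :: 'e, 0 :: 'e, b - m)"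
  define d where "d = (y - x, w - v, 0 :: 'e)"
  have bm: "norm h \<le> norm (b - a) / 2"
  proof -
    have "norm h \<le> norm (b - m)" unfolding h_def by (rule order_trans[OF pn]) simp
    also have "b - m = (1/2) *\<^sub>R (b - a)" using m2 by (simp add: algebra_simps)
    finally show ?thesis by simp
  qed
  have n4: "norm d \<le> 2 * S"
    unfolding d_def by (rule order_trans[OF pn]) (use S in simp)
  (* Carry the step from m to b over from the state of y to that of x, where convexity is applied. *)
  have "\<bar>f ((x, v, m) + h + d) - f ((x, v, m) + h) - f ((x, v, m) + d) + f (x, v, m)\<bar> \<le> M * norm h * norm d"
    by (rule sd_boundD(4)[OF M]) (use K1 K2 K3 mK in \<open>simp_all add: h_def d_def algebra_simps\<close>)
  also have "\<dots> \<le> M * (norm (b - a) / 2) * (2 * S)"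
    using bm n4 M0 by (intro mult_mono) auto
  finally have 2: "f (y, w, m) + f (x, v, b) \<le> f (y, w, b) + f (x, v, m) + M * (norm (b - a) / 2) * (2 * S)"
    by (simp add: h_def d_def algebra_simps)
  have 3: "2 * f (x, v, m) - f (x, v, a) - f (x, v, b) \<le> - lam * (norm (b - a))\<^sup>2"
    using conv by (simp add: m_def)
  show ?thesis
    unfolding m1 m2 using 1 2 3 by (simp add: power2_eq_square algebra_simps)
qed

text \<open>
  Moving one state in two opposite directions costs only a second order term.
\<close>
lemma symmetric_perturbation_estimate:
  assumes M: "sd_bound M K f" and K: "p \<in> K" "p + q \<in> K" "p - q \<in> K"
  shows "f (p + q) + f (p - q) - 2 * f p \<le> M * (norm q)\<^sup>2"
proof -
  have "\<bar>f (p - q + q + q) - f (p - q + q) - f (p - q + q) + f (p - q)\<bar> \<le> M * norm q * norm q"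
    by (rule sd_boundD(4)[OF M]) (use K in simp_all)
  then show ?thesis by (simp add: power2_eq_square)
qed

locale lagrangian = riemannian_atlas A g
  for A :: "('q::{t2_space, second_countable_topology}, 'e::euclidean_space) chart set"
    and g :: "('q, 'e) metric" +
  fixes V :: "'q \<Rightarrow> real"
  assumes potential: "smooth_function A V"
begin

text \<open>
  The coordinates of the covariant acceleration, from position, velocity and second derivative.
\<close>
definition accel :: "('q, 'e) chart \<Rightarrow> 'e \<times> 'e \<times> 'e \<Rightarrow> 'e" where
  "accel c = (\<lambda>(x, v, a). a + christoffel A g c x v v)"

text \<open>
  The integrand of the action as a function of the coordinates of a path, of its velocity and of
  its second derivative.
\<close>
definition lagr :: "('q, 'e) chart \<Rightarrow> 'e \<times> 'e \<times> 'e \<Rightarrow> real" where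
  "lagr c p = 1 / 2 * G c (fst p) (accel c p) (accel c p) + V (chart_inv c (fst p))"

text \<open>
  The function \<open>(x, u) \<mapsto> G x u u\<close> is continuous and positive on the compact product of \<open>K\<close> with the
  unit sphere.
\<close>
lemma G_coercive:
  assumes c: "c \<in> A" and K: "compact K" "K \<subseteq> chart_img c"
  obtains lam where "0 < lam" "\<And>x u. x \<in> K \<Longrightarrow> lam * (norm u)\<^sup>2 \<le> G c x u u"
proof (cases "K = {}")
  case True
  then show ?thesis using that[of 1] by simp
next
  case False
  let ?S = "sphere 0 1 :: 'e set"
  have ne: "K \<times> ?S \<noteq> {}"
  proof -
    obtain b :: 'e where "b \<in> Basis" using nonempty_Basis by blast
    then have "b \<in> ?S" by simp
    then show ?thesis using False by blast
  qed
  let ?F = "\<lambda>p. \<Sum>i\<in>Basis. \<Sum>j\<in>Basis. ((snd p \<bullet> i) * (snd p \<bullet> j)) *\<^sub>R G c (fst p) i j"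
  have "continuous_on K (\<lambda>x. G c x i j)" for i j
    using Ck_on_continuous[OF smooth_on_Ck[OF G_smooth[OF c]]] K(2) continuous_on_subset by blast
  then have "continuous_on (K \<times> ?S) (\<lambda>p. G c (fst p) i j)" for i j
    using continuous_on_compose2[of K "\<lambda>x. G c x i j" "K \<times> ?S" fst] continuous_on_fst[OF continuous_on_id] by auto
  then have contF: "continuous_on (K \<times> ?S) ?F"
    by (intro continuous_intros)
  have eq: "G c (fst p) (snd p) (snd p) = ?F p" if "p \<in> K \<times> ?S" for p
    by (rule bilinear_expand[OF G_bilinear[OF c]]) (use that K(2) in auto)
  have "continuous_on (K \<times> ?S) (\<lambda>p. G c (fst p) (snd p) (snd p))"
    by (rule continuous_on_eq[OF contF]) (rule eq[symmetric])
  moreover have "compact (K \<times> ?S)" using K(1) by (intro compact_Times) auto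
  ultimately obtain p where p: "p \<in> K \<times> ?S"
    "\<And>q. q \<in> K \<times> ?S \<Longrightarrow> G c (fst p) (snd p) (snd p) \<le> G c (fst q) (snd q) (snd q)"
    using continuous_attains_inf[OF _ ne] by blast
  define lam where "lam = G c (fst p) (snd p) (snd p)"
  have "lam > 0"
    unfolding lam_def by (rule G_pos[OF c]) (use p(1) K(2) in auto)
  moreover have "lam * (norm u)\<^sup>2 \<le> G c x u u" if x: "x \<in> K" for x u
  proof (cases "u = 0")
    case True
    have "G c x 0 0 = 0" using G_scale[OF c, of x 0 0 0] x K(2) by auto
    then show ?thesis using True by simp
  next
    case False
    let ?u = "(1 / norm u) *\<^sub>R u"
    have xi: "x \<in> chart_img c" using x K(2) by auto
    have "lam \<le> G c x ?u ?u"
      unfolding lam_def using p(2)[of "(x, ?u)"] x False by simp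
    also have "G c x ?u ?u = (1 / norm u) * ((1 / norm u) * G c x u u)"
      unfolding G_scale[OF c xi, of _ u ?u] G_sym[OF c xi, of u ?u] G_scale[OF c xi, of _ u u] ..
    finally show ?thesis using False by (simp add: field_simps power2_eq_square)
  qed
  ultimately show ?thesis by (rule that)
qed

text \<open>
  The Lagrangian is a polynomial in the coordinates of velocity and acceleration whose coefficients
  are built from the metric, the Christoffel symbols and the potential, all of which have bounded
  second differences on \<open>K1\<close>.
\<close>
lemma lagr_sd_bounded:
  assumes c: "c \<in> A" and K1: "compact K1" "convex K1" "K1 \<subseteq> chart_img c"
    and K2: "bounded K2" and K3: "bounded K3"
  shows "sd_bounded (K1 \<times> K2 \<times> K3) (lagr c)"
proof -
  let ?K = "K1 \<times> K2 \<times> K3"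
  have base: "sd_bounded K1 F" if "smooth_on (chart_img c) F" for F
    by (rule sd_bounded_Ck2[OF img_open[OF c] smooth_on_Ck[OF that] K1])
  have Gs: "sd_bounded K1 (\<lambda>x. G c x i j)" for i j by (rule base[OF G_smooth[OF c]])
  have DGs: "sd_bounded K1 (\<lambda>x. DG c x z i j)" for z i j
    by (rule base[OF smooth_on_derivative[OF G_smooth[OF c] img_open[OF c]]])
  have Vs: "sd_bounded K1 (\<lambda>x. V (chart_inv c x))"
    using base[of "V \<circ> chart_inv c"] potential c unfolding smooth_function_def o_def by blast
  obtain lam where lam: "0 < lam" "\<And>x u. x \<in> K1 \<Longrightarrow> lam * (norm u)\<^sup>2 \<le> G c x u u"
    using G_coercive[OF c K1(1,3)] by blast
  have \<Gamma>s: "sd_bounded K1 (\<lambda>x. christoffel A g c x j k \<bullet> i)" if i: "i \<in> Basis" for i j k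
  proof (rule sd_bounded_solve[where B = "G c", OF _ lam Gs _ i])
    show "bilinear (G c x)" if "x \<in> K1" for x using G_bilinear[OF c] that K1(3) by blast
    fix l :: 'e
    have "sd_bounded K1 (\<lambda>x. (1/2) * (DG c x j k l + (DG c x k j l + (- 1) * DG c x l j k)))"
      by (intro sd_bounded_mult sd_bounded_add sd_bounded_const DGs)
    then show "sd_bounded K1 (\<lambda>x. G c x (christoffel A g c x j k) l)"
      by (rule sd_bounded_cong[rotated]) (use koszul[OF c, of _ j k l] K1(3) in auto)
  qed
  have fst1: "sd_bounded ?K (\<lambda>p. F (fst p))" if "sd_bounded K1 F" for F
    by (rule sd_bounded_compose_linear[OF bounded_linear_fst _ that]) auto
  have lin2: "sd_bounded ?K (\<lambda>p. fst (snd p) \<bullet> i)" for i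
    by (rule sd_bounded_compose_linear[of "\<lambda>p. fst (snd p)" _ K2 "\<lambda>v. v \<bullet> i"])
      (auto intro!: bounded_linear_fst_comp bounded_linear_snd sd_bounded_linear bounded_linear_inner_left K2)
  have lin3: "sd_bounded ?K (\<lambda>p. snd (snd p) \<bullet> i)" for i
    by (rule sd_bounded_compose_linear[of "\<lambda>p. snd (snd p)" _ K3 "\<lambda>v. v \<bullet> i"])
      (auto intro!: bounded_linear_snd_comp bounded_linear_snd sd_bounded_linear bounded_linear_inner_left K3)
  let ?a = "\<lambda>i p. snd (snd p) \<bullet> i + (\<Sum>j\<in>Basis. \<Sum>k\<in>Basis. ((fst (snd p) \<bullet> j) * (fst (snd p) \<bullet> k)) *
    (christoffel A g c (fst p) j k \<bullet> i))"
  have as: "sd_bounded ?K (?a i)" if "i \<in> Basis" for i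
    by (intro sd_bounded_add sd_bounded_sum sd_bounded_mult lin2 lin3 fst1[OF \<Gamma>s[OF that]])
  let ?L = "\<lambda>p. (1/2) * (\<Sum>i\<in>Basis. \<Sum>j\<in>Basis. (?a i p * ?a j p) * G c (fst p) i j) + V (chart_inv c (fst p))"
  have "sd_bounded ?K ?L"
    by (intro sd_bounded_add sd_bounded_mult sd_bounded_const sd_bounded_sum as fst1[OF Gs] fst1[OF Vs])
  moreover have "?L p = lagr c p" if "p \<in> ?K" for p
  proof -
    obtain x v a where p: "p = (x, v, a)" by (cases p) auto
    have x: "x \<in> chart_img c" using that K1(3) p by auto
    have "accel c p \<bullet> i = ?a i p" for i
    proof -
      have "accel c p = a + christoffel A g c x v v" by (simp add: accel_def p)
      then show ?thesis
        unfolding bilinear_expand[OF christoffel_bilinear[OF c x], of v v]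
        by (simp add: p inner_add_left inner_sum_left)
    qed
    then show ?thesis
      unfolding lagr_def p fst_conv bilinear_expand[OF G_bilinear[OF c x], of "accel c (x, v, a)" "accel c (x, v, a)"]
      by (simp add: p)
  qed
  ultimately show ?thesis by (rule sd_bounded_cong[rotated])
qed

text \<open>
  The Lagrangian is quadratic in the acceleration, with leading part half the metric.
\<close>
lemma lagr_strongly_convex:
  assumes c: "c \<in> A" and x: "x \<in> chart_img c" and lam: "\<And>u. lam * (norm u)\<^sup>2 \<le> G c x u u"
  shows "2 * lagr c (x, v, (1/2) *\<^sub>R (a + b)) - lagr c (x, v, a) - lagr c (x, v, b) \<le> - (lam / 4) * (norm (b - a))\<^sup>2"
proof -
  define \<alpha> where "\<alpha> = accel c (x, v, a)"
  define \<beta> where "\<beta> = accel c (x, v, b)"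
  note bil = G_bilinear[OF c x]
  have mid: "accel c (x, v, (1/2) *\<^sub>R (a + b)) = (1/2) *\<^sub>R (\<alpha> + \<beta>)"
    by (simp add: \<alpha>_def \<beta>_def accel_def algebra_simps flip: scaleR_add_left)
  have d: "\<beta> - \<alpha> = b - a" by (simp add: \<alpha>_def \<beta>_def accel_def)
  note e = bilinear_ladd[OF bil] bilinear_radd[OF bil] bilinear_lsub[OF bil] bilinear_rsub[OF bil]
    bilinear_lmul[OF bil] bilinear_rmul[OF bil]
  have "2 * lagr c (x, v, (1/2) *\<^sub>R (a + b)) - lagr c (x, v, a) - lagr c (x, v, b) = - (1/4) * G c x (\<beta> - \<alpha>) (\<beta> - \<alpha>)"
    unfolding lagr_def fst_conv mid \<alpha>_def[symmetric] \<beta>_def[symmetric]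
    by (simp add: e G_sym[OF c x, of \<beta> \<alpha>] algebra_simps)
  also have "\<dots> \<le> - (lam / 4) * (norm (b - a))\<^sup>2"
    unfolding d using lam[of "b - a"] by (simp add: algebra_simps)
  finally show ?thesis .
qed

end

section \<open>Piecewise smooth curves and splicing\<close>

text \<open>
  The existence of break points, split off from \<open>C\<^sup>1\<close> smoothness on the whole interval because the two
  behave differently when curves are joined: pieces can simply be concatenated, whereas
  \<open>C\<^sup>1\<close> smoothness needs equal velocities.
\<close>
definition piecewise_smooth ::
  "('q::topological_space, 'e::euclidean_space) chart set \<Rightarrow> real \<Rightarrow> real \<Rightarrow> (real \<Rightarrow> 'q) \<Rightarrow> bool" where
  "piecewise_smooth A a b \<gamma> \<longleftrightarrow> (\<exists>(n::nat) \<tau>. \<tau> 0 = a \<and> \<tau> n = b \<and>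
        (\<forall>i<n. \<tau> i < \<tau> (Suc i) \<and> smooth_curve A {\<tau> i..\<tau> (Suc i)} \<gamma>))"

lemma piecewise_smooth_C1_iff:
  "piecewise_smooth_C1_curve A a b \<gamma> \<longleftrightarrow> Ck_curve A 1 {a..b} \<gamma> \<and> piecewise_smooth A a b \<gamma>"
  by (simp add: piecewise_smooth_C1_curve_def piecewise_smooth_def)

lemma piecewise_smooth_refl: "piecewise_smooth A a a \<gamma>"
  unfolding piecewise_smooth_def by (intro exI[of _ 0] exI[of _ "\<lambda>_. a"]) simp

lemma piecewise_smooth_snoc:
  assumes "piecewise_smooth A a m \<gamma>" "m < b" "smooth_curve A {m..b} \<gamma>"
  shows "piecewise_smooth A a b \<gamma>"
proof -
  obtain n \<tau> where \<tau>: "\<tau> 0 = a" "\<tau> n = m"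
    "\<And>i. i < n \<Longrightarrow> \<tau> i < \<tau> (Suc i) \<and> smooth_curve A {\<tau> i..\<tau> (Suc i)} \<gamma>"
    using assms(1) unfolding piecewise_smooth_def by blast
  have "(\<tau>(Suc n := b)) i < (\<tau>(Suc n := b)) (Suc i) \<and>
      smooth_curve A {(\<tau>(Suc n := b)) i..(\<tau>(Suc n := b)) (Suc i)} \<gamma>" if "i < Suc n" for i
    using that \<tau> assms(2,3) by (cases "i = n") auto
  then show ?thesis
    unfolding piecewise_smooth_def using \<tau>
    by (intro exI[of _ "Suc n"] exI[of _ "\<tau>(Suc n := b)"]) auto
qed

text \<open>
  Induction over the pieces, from left to right.
\<close>
lemma piecewise_smooth_induct [consumes 1, case_names refl snoc]:
  assumes "piecewise_smooth A a b \<gamma>" and base: "P a"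
    and step: "\<And>m b. \<lbrakk>piecewise_smooth A a m \<gamma>; P m; m < b; smooth_curve A {m..b} \<gamma>\<rbrakk> \<Longrightarrow> P b"
  shows "P b"
proof -
  obtain n \<tau> where \<tau>: "\<tau> 0 = a" "\<tau> n = b"
    "\<And>i. i < n \<Longrightarrow> \<tau> i < \<tau> (Suc i) \<and> smooth_curve A {\<tau> i..\<tau> (Suc i)} \<gamma>"
    using assms(1) unfolding piecewise_smooth_def by blast
  have "i \<le> n \<Longrightarrow> piecewise_smooth A a (\<tau> i) \<gamma> \<and> P (\<tau> i)" for i
  proof (induction i)
    case 0
    then show ?case using \<tau> base piecewise_smooth_refl by metis
  next
    case (Suc i)
    then show ?case using \<tau>(3)[of i] step piecewise_smooth_snoc by (metis Suc_le_eq less_imp_le)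
  qed
  then show ?thesis using \<tau>(2) by blast
qed

lemma piecewise_smooth_le: "piecewise_smooth A a b \<gamma> \<Longrightarrow> a \<le> b"
  by (induction rule: piecewise_smooth_induct) simp_all

lemma piecewise_smooth_append:
  assumes 1: "piecewise_smooth A a m \<gamma>" and 2: "piecewise_smooth A m b \<gamma>"
  shows "piecewise_smooth A a b \<gamma>"
  using 2 by (induction rule: piecewise_smooth_induct) (use 1 piecewise_smooth_snoc in blast)+

lemma smooth_curve_cong:
  assumes "\<And>t. t \<in> I \<Longrightarrow> \<gamma> t = \<gamma>' t" "smooth_curve A I \<gamma>"
  shows "smooth_curve A I \<gamma>'"
  using Ck_curve_cong[of I \<gamma> \<gamma>'] assms unfolding smooth_curve_def by blast

lemma piecewise_smooth_cong:
  assumes "piecewise_smooth A a b \<gamma>" "\<And>t. t \<in> {a..b} \<Longrightarrow> \<gamma> t = \<gamma>' t"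
  shows "piecewise_smooth A a b \<gamma>'"
proof -
  have "(\<forall>t\<in>{a..b}. \<gamma> t = \<gamma>' t) \<longrightarrow> piecewise_smooth A a b \<gamma>'"
    using assms(1)
  proof (induction rule: piecewise_smooth_induct)
    case refl
    then show ?case by (simp add: piecewise_smooth_refl)
  next
    case (snoc m b)
    have le: "a \<le> m" using snoc.hyps(1) piecewise_smooth_le by blast
    show ?case
    proof
      assume eq: "\<forall>t\<in>{a..b}. \<gamma> t = \<gamma>' t"
      have "piecewise_smooth A a m \<gamma>'" using snoc eq by auto
      moreover have "smooth_curve A {m..b} \<gamma>'"
        by (rule smooth_curve_cong[OF _ snoc.hyps(3)]) (use eq le in auto)
      ultimately show "piecewise_smooth A a b \<gamma>'" using snoc.hyps(2) piecewise_smooth_snoc by blast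
    qed
  qed
  then show ?thesis using assms(2) by blast
qed

context chart_atlas
begin

lemma smooth_curve_subset:
  "\<lbrakk>smooth_curve A {a..b} \<gamma>; {s..e} \<subseteq> {a..b}; s < e\<rbrakk> \<Longrightarrow> smooth_curve A {s..e} \<gamma>"
  using Ck_curve_subset dom_open unfolding smooth_curve_def by blast

lemma piecewise_smooth_restrict:
  assumes "piecewise_smooth A a b \<gamma>" "a \<le> s" "s \<le> e" "e \<le> b"
  shows "piecewise_smooth A s e \<gamma>"
proof (cases "s = e")
  case True
  then show ?thesis by (simp add: piecewise_smooth_refl)
next
  case False
  have "\<forall>s e. a \<le> s \<and> s < e \<and> e \<le> b \<longrightarrow> piecewise_smooth A s e \<gamma>"
    using assms(1)
  proof (induction rule: piecewise_smooth_induct)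
    case (snoc m b)
    show ?case
    proof (intro allI impI)
      fix s e assume se: "a \<le> s \<and> s < e \<and> e \<le> b"
      show "piecewise_smooth A s e \<gamma>"
      proof (cases "e \<le> m")
        case True
        then show ?thesis using snoc se by blast
      next
        case False
        have "piecewise_smooth A s (max s m) \<gamma>"
          using snoc.IH se by (cases "s < m") (auto simp: piecewise_smooth_refl max_def)
        moreover have "smooth_curve A {max s m..e} \<gamma>"
          by (rule smooth_curve_subset[OF snoc.hyps(3)]) (use se False in auto)
        ultimately show ?thesis
          using piecewise_smooth_snoc[of A s "max s m" \<gamma> e] se False by auto
      qed
    qed
  qed auto
  then show ?thesis using assms False by auto
qed

lemma piecewise_smooth_right:
  assumes "piecewise_smooth A a b \<gamma>" "a \<le> T" "T < b"
  shows "\<exists>d>0. \<forall>d'. 0 < d' \<and> d' \<le> d \<longrightarrow> smooth_curve A {T..T + d'} \<gamma>"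
proof -
  have "a \<le> T \<and> T < b \<longrightarrow> (\<exists>d>0. \<forall>d'. 0 < d' \<and> d' \<le> d \<longrightarrow> smooth_curve A {T..T + d'} \<gamma>)"
    using assms(1)
  proof (induction rule: piecewise_smooth_induct)
    case (snoc m b)
    show ?case
    proof (cases "T < m")
      case False
      have "smooth_curve A {T..T + d'} \<gamma>" if "T < b" "0 < d' \<and> d' \<le> b - T" for d'
        by (rule smooth_curve_subset[OF snoc.hyps(3)]) (use that False in auto)
      then show ?thesis by (intro impI exI[of _ "b - T"]) auto
    qed (use snoc in auto)
  qed auto
  then show ?thesis using assms by blast
qed

lemma piecewise_smooth_left:
  assumes "piecewise_smooth A a b \<gamma>" "a < T" "T \<le> b"
  shows "\<exists>d>0. \<forall>d'. 0 < d' \<and> d' \<le> d \<longrightarrow> smooth_curve A {T - d'..T} \<gamma>"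
proof -
  have "a < T \<and> T \<le> b \<longrightarrow> (\<exists>d>0. \<forall>d'. 0 < d' \<and> d' \<le> d \<longrightarrow> smooth_curve A {T - d'..T} \<gamma>)"
    using assms(1)
  proof (induction rule: piecewise_smooth_induct)
    case (snoc m b)
    show ?case
    proof (cases "T \<le> m")
      case False
      have "smooth_curve A {T - d'..T} \<gamma>" if "T \<le> b" "0 < d' \<and> d' \<le> T - m" for d'
        by (rule smooth_curve_subset[OF snoc.hyps(3)]) (use that False in auto)
      then show ?thesis using False by (intro impI exI[of _ "T - m"]) auto
    qed (use snoc in auto)
  qed auto
  then show ?thesis using assms by blast
qed

lemma velocity_interior:
  assumes "{s..e} \<subseteq> {a..b}" "r \<in> {s<..<e}"
  shows "velocity A {a..b} \<gamma> r = velocity A {s..e} \<gamma> r"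
proof -
  have "r \<in> interior {s..e}" "r \<in> interior {a..b}" using assms by auto
  then have eq: "at r within {a..b} = at r within {s..e}" by (metis at_within_interior)
  show ?thesis unfolding velocity_def eq ..
qed

lemma admissible_restrict:
  assumes adm: "\<gamma> \<in> admissible_curves A a b \<xi> \<eta>" and sub: "a \<le> s" "s < e" "e \<le> b"
  shows "restrict \<gamma> {s..e} \<in> admissible_curves A s e
    (\<gamma> s, velocity A {a..b} \<gamma> s) (\<gamma> e, velocity A {a..b} \<gamma> e)"
proof -
  let ?\<gamma> = "restrict \<gamma> {s..e}"
  have C1: "Ck_curve A 1 {a..b} \<gamma>" and pw: "piecewise_smooth A a b \<gamma>"
    using adm by (auto simp: admissible_curves_def piecewise_smooth_C1_iff)
  have sub': "{s..e} \<subseteq> {a..b}" using sub by auto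
  have "Ck_curve A 1 {s..e} ?\<gamma>"
    by (rule Ck_curve_cong[OF _ Ck_curve_subset[OF C1 sub' sub(2) dom_open]]) auto
  moreover have "piecewise_smooth A s e ?\<gamma>"
    by (rule piecewise_smooth_cong[OF piecewise_smooth_restrict[OF pw]]) (use sub in auto)
  moreover have "velocity A {s..e} ?\<gamma> t = velocity A {a..b} \<gamma> t" if "t \<in> {s..e}" for t
    using velocity_cong[of "{s..e}" ?\<gamma> \<gamma> t A] velocity_subset[OF C1 sub' sub(2) that dom_open] that by simp
  ultimately show ?thesis
    using sub by (simp add: admissible_curves_def piecewise_smooth_C1_iff)
qed

definition splice_curve :: "real \<Rightarrow> real \<Rightarrow> (real \<Rightarrow> 'q) \<Rightarrow> (real \<Rightarrow> 'q) \<Rightarrow> real \<Rightarrow> 'q" where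
  "splice_curve s e r \<gamma> t = (if t \<in> {s..e} then r t else \<gamma> t)"

text \<open>
  Replacing a stretch of an admissible curve by a curve with the same end data keeps it \<open>C\<^sup>1\<close>, as the
  velocities at both joints agree. The velocities are all compared by restriction to subintervals,
  and the degenerate cases are those where the stretch reaches an end point of \<open>{a..b}\<close>.
\<close>
lemma admissible_splice:
  assumes adm: "\<gamma> \<in> admissible_curves A a b \<xi> \<eta>" and sub: "a \<le> s" "s < e" "e \<le> b"
    and r: "r \<in> admissible_curves A s e (\<gamma> s, velocity A {a..b} \<gamma> s) (\<gamma> e, velocity A {a..b} \<gamma> e)"
  shows "splice_curve s e r \<gamma> \<in> admissible_curves A a b \<xi> \<eta>"
proof -
  let ?\<sigma> = "splice_curve s e r \<gamma>"
  have C1: "Ck_curve A 1 {a..b} \<gamma>" and pw: "piecewise_smooth A a b \<gamma>" and ext: "\<gamma> \<in> extensional {a..b}"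
    and ends: "\<xi> = (\<gamma> a, velocity A {a..b} \<gamma> a)" "\<eta> = (\<gamma> b, velocity A {a..b} \<gamma> b)"
    using adm by (auto simp: admissible_curves_def piecewise_smooth_C1_iff)
  have C1r: "Ck_curve A 1 {s..e} r" and pwr: "piecewise_smooth A s e r"
    and re: "r s = \<gamma> s" "r e = \<gamma> e" "velocity A {s..e} r s = velocity A {a..b} \<gamma> s"
      "velocity A {s..e} r e = velocity A {a..b} \<gamma> e"
    using r by (auto simp: admissible_curves_def piecewise_smooth_C1_iff)
  have eq1: "?\<sigma> t = \<gamma> t" if "t \<in> {a..s}" for t using that re sub by (auto simp: splice_curve_def)
  have eq2: "?\<sigma> t = r t" if "t \<in> {s..e}" for t using that by (auto simp: splice_curve_def)
  have eq3: "?\<sigma> t = \<gamma> t" if "t \<in> {e..b}" for t using that re sub by (auto simp: splice_curve_def)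
  have C2: "Ck_curve A 1 {s..e} ?\<sigma>" by (rule Ck_curve_cong[OF _ C1r]) (simp add: eq2)
  have v2: "velocity A {s..e} ?\<sigma> t = velocity A {s..e} r t" if "t \<in> {s..e}" for t
    by (rule velocity_cong[OF _ that]) (simp add: eq2)
  have C12: "Ck_curve A 1 {a..e} ?\<sigma>"
  proof (cases "a = s")
    case False
    then have as: "a < s" using sub by simp
    have sub1: "{a..s} \<subseteq> {a..b}" using sub by auto
    show ?thesis
    proof (rule Ck_curve_glue[OF as sub(2) _ C2 _ dom_open])
      show "Ck_curve A 1 {a..s} ?\<sigma>"
        by (rule Ck_curve_cong[OF _ Ck_curve_subset[OF C1 sub1 as dom_open]]) (simp add: eq1)
      have "velocity A {a..s} ?\<sigma> s = velocity A {a..s} \<gamma> s"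
        by (rule velocity_cong) (use eq1 as in auto)
      then show "velocity A {a..s} ?\<sigma> s = velocity A {s..e} ?\<sigma> s"
        using velocity_subset[OF C1 sub1 as _ dom_open, of s] v2[of s] re as sub by auto
    qed
  qed (use C2 in simp)
  have C123: "Ck_curve A 1 {a..b} ?\<sigma>"
  proof (cases "e = b")
    case False
    then have eb: "e < b" using sub by simp
    have ae: "a < e" using sub by simp
    have sub3: "{e..b} \<subseteq> {a..b}" using sub by auto
    show ?thesis
    proof (rule Ck_curve_glue[OF ae eb C12 _ _ dom_open])
      show "Ck_curve A 1 {e..b} ?\<sigma>"
        by (rule Ck_curve_cong[OF _ Ck_curve_subset[OF C1 sub3 eb dom_open]]) (simp add: eq3)
      have "velocity A {e..b} ?\<sigma> e = velocity A {e..b} \<gamma> e"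
        by (rule velocity_cong) (use eq3 eb in auto)
      also have "\<dots> = velocity A {a..b} \<gamma> e"
        by (rule velocity_subset[OF C1 sub3 eb _ dom_open]) (use eb in auto)
      also have "\<dots> = velocity A {s..e} ?\<sigma> e" using v2[of e] re sub by simp
      also have "\<dots> = velocity A {a..e} ?\<sigma> e"
        by (rule velocity_subset[OF C12 _ sub(2) _ dom_open]) (use sub in auto)
      finally show "velocity A {a..e} ?\<sigma> e = velocity A {e..b} ?\<sigma> e" by simp
    qed
  qed (use C12 in simp)
  have pws: "piecewise_smooth A a b ?\<sigma>"
  proof -
    have "piecewise_smooth A a s ?\<sigma>"
      by (rule piecewise_smooth_cong[OF piecewise_smooth_restrict[OF pw]]) (use sub eq1 in auto)
    moreover have "piecewise_smooth A s e ?\<sigma>"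
      by (rule piecewise_smooth_cong[OF pwr]) (use eq2 in auto)
    moreover have "piecewise_smooth A e b ?\<sigma>"
      by (rule piecewise_smooth_cong[OF piecewise_smooth_restrict[OF pw]]) (use sub eq3 in auto)
    ultimately show ?thesis using piecewise_smooth_append by blast
  qed
  have va: "velocity A {a..b} ?\<sigma> a = velocity A {a..b} \<gamma> a"
  proof (cases "a = s")
    case True
    have "velocity A {s..e} ?\<sigma> s = velocity A {a..b} ?\<sigma> s"
      by (rule velocity_subset[OF C123 _ sub(2) _ dom_open]) (use sub in auto)
    then show ?thesis using v2[of s] re True sub by simp
  next
    case False
    then have as: "a < s" using sub by simp
    have sub1: "{a..s} \<subseteq> {a..b}" using sub by auto
    have "velocity A {a..s} ?\<sigma> a = velocity A {a..s} \<gamma> a"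
      by (rule velocity_cong) (use eq1 as in auto)
    then show ?thesis
      using velocity_subset[OF C1 sub1 as _ dom_open, of a] velocity_subset[OF C123 sub1 as _ dom_open, of a] as
      by simp
  qed
  have vb: "velocity A {a..b} ?\<sigma> b = velocity A {a..b} \<gamma> b"
  proof (cases "b = e")
    case True
    have "velocity A {s..e} ?\<sigma> e = velocity A {a..b} ?\<sigma> e"
      by (rule velocity_subset[OF C123 _ sub(2) _ dom_open]) (use sub in auto)
    then show ?thesis using v2[of e] re True sub by simp
  next
    case False
    then have eb: "e < b" using sub by simp
    have sub1: "{e..b} \<subseteq> {a..b}" using sub by auto
    have "velocity A {e..b} ?\<sigma> b = velocity A {e..b} \<gamma> b"
      by (rule velocity_cong) (use eq3 eb in auto)
    then show ?thesis
      using velocity_subset[OF C1 sub1 eb _ dom_open, of b] velocity_subset[OF C123 sub1 eb _ dom_open, of b] eb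
      by simp
  qed
  have "?\<sigma> \<in> extensional {a..b}"
    using ext sub by (auto simp: extensional_def splice_curve_def)
  moreover have "?\<sigma> a = \<gamma> a" "?\<sigma> b = \<gamma> b" using eq1[of a] eq3[of b] sub by auto
  ultimately show ?thesis
    using C123 pws va vb ends by (simp add: admissible_curves_def piecewise_smooth_C1_iff)
qed

end

section \<open>Additivity of the action and restriction of minimizers\<close>

context lagrangian
begin

abbreviation action :: "real \<Rightarrow> real \<Rightarrow> (real \<Rightarrow> 'q) \<Rightarrow> real" where
  "action \<equiv> J_functional A g V"

abbreviation minimizer where "minimizer \<equiv> global_minimizer A g V"

definition action_density :: "real set \<Rightarrow> (real \<Rightarrow> 'q) \<Rightarrow> real \<Rightarrow> real" where
  "action_density I \<gamma> t = 1 / 2 * g (\<gamma> t) (acceleration A g I \<gamma> t) (acceleration A g I \<gamma> t) + V (\<gamma> t)"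

lemma action_integral: "action a b \<gamma> = integral {a..b} (action_density {a..b} \<gamma>)"
  by (simp add: J_functional_def action_density_def[abs_def])

text \<open>
  Away from the end points the integrand of the action depends only on the germ of the curve, not on
  the parameter interval.
\<close>
lemma action_density_interior:
  assumes sub: "{s..e} \<subseteq> {a..b}" and t: "t \<in> {s<..<e}" and eq: "\<And>r. r \<in> {s..e} \<Longrightarrow> \<gamma> r = \<gamma>' r"
  shows "action_density {a..b} \<gamma> t = action_density {s..e} \<gamma>' t"
proof -
  have v: "velocity A {a..b} \<gamma> r = velocity A {s..e} \<gamma>' r" if "r \<in> {s<..<e}" for r
    using velocity_interior[OF sub that] velocity_cong[of "{s..e}" \<gamma> \<gamma>' r A] eq that by auto
  have "t \<in> interior {s..e}" "t \<in> interior {a..b}" using sub t by auto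
  note at = this[THEN at_within_interior]
  have vd: "vector_derivative (\<lambda>r. velocity A {a..b} \<gamma> r c) (at t) =
    vector_derivative (\<lambda>r. velocity A {s..e} \<gamma>' r c) (at t)" for c
  proof -
    have "((\<lambda>r. velocity A {a..b} \<gamma> r c) has_vector_derivative d) (at t) \<longleftrightarrow>
      ((\<lambda>r. velocity A {s..e} \<gamma>' r c) has_vector_derivative d) (at t)" for d
      using has_vector_derivative_transform_within_open[of "\<lambda>r. velocity A {a..b} \<gamma> r c" d t "{s<..<e}" "\<lambda>r. velocity A {s..e} \<gamma>' r c"]
        has_vector_derivative_transform_within_open[of "\<lambda>r. velocity A {s..e} \<gamma>' r c" d t "{s<..<e}" "\<lambda>r. velocity A {a..b} \<gamma> r c"]
        v t by auto
    then show ?thesis by (simp add: vector_derivative_def)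
  qed
  have pt: "\<gamma> t = \<gamma>' t" using eq t by auto
  have "acceleration A g {a..b} \<gamma> t = acceleration A g {s..e} \<gamma>' t"
    unfolding acceleration_def covariant_derivative_def at vd v[OF t] pt ..
  then show ?thesis using pt by (simp add: action_density_def)
qed

lemma action_density_chart:
  assumes se: "s < e" and C1: "Ck_curve A 1 {s..e} \<gamma>" and t: "t \<in> {s..e}"
    and c: "c \<in> A" "\<gamma> t \<in> chart_dom c"
    and d2: "((\<lambda>r. velocity A {s..e} \<gamma> r c) has_vector_derivative w) (at t within {s..e})"
  shows "action_density {s..e} \<gamma> t = lagr c (chart_map c (\<gamma> t), velocity A {s..e} \<gamma> t c, w)"
  using acceleration_norm[OF se C1 t c d2] chart_inv_map[OF c]
  by (simp add: action_density_def lagr_def accel_def)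

text \<open>
  Functions with bounded second differences are continuous, and every point has a neighbourhood on
  which \<open>lagr_sd_bounded\<close> applies.
\<close>
lemma lagr_continuous:
  assumes c: "c \<in> A"
  shows "continuous_on (chart_img c \<times> UNIV \<times> UNIV) (lagr c)"
proof -
  have "isCont (lagr c) p" if "p \<in> chart_img c \<times> UNIV \<times> UNIV" for p
  proof -
    obtain x v a where p: "p = (x, v, a)" by (cases p) auto
    have "x \<in> chart_img c" using that p by simp
    then obtain d where d: "d > 0" "cball x d \<subseteq> chart_img c"
      using img_open[OF c] open_contains_cball by blast
    let ?K = "cball x d \<times> cball v 1 \<times> cball a 1"
    have "continuous_on ?K (lagr c)"
      by (rule sd_bounded_continuous[OF lagr_sd_bounded[OF c _ _ d(2)]]) auto
    moreover have "p \<in> interior ?K"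
      using d(1) by (auto simp: interior_Times p)
    ultimately show ?thesis using continuous_on_interior by blast
  qed
  then show ?thesis
    by (meson continuous_at_imp_continuous_on)
qed

lemma action_density_continuous:
  assumes se: "s < e" and sm: "smooth_curve A {s..e} \<gamma>"
  shows "continuous_on {s..e} (action_density {s..e} \<gamma>)"
  unfolding continuous_on_eq_continuous_within
proof
  fix t assume t: "t \<in> {s..e}"
  let ?I = "{s..e}"
  obtain c where c: "c \<in> A" "\<gamma> t \<in> chart_dom c" using dom_cover by blast
  let ?S = "{r \<in> {s..e}. \<gamma> r \<in> chart_dom c}"
  have C1: "Ck_curve A 1 ?I \<gamma>" and C2: "Ck_curve A (Suc (Suc 0)) ?I \<gamma>"
    using sm by (auto simp: smooth_curve_def)
  have cont: "continuous_on ?I \<gamma>" using C1 by (simp add: Ck_curve_def)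
  note S = diff_dom_preimage[OF se cont dom_open[OF c(1)]]
  have at: "at r within ?S = at r within ?I" if "r \<in> ?S" for r
    by (rule at_within_preimage[OF cont dom_open[OF c(1)]]) (use that in auto)
  let ?v = "\<lambda>r. velocity A ?I \<gamma> r c"
  have v1: "Ck_on (Suc 0) ?S ?v"
    by (rule velocity_derivative(2)[OF C2 se c(1) dom_open[OF c(1)]])
  then obtain w where w: "\<forall>r\<in>?S. (?v has_vector_derivative w r) (at r within ?S)" "Ck_on 0 ?S w"
    unfolding Ck_on_real_Suc[OF S] by blast
  have "Ck_on (Suc (Suc 0)) ?S (chart_map c \<circ> \<gamma>)"
    using C2 c(1) unfolding Ck_curve_def by blast
  then have "continuous_on ?S (chart_map c \<circ> \<gamma>)" "continuous_on ?S ?v" "continuous_on ?S w"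
    using Ck_on_continuous v1 w(2) by blast+
  then have "continuous_on ?S (\<lambda>r. ((chart_map c \<circ> \<gamma>) r, ?v r, w r))"
    by (intro continuous_on_Pair)
  then have 1: "continuous_on ?S (\<lambda>r. lagr c ((chart_map c \<circ> \<gamma>) r, ?v r, w r))"
    by (rule continuous_on_compose2[OF lagr_continuous[OF c(1)]]) (auto simp: chart_map_img)
  have "continuous_on ?S (action_density ?I \<gamma>)"
  proof (rule continuous_on_eq[OF 1])
    fix r assume r: "r \<in> ?S"
    then have "(?v has_vector_derivative w r) (at r within ?I)" using w(1) at[OF r] by auto
    then show "lagr c ((chart_map c \<circ> \<gamma>) r, ?v r, w r) = action_density ?I \<gamma> r"
      using action_density_chart[OF se C1 _ c(1)] r by simp
  qed
  moreover have tS: "t \<in> ?S" using t c by simp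
  ultimately have "continuous (at t within ?S) (action_density ?I \<gamma>)"
    by (simp add: continuous_on_eq_continuous_within)
  then show "continuous (at t within ?I) (action_density ?I \<gamma>)" unfolding at[OF tS] .
qed

lemma action_density_spike:
  assumes sub: "{s..e} \<subseteq> {a..b}" and eq: "\<And>r. r \<in> {s..e} \<Longrightarrow> \<gamma> r = \<gamma>' r"
  shows "integral {s..e} (action_density {a..b} \<gamma>) = integral {s..e} (action_density {s..e} \<gamma>')"
    "action_density {s..e} \<gamma>' integrable_on {s..e} \<Longrightarrow> action_density {a..b} \<gamma> integrable_on {s..e}"
proof -
  have 1: "action_density {s..e} \<gamma>' t = action_density {a..b} \<gamma> t" if "t \<in> {s..e} - {s, e}" for t
    using action_density_interior[OF sub _ eq, of t] that by auto
  show "integral {s..e} (action_density {a..b} \<gamma>) = integral {s..e} (action_density {s..e} \<gamma>')"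
    by (rule integral_spike[of "{s, e}"]) (use 1 in auto)
  show "action_density {s..e} \<gamma>' integrable_on {s..e} \<Longrightarrow> action_density {a..b} \<gamma> integrable_on {s..e}"
    by (rule integrable_spike_finite[of "{s, e}"]) (use 1 in auto)
qed

text \<open>
  The integrand is continuous on each closed piece when computed with one-sided derivatives there;
  on \<open>{a..b}\<close> it differs from that only at break points.
\<close>
lemma action_density_integrable:
  assumes "piecewise_smooth A a b \<gamma>"
  shows "action_density {a..b} \<gamma> integrable_on {a..b}"
proof -
  have "b \<le> b' \<longrightarrow> action_density {a..b'} \<gamma> integrable_on {a..b}" for b'
    using assms
  proof (induction rule: piecewise_smooth_induct)
    case refl
    show ?case using integrable_on_refl[of "action_density {a..b'} \<gamma>" a] by simp
  next
    case (snoc m b)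
    show ?case
    proof
      assume b: "b \<le> b'"
      have "a \<le> m" using snoc.hyps(1) piecewise_smooth_le by blast
      have "action_density {m..b} \<gamma> integrable_on {m..b}"
        using action_density_continuous[OF snoc.hyps(2,3)] integrable_continuous_real by blast
      then have "action_density {a..b'} \<gamma> integrable_on {m..b}"
        using action_density_spike(2)[of m b a b' \<gamma> \<gamma>] b \<open>a \<le> m\<close> by auto
      then show "action_density {a..b'} \<gamma> integrable_on {a..b}"
        using Henstock_Kurzweil_Integration.integrable_combine[of a m b "action_density {a..b'} \<gamma>"] snoc b \<open>a \<le> m\<close> by auto
    qed
  qed
  then show ?thesis by simp
qed

lemma action_cong:
  assumes "\<And>t. t \<in> {s..e} \<Longrightarrow> \<gamma> t = \<gamma>' t"
  shows "action s e \<gamma> = action s e \<gamma>'"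
  unfolding action_integral by (rule action_density_spike(1)[OF order_refl assms])

lemma action_split:
  assumes pw: "piecewise_smooth A a b \<gamma>" and le: "a \<le> s" "s \<le> e" "e \<le> b"
  shows "action a b \<gamma> = action a s \<gamma> + action s e \<gamma> + action e b \<gamma>"
proof -
  let ?d = "action_density {a..b} \<gamma>"
  have i: "?d integrable_on {a..b}" by (rule action_density_integrable[OF pw])
  then have i2: "?d integrable_on {a..e}" using le integrable_on_subinterval by (metis atLeastatMost_subset_iff order_refl)
  have "integral {a..b} ?d = integral {a..e} ?d + integral {e..b} ?d"
    using Henstock_Kurzweil_Integration.integral_combine[OF _ _ i, of e] le by simp
  moreover have "integral {a..e} ?d = integral {a..s} ?d + integral {s..e} ?d"
    using Henstock_Kurzweil_Integration.integral_combine[OF _ _ i2, of s] le by simp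
  moreover have J: "integral {s'..e'} ?d = action s' e' \<gamma>" if "{s'..e'} \<subseteq> {a..b}" for s' e'
    unfolding action_integral by (rule action_density_spike(1)[OF that refl])
  moreover have "{a..s} \<subseteq> {a..b}" "{s..e} \<subseteq> {a..b}" "{e..b} \<subseteq> {a..b}" using le by auto
  ultimately show ?thesis
    using J[OF order_refl] J[of a s] J[of s e] J[of e b] by linarith
qed

lemma action_splice:
  assumes adm: "\<gamma> \<in> admissible_curves A a b \<xi> \<eta>" and sub: "a \<le> s" "s < e" "e \<le> b"
    and r: "r \<in> admissible_curves A s e (\<gamma> s, velocity A {a..b} \<gamma> s) (\<gamma> e, velocity A {a..b} \<gamma> e)"
  shows "action a b (splice_curve s e r \<gamma>) - action s e r =
    action a b \<gamma> - action s e \<gamma>"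
proof -
  let ?\<sigma> = "splice_curve s e r \<gamma>"
  have pw: "piecewise_smooth A a b \<gamma>" "piecewise_smooth A a b ?\<sigma>"
    using adm admissible_splice[OF adm sub r] by (auto simp: admissible_curves_def piecewise_smooth_C1_iff)
  have re: "r s = \<gamma> s" "r e = \<gamma> e" using r by (auto simp: admissible_curves_def)
  have "action a s ?\<sigma> = action a s \<gamma>"
    "action s e ?\<sigma> = action s e r"
    "action e b ?\<sigma> = action e b \<gamma>"
    by (rule action_cong; use re sub in \<open>auto simp: splice_curve_def\<close>)+
  then show ?thesis
    using action_split[OF pw(1), of s e] action_split[OF pw(2), of s e] sub by simp
qed

lemma minimizer_restrict:
  assumes min: "minimizer a b \<xi> \<eta> q" and sub: "a \<le> s" "s < e" "e \<le> b"
  shows "minimizer s e (q s, velocity A {a..b} q s) (q e, velocity A {a..b} q e) (restrict q {s..e})"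
proof -
  have adm: "q \<in> admissible_curves A a b \<xi> \<eta>" using min by (simp add: global_minimizer_def)
  have "action s e (restrict q {s..e}) \<le> action s e r"
    if r: "r \<in> admissible_curves A s e (q s, velocity A {a..b} q s) (q e, velocity A {a..b} q e)" for r
  proof -
    have "action a b q \<le> action a b (splice_curve s e r q)"
      using min admissible_splice[OF adm sub r] by (simp add: global_minimizer_def)
    moreover have "action s e (restrict q {s..e}) = action s e q"
      by (rule action_cong) simp
    ultimately show ?thesis using action_splice[OF adm sub r] by simp
  qed
  then show ?thesis
    using admissible_restrict[OF adm sub] by (simp add: global_minimizer_def)
qed

text \<open>
  Splicing a minimizer for the data induced by \<open>q\<close> into the minimizer \<open>q\<close> does not raise the action.
\<close>
lemma minimizer_splice:
  assumes min: "minimizer a b \<xi> \<eta> q" and sub: "a \<le> s" "s < e" "e \<le> b"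
    and r: "minimizer s e (q s, velocity A {a..b} q s) (q e, velocity A {a..b} q e) r"
  shows "minimizer a b \<xi> \<eta> (splice_curve s e r q)"
proof -
  have adm: "q \<in> admissible_curves A a b \<xi> \<eta>" using min by (simp add: global_minimizer_def)
  have radm: "r \<in> admissible_curves A s e (q s, velocity A {a..b} q s) (q e, velocity A {a..b} q e)"
    using r by (simp add: global_minimizer_def)
  have "action s e r \<le> action s e (restrict q {s..e})"
    using r admissible_restrict[OF adm sub] by (simp add: global_minimizer_def)
  also have "\<dots> = action s e q" by (rule action_cong) simp
  finally have "action a b (splice_curve s e r q) \<le> action a b q"
    using action_splice[OF adm sub radm] by simp
  then show ?thesis
    using min admissible_splice[OF adm sub radm] unfolding global_minimizer_def by (meson order_trans)
qed

lemma action_in_chart: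
  assumes se: "s < e" and C1: "Ck_curve A 1 {s..e} \<gamma>" and pw: "piecewise_smooth A s e \<gamma>" and c: "c \<in> A"
    and dom: "\<And>t. t \<in> {s..e} \<Longrightarrow> \<gamma> t \<in> chart_dom c"
    and x: "\<And>t. t \<in> {s..e} \<Longrightarrow> chart_map c (\<gamma> t) = x t"
    and x1: "\<And>t. t \<in> {s..e} \<Longrightarrow> (x has_vector_derivative x1 t) (at t within {s..e})"
    and x2: "\<And>t. t \<in> {s<..<e} - F \<Longrightarrow> (x1 has_vector_derivative x2 t) (at t)" and F: "finite F"
  shows "((\<lambda>t. lagr c (x t, x1 t, x2 t)) has_integral action s e \<gamma>) {s..e}"
proof -
  have vel: "velocity A {s..e} \<gamma> t c = x1 t" if t: "t \<in> {s..e}" for t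
  proof -
    have "((chart_map c \<circ> \<gamma>) has_vector_derivative x1 t) (at t within {s..e})"
      by (rule has_vector_derivative_transform[OF t _ x1[OF t]]) (simp add: x)
    then show ?thesis using vector_derivative_Icc[OF se t] c dom[OF t] by (simp add: velocity_def)
  qed
  have "(action_density {s..e} \<gamma> has_integral action s e \<gamma>) {s..e}"
    using action_density_integrable[OF pw] by (simp add: action_integral has_integral_integral)
  then show ?thesis
  proof (rule has_integral_spike_finite[of "insert s (insert e F)", rotated 2])
    fix t assume t: "t \<in> {s..e} - insert s (insert e F)"
    then have t': "t \<in> {s..e}" by auto
    have "(x1 has_vector_derivative x2 t) (at t within {s..e})"
      using x2[of t] t has_vector_derivative_at_within by fastforce
    then have "((\<lambda>r. velocity A {s..e} \<gamma> r c) has_vector_derivative x2 t) (at t within {s..e})"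
      by (rule has_vector_derivative_transform[OF t', rotated]) (simp add: vel)
    from action_density_chart[OF se C1 t' c dom[OF t'] this]
    show "lagr c (x t, x1 t, x2 t) = action_density {s..e} \<gamma> t"
      using x[OF t'] vel[OF t'] by simp
  qed (use F in auto)
qed

text \<open>
  A minimizer stays minimal when a stretch of it inside one chart is replaced by a path in coordinates
  with the same position and velocity at both ends. The comparison of paths below uses minimality in
  this form.
\<close>
lemma minimizer_in_chart:
  assumes min: "minimizer a b \<xi> \<eta> q" and sub: "a \<le> s" "s < T" "T < e" "e \<le> b"
    and c: "c \<in> A" and dom: "\<And>t. t \<in> {s..e} \<Longrightarrow> q t \<in> chart_dom c"
    and x: "\<And>t. t \<in> {s..e} \<Longrightarrow> chart_map c (q t) = x t"
    and x1: "\<And>t. t \<in> {s..e} \<Longrightarrow> (x has_vector_derivative x1 t) (at t within {s..e})"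
    and x2: "\<And>t. t \<in> {s<..<e} - {T} \<Longrightarrow> (x1 has_vector_derivative x2 t) (at t)"
    and u: "Ck_on 1 {s..e} u" "\<And>k. Ck_on k {s..T} u" "\<And>k. Ck_on k {T..e} u" "u ` {s..e} \<subseteq> chart_img c"
    and u1: "\<And>t. t \<in> {s..e} \<Longrightarrow> (u has_vector_derivative u1 t) (at t within {s..e})"
    and u2: "\<And>t. t \<in> {s<..<e} - {T} \<Longrightarrow> (u1 has_vector_derivative u2 t) (at t)"
    and ends: "u s = x s" "u e = x e" "u1 s = x1 s" "u1 e = x1 e"
  shows "\<exists>I I'. ((\<lambda>t. lagr c (x t, x1 t, x2 t)) has_integral I) {s..e} \<and>
    ((\<lambda>t. lagr c (u t, u1 t, u2 t)) has_integral I') {s..e} \<and> I \<le> I'"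
proof -
  have se: "s < e" and sub': "{s..e} \<subseteq> {a..b}" using sub by auto
  have adm: "q \<in> admissible_curves A a b \<xi> \<eta>" using min by (simp add: global_minimizer_def)
  then have C1: "Ck_curve A 1 {a..b} q" and pw: "piecewise_smooth A a b q"
    by (auto simp: admissible_curves_def piecewise_smooth_C1_iff)
  have C1q: "Ck_curve A 1 {s..e} q" by (rule Ck_curve_subset[OF C1 sub' se dom_open])
  have pwq: "piecewise_smooth A s e q" by (rule piecewise_smooth_restrict[OF pw]) (use sub in auto)
  let ?r0 = "chart_inv c \<circ> u"
  let ?r = "restrict ?r0 {s..e}"
  have C1r: "Ck_curve A 1 {s..e} ?r"
    by (rule Ck_curve_cong[OF _ Ck_curve_chart[OF c se u(1,4)]]) simp
  have sm: "smooth_curve A {s..T} ?r" "smooth_curve A {T..e} ?r"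
    unfolding smooth_curve_def
    by (intro allI Ck_curve_cong[OF _ Ck_curve_chart[OF c sub(2) u(2)]]; use u(4) sub in auto;
        intro allI Ck_curve_cong[OF _ Ck_curve_chart[OF c sub(3) u(3)]]; use u(4) sub in auto)+
  have pwr: "piecewise_smooth A s e ?r"
    using piecewise_smooth_snoc[OF piecewise_smooth_snoc[OF piecewise_smooth_refl sub(2) sm(1)] sub(3) sm(2)] .
  have domr: "?r t \<in> chart_dom c" "chart_map c (?r t) = u t" if "t \<in> {s..e}" for t
  proof -
    have "u t \<in> chart_img c" using that u(4) by blast
    then show "?r t \<in> chart_dom c" "chart_map c (?r t) = u t"
      using that chart_inv_dom[OF c] chart_map_inv[OF c] by simp_all
  qed
  have vel: "velocity A {s..e} \<gamma> t = tangent_of A c (\<gamma> t) w"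
    if "t \<in> {s..e}" "Ck_curve A 1 {s..e} \<gamma>" "\<And>t. t \<in> {s..e} \<Longrightarrow> \<gamma> t \<in> chart_dom c"
     "\<And>t. t \<in> {s..e} \<Longrightarrow> chart_map c (\<gamma> t) = y t" "(y has_vector_derivative w) (at t within {s..e})" for \<gamma> y w t
  proof -
    have "((chart_map c \<circ> \<gamma>) has_vector_derivative w) (at t within {s..e})"
      by (rule has_vector_derivative_transform[OF that(1) _ that(5)]) (simp add: that(4))
    moreover have "continuous_on {s..e} \<gamma>" using that(2) by (simp add: Ck_curve_def)
    note velocity_tangent_of[OF se this that(1) c that(3)[OF that(1)]]
    ultimately show ?thesis by blast
  qed
  have endp: "?r t = q t" "velocity A {s..e} ?r t = velocity A {a..b} q t" if "t = s \<or> t = e" for t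
  proof -
    have t: "t \<in> {s..e}" and ux: "u t = x t" "u1 t = x1 t" using that ends se by auto
    show rq: "?r t = q t" using t ux x[OF t] chart_inv_map[OF c dom[OF t]] by simp
    have "velocity A {s..e} ?r t = tangent_of A c (?r t) (u1 t)"
      by (rule vel[OF t C1r domr u1[OF t]])
    also have "\<dots> = velocity A {s..e} q t"
      unfolding rq ux by (rule vel[OF t C1q dom x x1[OF t], symmetric])
    finally show "velocity A {s..e} ?r t = velocity A {a..b} q t"
      using velocity_subset[OF C1 sub' se t dom_open] by simp
  qed
  have "?r \<in> admissible_curves A s e (q s, velocity A {a..b} q s) (q e, velocity A {a..b} q e)"
    using C1r pwr endp[of s] endp[of e] by (simp add: admissible_curves_def piecewise_smooth_C1_iff)
  then have "action s e (restrict q {s..e}) \<le> action s e ?r"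
    using minimizer_restrict[OF min sub(1) se sub(4)] by (simp add: global_minimizer_def)
  moreover have "action s e (restrict q {s..e}) = action s e q"
    by (rule action_cong) simp
  moreover have "((\<lambda>t. lagr c (x t, x1 t, x2 t)) has_integral action s e q) {s..e}"
    by (rule action_in_chart[OF se C1q pwq c dom x x1 x2]) auto
  moreover have "((\<lambda>t. lagr c (u t, u1 t, u2 t)) has_integral action s e ?r) {s..e}"
    by (rule action_in_chart[OF se C1r pwr c domr u1 u2]) auto
  ultimately show ?thesis by auto
qed

end

section \<open>Paths with one corner\<close>

text \<open>
  A \<open>C\<^sup>1\<close> path on \<open>{s..e}\<close>, smooth on both sides of \<open>T\<close>, together with its first two derivatives.
  Near any parameter a piecewise smooth curve has this form. The value of \<open>u2\<close> is unspecified at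
  \<open>T\<close> and at the end points.
\<close>
definition broken :: "real \<Rightarrow> real \<Rightarrow> real \<Rightarrow> (real \<Rightarrow> 'b::real_normed_vector) \<Rightarrow> (real \<Rightarrow> 'b) \<Rightarrow> (real \<Rightarrow> 'b) \<Rightarrow> bool" where
  "broken s T e u u1 u2 \<longleftrightarrow> Ck_on 1 {s..e} u \<and> (\<forall>k. Ck_on k {s..T} u \<and> Ck_on k {T..e} u) \<and>
    (\<forall>t\<in>{s..e}. (u has_vector_derivative u1 t) (at t within {s..e})) \<and>
    (\<forall>t\<in>{s<..<e} - {T}. (u1 has_vector_derivative u2 t) (at t))"

lemma brokenD:
  assumes "broken s T e u u1 u2"
  shows "Ck_on 1 {s..e} u" "Ck_on k {s..T} u" "Ck_on k {T..e} u"
    "t \<in> {s..e} \<Longrightarrow> (u has_vector_derivative u1 t) (at t within {s..e})"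
    "t \<in> {s<..<e} - {T} \<Longrightarrow> (u1 has_vector_derivative u2 t) (at t)"
  using assms by (auto simp: broken_def)

lemma broken_lincomb:
  assumes ord: "s < T" "T < e" and u: "broken s T e u u1 u2" and v: "broken s T e v v1 v2"
  shows "broken s T e (\<lambda>t. \<alpha> *\<^sub>R u t + \<beta> *\<^sub>R v t) (\<lambda>t. \<alpha> *\<^sub>R u1 t + \<beta> *\<^sub>R v1 t) (\<lambda>t. \<alpha> *\<^sub>R u2 t + \<beta> *\<^sub>R v2 t)"
proof -
  have C: "Ck_on k S (\<lambda>t. \<alpha> *\<^sub>R u t + \<beta> *\<^sub>R v t)" if "diff_dom S" "Ck_on k S u" "Ck_on k S v" for k S
    by (intro Ck_on_add Ck_on_bounded_linear[OF _ bounded_linear_scaleR_right] that)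
  have dd: "diff_dom {s..e}" "diff_dom {s..T}" "diff_dom {T..e}" using ord by (auto intro!: diff_dom_Icc)
  show ?thesis
    unfolding broken_def
    by (intro conjI allI ballI C dd has_vector_derivative_add brokenD[OF u] brokenD[OF v]
        bounded_linear.has_vector_derivative[OF bounded_linear_scaleR_right]; assumption)
qed

lemma broken_scaleR:
  assumes ord: "s < T" "T < e" and h: "broken s T e h h1 h2" and v: "broken s T e v v1 v2"
  shows "broken s T e (\<lambda>t. h t *\<^sub>R v t) (\<lambda>t. h t *\<^sub>R v1 t + h1 t *\<^sub>R v t)
    (\<lambda>t. (h t *\<^sub>R v2 t + h1 t *\<^sub>R v1 t) + (h1 t *\<^sub>R v1 t + h2 t *\<^sub>R v t))"
proof -
  have C: "Ck_on k S (\<lambda>t. h t *\<^sub>R v t)" if "diff_dom S" "Ck_on k S h" "Ck_on k S v" for k S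
    by (rule Ck_on_bilinear[OF that(1) bounded_bilinear_scaleR that(2,3)])
  have dd: "diff_dom {s..e}" "diff_dom {s..T}" "diff_dom {T..e}" using ord by (auto intro!: diff_dom_Icc)
  note prod = bounded_bilinear.has_vector_derivative[OF bounded_bilinear_scaleR]
  have at: "(w has_vector_derivative w1 t) (at t)" if "t \<in> {s<..<e} - {T}" "broken s T e w w1 w2"
    for w w1 w2 t
  proof -
    have "t \<in> interior {s..e}" using that by auto
    note eq = at_within_interior[OF this]
    show ?thesis using brokenD(4)[OF that(2), of t] that(1) unfolding eq by auto
  qed
  show ?thesis
    unfolding broken_def
  proof (intro conjI allI ballI)
    fix t assume t: "t \<in> {s<..<e} - {T}"
    show "((\<lambda>t. h t *\<^sub>R v1 t + h1 t *\<^sub>R v t) has_vector_derivative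
        (h t *\<^sub>R v2 t + h1 t *\<^sub>R v1 t) + (h1 t *\<^sub>R v1 t + h2 t *\<^sub>R v t)) (at t)"
      by (intro has_vector_derivative_add prod at[OF t h] at[OF t v] brokenD(5)[OF h t] brokenD(5)[OF v t])
  qed (intro C dd prod brokenD[OF h] brokenD[OF v]; assumption)+
qed

lemma broken_glue:
  assumes ord: "s < T" "T < e" and f: "\<And>k. Ck_on k {s..T} f" and g: "\<And>k. Ck_on k {T..e} g"
    and f1: "\<And>t. (f has_vector_derivative f1 t) (at t)" and f2: "\<And>t. (f1 has_vector_derivative f2 t) (at t)"
    and g1: "\<And>t. (g has_vector_derivative g1 t) (at t)" and g2: "\<And>t. (g1 has_vector_derivative g2 t) (at t)"
    and eq: "f T = g T" "f1 T = g1 T"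
  shows "broken s T e (\<lambda>t. if t \<le> T then f t else g t) (\<lambda>t. if t \<le> T then f1 t else g1 t)
    (\<lambda>t. if t \<le> T then f2 t else g2 t)"
proof -
  let ?u = "\<lambda>t. if t \<le> T then f t else g t" and ?u1 = "\<lambda>t. if t \<le> T then f1 t else g1 t"
  have Un: "{s..e} = {s..T} \<union> {T..e}" using ord by auto
  have dd: "diff_dom {s..e}" using ord by (auto intro!: diff_dom_Icc)
  have uL: "?u t = f t" "?u1 t = f1 t" if "t \<in> {s..T}" for t using that by auto
  have uR: "?u t = g t" "?u1 t = g1 t" if "t \<in> {T..e}" for t using that eq by (cases "t = T"; simp)+
  have d: "(?u has_vector_derivative ?u1 t) (at t within {s..e})" if t: "t \<in> {s..e}" for t
    unfolding Un
  proof (rule has_vector_derivative_Un)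
    show "(?u has_vector_derivative ?u1 t) (at t within {s..T})"
    proof (cases "t \<in> {s..T}")
      case True
      show ?thesis
        unfolding uL(2)[OF True]
        by (rule has_vector_derivative_transform[OF True uL(1) has_vector_derivative_at_within[OF f1]])
    qed (rule has_vector_derivative_outside_Icc[OF ord(1)])
    show "(?u has_vector_derivative ?u1 t) (at t within {T..e})"
    proof (cases "t \<in> {T..e}")
      case True
      show ?thesis
        unfolding uR(2)[OF True]
        by (rule has_vector_derivative_transform[OF True uR(1) has_vector_derivative_at_within[OF g1]])
    qed (rule has_vector_derivative_outside_Icc[OF ord(2)])
  qed
  have cf: "continuous_on S f1" "continuous_on S g1" for S
    by (rule continuous_on_vector_derivative[OF has_vector_derivative_at_within[OF f2]])
      (rule continuous_on_vector_derivative[OF has_vector_derivative_at_within[OF g2]])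
  have c1: "continuous_on {s..e} ?u1"
    unfolding Un
  proof (rule continuous_on_closed_Un)
    show "continuous_on {s..T} ?u1" by (rule continuous_on_eq[OF cf(1)]) (use uL in auto)
    show "continuous_on {T..e} ?u1" by (rule continuous_on_eq[OF cf(2)]) (use uR in auto)
  qed auto
  have "Ck_on (Suc 0) {s..e} ?u"
    unfolding Ck_on_real_Suc[OF dd] using d c1 by (intro exI[of _ ?u1]) simp
  moreover have "Ck_on k {s..T} ?u" "Ck_on k {T..e} ?u" for k
    using Ck_on_cong[OF _ f, of ?u k] Ck_on_cong[OF _ g, of ?u k] uL(1) uR(1) by simp_all
  moreover have "(?u1 has_vector_derivative (if t \<le> T then f2 t else g2 t)) (at t)" if "t \<in> {s<..<e} - {T}" for t
  proof (cases "t < T")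
    case True
    have "(?u1 has_vector_derivative f2 t) (at t)"
      by (rule has_vector_derivative_transform_within_open[OF f2 open_lessThan[of T]]) (use True in auto)
    then show ?thesis using True by simp
  next
    case False
    have "(?u1 has_vector_derivative g2 t) (at t)"
      by (rule has_vector_derivative_transform_within_open[OF g2 open_greaterThan[of T]]) (use False that in auto)
    then show ?thesis using False that by simp
  qed
  ultimately show ?thesis using d by (simp add: broken_def)
qed

lemma broken_smooth:
  assumes ord: "s < T" "T < e" and f: "\<And>k S. diff_dom S \<Longrightarrow> Ck_on k S f"
    and f1: "\<And>t. (f has_vector_derivative f1 t) (at t)" and f2: "\<And>t. (f1 has_vector_derivative f2 t) (at t)"
  shows "broken s T e f f1 f2"
  using broken_glue[OF ord f[OF diff_dom_Icc[OF ord(1)]] f[OF diff_dom_Icc[OF ord(2)]] f1 f2 f1 f2 refl refl]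
  by (simp cong: if_cong)

lemma broken_affine:
  assumes ord: "s < T" "T < e"
  shows "broken s T e (\<lambda>t. a + (t - p) *\<^sub>R b) (\<lambda>_. b) (\<lambda>_. 0)"
proof (rule broken_smooth[OF ord])
  fix k and S :: "real set" assume S: "diff_dom S"
  have "Ck_on k S (\<lambda>t. (a - p *\<^sub>R b) + t *\<^sub>R b)"
    by (intro Ck_on_add Ck_on_const Ck_on_linear bounded_linear_scaleR_left S)
  then show "Ck_on k S (\<lambda>t. a + (t - p) *\<^sub>R b)" by (simp add: algebra_simps)
qed (auto intro!: derivative_eq_intros simp: has_vector_derivative_def)

lemma C2_on_Icc_derivative_of_derivative:
  assumes lm: "l < m" and u: "Ck_on (Suc (Suc 0)) {l..m} u"
    and u1: "\<And>t. t \<in> {l..m} \<Longrightarrow> (u has_vector_derivative u1 t) (at t within {l..m})"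
  shows "\<exists>w. continuous_on {l..m} w \<and> (\<forall>t\<in>{l..m}. (u1 has_vector_derivative w t) (at t within {l..m}))"
proof -
  obtain v w where v: "\<And>t. t \<in> {l..m} \<Longrightarrow> (u has_vector_derivative v t) (at t within {l..m})"
    and w: "\<And>t. t \<in> {l..m} \<Longrightarrow> (v has_vector_derivative w t) (at t within {l..m})" "continuous_on {l..m} w"
    using u unfolding Ck_on_real_Suc[OF diff_dom_Icc[OF lm]] Ck_on.simps(1) by blast
  have "u1 t = v t" if "t \<in> {l..m}" for t
    using vector_derivative_unique_within[OF at_within_Icc_neq_bot[OF lm that] u1[OF that] v[OF that]] .
  then show ?thesis using w has_vector_derivative_transform by blast
qed

text \<open>
  On either side of \<open>T\<close> the second derivative extends continuously to the closed interval.
\<close>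
lemma broken_half:
  assumes ord: "s < T" "T < e" and u: "broken s T e u u1 u2" and lm: "l = s \<and> m = T \<or> l = T \<and> m = e"
  obtains w where "continuous_on {l..m} w" "\<And>t. t \<in> {l..m} \<Longrightarrow> (u1 has_vector_derivative w t) (at t within {l..m})"
    "\<And>t. t \<in> {l<..<m} \<Longrightarrow> w t = u2 t"
proof -
  have D: "l < m" "{l..m} \<subseteq> {s..e}" "{l<..<m} \<subseteq> {s<..<e} - {T}"
    using lm ord by auto
  have "Ck_on (Suc (Suc 0)) {l..m} u" using brokenD(2,3)[OF u] lm by blast
  moreover have "(u has_vector_derivative u1 t) (at t within {l..m})" if "t \<in> {l..m}" for t
    using brokenD(4)[OF u, of t] D(2) that has_vector_derivative_within_subset by blast
  ultimately obtain w where w: "continuous_on {l..m} w" "\<And>t. t \<in> {l..m} \<Longrightarrow> (u1 has_vector_derivative w t) (at t within {l..m})"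
    using C2_on_Icc_derivative_of_derivative[OF D(1)] by blast
  have "w t = u2 t" if "t \<in> {l<..<m}" for t
  proof -
    have "t \<in> interior {l..m}" using that by auto
    note at = at_within_interior[OF this]
    have "(u1 has_vector_derivative w t) (at t)" using w(2)[of t] that unfolding at by auto
    moreover have "(u1 has_vector_derivative u2 t) (at t)" using brokenD(5)[OF u, of t] D(3) that by blast
    ultimately show ?thesis by (rule vector_derivative_unique_at)
  qed
  then show ?thesis using that w by blast
qed

lemma broken_exists:
  assumes ord: "s < T" "T < e" and u: "Ck_on 1 {s..e} u" "\<And>k. Ck_on k {s..T} u" "\<And>k. Ck_on k {T..e} u"
  obtains u1 u2 where "broken s T e u u1 u2" "continuous_on {s..e} u1"
proof -
  have dd: "diff_dom {s..e}" "diff_dom {s..T}" "diff_dom {T..e}" using ord by (auto intro!: diff_dom_Icc)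
  have "Ck_on (Suc 0) {s..e} u" using u(1) by simp
  then obtain u1 where u1: "\<And>t. t \<in> {s..e} \<Longrightarrow> (u has_vector_derivative u1 t) (at t within {s..e})" "continuous_on {s..e} u1"
    unfolding Ck_on_real_Suc[OF dd(1)] Ck_on.simps(1) by blast
  have half: "\<exists>d. (u1 has_vector_derivative d) (at t)"
    if D: "l < m" "{l..m} \<subseteq> {s..e}" "Ck_on (Suc (Suc 0)) {l..m} u" and t: "t \<in> {l<..<m}" for l m t
  proof -
    have "(u has_vector_derivative u1 r) (at r within {l..m})" if "r \<in> {l..m}" for r
      using u1(1)[of r] D(2) that has_vector_derivative_within_subset by blast
    then obtain w where "\<forall>r\<in>{l..m}. (u1 has_vector_derivative w r) (at r within {l..m})"
      using C2_on_Icc_derivative_of_derivative[OF D(1,3)] by blast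
    moreover have "t \<in> interior {l..m}" using t by auto
    note at_within_interior[OF this]
    ultimately show ?thesis using t by (metis atLeastAtMost_iff greaterThanLessThan_iff less_imp_le)
  qed
  have "(u1 has_vector_derivative vector_derivative u1 (at t)) (at t)" if "t \<in> {s<..<e} - {T}" for t
  proof -
    have "\<exists>d. (u1 has_vector_derivative d) (at t)"
    proof (cases "t < T")
      case True
      then show ?thesis using half[of s T t] that ord u(2) by auto
    next
      case False
      then show ?thesis using half[of T e t] that ord u(3) by auto
    qed
    then show ?thesis using vector_derivative_works differentiableI_vector by blast
  qed
  then have "broken s T e u u1 (\<lambda>t. vector_derivative u1 (at t))"
    using u u1 by (simp add: broken_def)
  then show ?thesis using that u1(2) by blast
qed

text \<open>
  The cubic \<open>3 r\<^sup>2 - 2 r\<^sup>3\<close> rises from \<open>0\<close> to \<open>1\<close> on the unit interval with derivative \<open>0\<close> at both ends,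
  so it joins the constant \<open>1\<close> at \<open>T\<close> with a continuous derivative. The number \<open>18\<close> is a crude
  common bound for the cubic and its first two derivatives on the unit interval.
\<close>
lemma cutoff_exists:
  assumes ord: "s < T" "T < e" and p: "p = s \<or> p = e" and \<epsilon>: "\<epsilon> = \<bar>T - p\<bar>" "\<epsilon> \<le> 1"
  obtains h h1 h2 :: "real \<Rightarrow> real" where "broken s T e h h1 h2" "h p = 0" "h1 p = 0"
    "\<And>t. \<lbrakk>t \<in> {s..e}; t \<notin> closed_segment T p \<or> t = T\<rbrakk> \<Longrightarrow> h t = 1 \<and> h1 t = 0"
    "\<And>t. \<lbrakk>t \<in> {s..e}; t \<notin> closed_segment T p\<rbrakk> \<Longrightarrow> h2 t = 0"
    "\<And>t. t \<in> closed_segment T p \<Longrightarrow> \<bar>h t\<bar> \<le> 18 / \<epsilon>\<^sup>2 \<and> \<bar>h1 t\<bar> \<le> 18 / \<epsilon>\<^sup>2"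
    "\<And>t. t \<in> closed_segment T p - {T} \<Longrightarrow> \<bar>h2 t\<bar> \<le> 18 / \<epsilon>\<^sup>2"
proof -
  define d where "d = T - p"
  have d0: "d \<noteq> 0" and \<epsilon>0: "\<epsilon> > 0" and \<epsilon>d: "\<epsilon> = \<bar>d\<bar>" using ord p \<epsilon> by (auto simp: d_def)
  define P where "P t = 3 * ((t - p) / d)^2 - 2 * ((t - p) / d)^3" for t
  define P1 where "P1 t = (6 * ((t - p) / d) - 6 * ((t - p) / d)^2) / d" for t
  define P2 where "P2 t = (6 - 12 * ((t - p) / d)) / d^2" for t
  have r: "((\<lambda>t. (t - p) / d) has_real_derivative 1 / d) (at t)" for t
    using d0 by (auto intro!: derivative_eq_intros)
  have k1: "((\<lambda>r. 3 * r^2 - 2 * r^3) has_real_derivative 6 * r - 6 * r^2) (at r)"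
    and k2: "((\<lambda>r. (6 * r - 6 * r^2) / d) has_real_derivative (6 - 12 * r) / d) (at r)" for r :: real
    using d0 by (auto intro!: derivative_eq_intros simp: field_simps)
  have P1: "(P has_vector_derivative P1 t) (at t)" for t
    using DERIV_chain2[OF k1 r]
    by (simp add: has_real_derivative_iff_has_vector_derivative[symmetric] P_def[abs_def] P1_def)
  have P2: "(P1 has_vector_derivative P2 t) (at t)" for t
    using DERIV_chain2[OF k2 r]
    by (simp add: has_real_derivative_iff_has_vector_derivative[symmetric] P1_def[abs_def] P2_def power2_eq_square)
  have PC: "Ck_on k S P" if S: "diff_dom S" for k S
  proof -
    have l: "Ck_on k S (\<lambda>t. (- p / d) + (1 / d) * t)"
      by (intro Ck_on_add Ck_on_const Ck_on_linear bounded_linear_mult_right S)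
    note m = Ck_on_bilinear[OF S bounded_bilinear_mult]
    have "Ck_on k S (\<lambda>t. 3 * (((- p / d) + (1 / d) * t) * ((- p / d) + (1 / d) * t)) +
        (- 2) * (((- p / d) + (1 / d) * t) * (((- p / d) + (1 / d) * t) * ((- p / d) + (1 / d) * t))))"
      by (intro Ck_on_add m l Ck_on_const S)
    moreover have "(- p / d) + (1 / d) * t = (t - p) / d" for t by (simp add: diff_divide_distrib)
    ultimately show ?thesis
      unfolding P_def[abs_def] by (simp add: power2_eq_square power3_eq_cube mult.assoc)
  qed
  have PT: "P T = 1" "P1 T = 0" "P p = 0" "P1 p = 0"
    using d0 by (simp_all add: P_def P1_def flip: d_def)
  have one: "((\<lambda>_. 1::real) has_vector_derivative 0) (at t)" "((\<lambda>_. 0::real) has_vector_derivative 0) (at t)" for t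
    by (rule has_vector_derivative_const)+
  have b: "0 \<le> (t - p) / d \<and> (t - p) / d \<le> 1" if "t \<in> closed_segment T p" for t
    using that d0 by (auto simp: closed_segment_eq_real_ivl d_def field_simps split: if_splits)
  have e2: "\<epsilon>\<^sup>2 \<le> 1" "\<epsilon>\<^sup>2 \<le> \<epsilon>" "0 < \<epsilon>\<^sup>2"
    using power_le_one[of \<epsilon> 2] mult_left_le[of \<epsilon> \<epsilon>] \<epsilon>(2) \<epsilon>0 by (simp_all add: power2_eq_square)
  have H: "18 \<le> 18 / \<epsilon>\<^sup>2" "18 / \<epsilon> \<le> 18 / \<epsilon>\<^sup>2"
    using divide_left_mono[OF e2(1), of 18] divide_left_mono[OF e2(2), of 18] e2(3) \<epsilon>0 by simp_all
  have bounds: "\<bar>P t\<bar> \<le> 18 / \<epsilon>\<^sup>2" "\<bar>P1 t\<bar> \<le> 18 / \<epsilon>\<^sup>2" "\<bar>P2 t\<bar> \<le> 18 / \<epsilon>\<^sup>2" if "t \<in> closed_segment T p" for t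
  proof -
    define r where "r = (t - p) / d"
    have r: "0 \<le> r" "r \<le> 1" "0 \<le> r\<^sup>2" "r\<^sup>2 \<le> 1" "0 \<le> r^3" "r^3 \<le> 1"
      using b[OF that] by (auto simp: r_def power_le_one)
    have "\<bar>P t\<bar> \<le> 18" unfolding P_def r_def[symmetric] using r by linarith
    then show "\<bar>P t\<bar> \<le> 18 / \<epsilon>\<^sup>2" using H by linarith
    have "\<bar>6 * r - 6 * r\<^sup>2\<bar> \<le> 18" using r by linarith
    then have "\<bar>P1 t\<bar> \<le> 18 / \<epsilon>"
      unfolding P1_def r_def[symmetric] \<epsilon>d abs_divide by (intro divide_right_mono) auto
    then show "\<bar>P1 t\<bar> \<le> 18 / \<epsilon>\<^sup>2" using H by linarith
    have "\<bar>6 - 12 * r\<bar> \<le> 18" using r by linarith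
    then show "\<bar>P2 t\<bar> \<le> 18 / \<epsilon>\<^sup>2"
      unfolding P2_def r_def[symmetric] \<epsilon>d abs_divide by (simp add: divide_right_mono)
  qed
  have C1: "Ck_on k S (\<lambda>_. 1::real)" if "diff_dom S" for k S by (rule Ck_on_const[OF that])
  note dd = diff_dom_Icc[OF ord(1)] diff_dom_Icc[OF ord(2)]
  show ?thesis
  proof (cases "p = s")
    case True
    then have seg: "closed_segment T p = {s..T}" using ord by (simp add: closed_segment_eq_real_ivl)
    have br: "broken s T e (\<lambda>t. if t \<le> T then P t else 1) (\<lambda>t. if t \<le> T then P1 t else 0) (\<lambda>t. if t \<le> T then P2 t else 0)"
      by (rule broken_glue[OF ord PC[OF dd(1)] C1[OF dd(2)] P1 P2 one PT(1,2)])
    show ?thesis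
      by (rule that[OF br]) (use PT True ord bounds seg in auto)
  next
    case False
    then have pe: "p = e" using p by simp
    then have seg: "closed_segment T p = {T..e}" using ord by (simp add: closed_segment_eq_real_ivl)
    have br: "broken s T e (\<lambda>t. if t \<le> T then 1 else P t) (\<lambda>t. if t \<le> T then 0 else P1 t) (\<lambda>t. if t \<le> T then 0 else P2 t)"
      by (rule broken_glue[OF ord C1[OF dd(1)] PC[OF dd(2)] one P1 P2]) (use PT in auto)
    have T1: "1 \<le> 18 / \<epsilon>\<^sup>2" "0 \<le> 18 / \<epsilon>\<^sup>2" using H by linarith+
    show ?thesis
      by (rule that[OF br]) (use PT pe ord bounds seg T1 in auto)
  qed
qed

text \<open>
  The fundamental theorem of calculus between \<open>t\<close> and \<open>t'\<close>.
\<close>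
lemma derivative_variation:
  fixes z :: "real \<Rightarrow> 'e::euclidean_space"
  assumes w: "continuous_on {l..m} w" and z: "\<And>t. t \<in> {l..m} \<Longrightarrow> (z has_vector_derivative w t) (at t within {l..m})"
    and t: "t \<in> {l..m}" "t' \<in> {l..m}"
  shows "norm (z t - z t') \<le> integral {l..m} (\<lambda>t. norm (w t))"
proof -
  have nw: "continuous_on {l..m} (\<lambda>t. norm (w t))" by (intro continuous_on_norm w)
  have 1: "norm (z q - z r) \<le> integral {l..m} (\<lambda>t. norm (w t))" if qr: "r \<in> {l..m}" "q \<in> {l..m}" "r \<le> q" for q r
  proof -
    have sub: "{r..q} \<subseteq> {l..m}" using qr by auto
    have "(w has_integral (z q - z r)) {r..q}"
    proof (rule fundamental_theorem_of_calculus[OF qr(3)])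
      fix t assume "t \<in> {r..q}"
      then show "(z has_vector_derivative w t) (at t within {r..q})"
        using z[of t] sub has_vector_derivative_within_subset by blast
    qed
    then have "z q - z r = integral {r..q} w" by (simp add: integral_unique)
    also have "norm \<dots> \<le> integral {r..q} (\<lambda>t. norm (w t))"
      by (rule Henstock_Kurzweil_Integration.integral_norm_bound_integral)
        (use continuous_on_subset[OF w sub] continuous_on_subset[OF nw sub] in \<open>auto intro!: integrable_continuous_real\<close>)
    also have "\<dots> \<le> integral {l..m} (\<lambda>t. norm (w t))"
      by (rule integral_subset_le[OF sub])
        (use continuous_on_subset[OF nw sub] nw in \<open>auto intro!: integrable_continuous_real\<close>)
    finally show ?thesis .
  qed
  show ?thesis
    using 1[of t t'] 1[of t' t] t by (cases "t \<le> t'") (auto simp: norm_minus_commute)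
qed

lemma has_integral_le_off_finite:
  fixes f :: "real \<Rightarrow> real"
  assumes "(f has_integral i) S" "(g has_integral j) S" "finite F" "\<And>t. t \<in> S - F \<Longrightarrow> f t \<le> g t"
  shows "i \<le> j"
proof -
  have "((\<lambda>t. if t \<in> F then g t else f t) has_integral i) S"
    by (rule has_integral_spike_finite[OF assms(3) _ assms(1)]) auto
  then show ?thesis by (rule has_integral_le[OF _ assms(2)]) (use assms(4) in auto)
qed

section \<open>Comparison of two minimizing paths\<close>

text \<open>
  Two paths \<open>x\<close>, \<open>y\<close> that minimize the integral of \<open>f\<close> and agree from \<open>p'\<close> to \<open>T\<close> agree up to \<open>p\<close>
  if \<open>p\<close> is close to \<open>T\<close>. Let \<open>z = y - x\<close> and let \<open>S\<close> be the integral of the norm of \<open>z''\<close> between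
  \<open>T\<close> and \<open>p\<close>. The perturbation \<open>\<phi>\<close> vanishes to first order at \<open>p\<close> and \<open>p'\<close> and satisfies
  \<open>\<phi>'' = z''\<close> between \<open>T\<close> and \<open>p\<close>, so \<open>x + \<phi>/2\<close> and \<open>y - \<phi>/2\<close> are competitors with equal second
  derivatives there. By strong convexity they lower the sum of the integrals by
  \<open>lam * S\<^sup>2 / \<delta>\<close> at least, up to an error of order \<open>S\<^sup>2\<close>. Minimality of both paths therefore
  forces \<open>S = 0\<close> when \<open>\<delta>\<close> is small.

  Here \<open>H\<close> bounds the cut-off function in \<open>\<phi>\<close> and its derivatives, and \<open>R\<close> the derivatives of the
  two paths.

  The orientation is left open, so that the same statement continues agreement to the right and to
  the left.
\<close>
lemma difference_vanishes:
  fixes f :: "'e::euclidean_space \<times> 'e \<times> 'e \<Rightarrow> real"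
  assumes ord: "s < T" "T < e" and orient: "p' = s \<and> p = e \<or> p' = e \<and> p = s"
    and len: "\<bar>T - p'\<bar> = \<epsilon>" "\<epsilon> \<le> 1" "\<bar>T - p\<bar> = \<delta>" "\<delta> \<le> 1"
    and x: "broken s T e x x1 x2" and y: "broken s T e y y1 y2"
    and agree: "\<And>t. t \<in> closed_segment T p' \<Longrightarrow> x t = y t"
    and pos: "\<And>t. t \<in> {s..e} \<Longrightarrow> dist x0 (x t) \<le> r / 2" "\<And>t. t \<in> {s..e} \<Longrightarrow> dist x0 (y t) \<le> r / 2"
    and vel: "\<And>t. t \<in> {s..e} \<Longrightarrow> norm (x1 t) \<le> R" "\<And>t. t \<in> {s..e} \<Longrightarrow> norm (y1 t) \<le> R"
    and acc: "\<And>t. t \<in> {s<..<e} - {T} \<Longrightarrow> norm (x2 t) \<le> R" "\<And>t. t \<in> {s<..<e} - {T} \<Longrightarrow> norm (y2 t) \<le> R"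
    and M: "sd_bound M (cball x0 r \<times> cball 0 (R + 1) \<times> cball 0 (R + 1)) f"
    and lam: "0 < lam" and conv: "\<And>x v a b. x \<in> cball x0 r \<Longrightarrow>
      2 * f (x, v, (1/2) *\<^sub>R (a + b)) - f (x, v, a) - f (x, v, b) \<le> - lam * (norm (b - a))\<^sup>2"
    and minx: "\<And>u u1 u2. \<lbrakk>broken s T e u u1 u2; u ` {s..e} \<subseteq> cball x0 r; u s = x s; u e = x e; u1 s = x1 s; u1 e = x1 e\<rbrakk> \<Longrightarrow>
      \<exists>I I'. ((\<lambda>t. f (x t, x1 t, x2 t)) has_integral I) {s..e} \<and> ((\<lambda>t. f (u t, u1 t, u2 t)) has_integral I') {s..e} \<and> I \<le> I'"
    and miny: "\<And>u u1 u2. \<lbrakk>broken s T e u u1 u2; u ` {s..e} \<subseteq> cball x0 r; u s = y s; u e = y e; u1 s = y1 s; u1 e = y1 e\<rbrakk> \<Longrightarrow>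
      \<exists>I I'. ((\<lambda>t. f (y t, y1 t, y2 t)) has_integral I) {s..e} \<and> ((\<lambda>t. f (u t, u1 t, u2 t)) has_integral I') {s..e} \<and> I \<le> I'"
    and H: "H = 18 / \<epsilon>\<^sup>2" and small: "24 * H * R * \<delta> \<le> 1" "24 * H * R * \<delta> \<le> r" "4 * M + 36 * M * H\<^sup>2 < lam / \<delta>"
    and t: "t \<in> {s..e}"
  shows "x t = y t"
proof -
  (* Between l and m, that is between T and p, the paths may differ; between lb and mb they agree. *)
  define l where "l = (if p = e then T else s)"
  define m where "m = (if p = e then e else T)"
  define lb where "lb = (if p = e then s else T)"
  define mb where "mb = (if p = e then T else e)"
  have D: "l = s \<and> m = T \<or> l = T \<and> m = e" "l < m" "m - l = \<delta>" "p \<in> {l..m}" "T \<in> {l..m}" "{l..m} \<subseteq> {s..e}"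
      "{l<..<m} \<subseteq> {s<..<e} - {T}" "p \<notin> closed_segment T p'"
    and B: "lb < mb" "mb - lb = \<epsilon>" "p' \<in> {lb..mb}" "T \<in> {lb..mb}" "closed_segment T p' = {lb..mb}" "{lb..mb} \<subseteq> {s..e}"
      "{lb<..<mb} \<subseteq> {s<..<e} - {T}"
    and DB: "{s..e} = {l..m} \<union> {lb..mb}" "\<And>t. t \<in> {l..m} \<Longrightarrow> t \<notin> {lb..mb} \<or> t = T"
    using ord orient len by (auto simp: l_def m_def lb_def mb_def closed_segment_eq_real_ivl)
  have \<epsilon>0: "0 < \<epsilon>" and \<delta>0: "0 < \<delta>" using ord orient len by auto
  have H1: "1 \<le> H"
  proof -
    have "\<epsilon>\<^sup>2 \<le> 1" "0 < \<epsilon>\<^sup>2" using power_le_one[of \<epsilon> 2] \<epsilon>0 len by auto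
    then show ?thesis unfolding H by (simp add: field_simps)
  qed
  have M0: "0 \<le> M" by (rule sd_boundD(1)[OF M])
  have R0: "0 \<le> R" using order_trans[OF norm_ge_zero vel(1)[of s]] ord by auto
  define z where "z t = y t - x t" for t
  define z1 where "z1 t = y1 t - x1 t" for t
  define z2 where "z2 t = y2 t - x2 t" for t
  have z: "broken s T e z z1 z2"
    using broken_lincomb[OF ord y x, of 1 "- 1"] by (simp add: z_def[abs_def] z1_def[abs_def] z2_def[abs_def])
  have zB: "z t = 0" if "t \<in> {lb..mb}" for t using agree[of t] that B by (simp add: z_def)
  have z1B: "z1 t = 0" if t: "t \<in> {lb..mb}" for t
  proof -
    have "(z has_vector_derivative z1 t) (at t within {lb..mb})"
      using brokenD(4)[OF z, of t] B(6) t has_vector_derivative_within_subset by blast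
    moreover have "(z has_vector_derivative 0) (at t within {lb..mb})"
      by (rule has_vector_derivative_transform[OF t zB has_vector_derivative_const])
    ultimately show ?thesis using vector_derivative_unique_within[OF at_within_Icc_neq_bot[OF B(1) t]] by blast
  qed
  have z2B: "z2 t = 0" if t: "t \<in> {lb<..<mb}" for t
  proof -
    have "(z1 has_vector_derivative z2 t) (at t)" using brokenD(5)[OF z, of t] B(7) t by blast
    moreover have "(z1 has_vector_derivative 0) (at t)"
      by (rule has_vector_derivative_transform_within_open[OF has_vector_derivative_const open_greaterThanLessThan t])
        (simp add: z1B)
    ultimately show ?thesis by (rule vector_derivative_unique_at)
  qed
  obtain w where w: "continuous_on {l..m} w" "\<And>t. t \<in> {l..m} \<Longrightarrow> (z1 has_vector_derivative w t) (at t within {l..m})"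
    "\<And>t. t \<in> {l<..<m} \<Longrightarrow> w t = z2 t"
    using broken_half[OF ord z D(1)] by blast
  (* Every quantity below is estimated by S. *)
  define S where "S = integral {l..m} (\<lambda>t. norm (w t))"
  have wS: "((\<lambda>t. norm (w t)) has_integral S) {l..m}"
    unfolding S_def by (intro integrable_integral integrable_continuous_real continuous_on_norm w)
  have S0: "0 \<le> S" by (rule has_integral_nonneg[OF wS]) simp
  have const: "((\<lambda>_. C) has_integral (\<delta> * C)) {l..m}" for C :: real
    using has_integral_const_real[of C l m] D(2,3) by simp
  have SR: "S \<le> \<delta> * (2 * R)"
  proof (rule has_integral_le_off_finite[OF wS const, of "{l, m}"])
    fix t assume "t \<in> {l..m} - {l, m}"
    then have "t \<in> {l<..<m}" by auto
    then have "w t = y2 t - x2 t" "t \<in> {s<..<e} - {T}" using w(3) D(7) by (auto simp: z2_def)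
    then show "norm (w t) \<le> 2 * R"
      using norm_triangle_ineq4[of "y2 t" "x2 t"] acc[of t] by simp
  qed simp
  have HS: "12 * H * S \<le> 1" "12 * H * S \<le> r"
  proof -
    have "12 * H * S \<le> 12 * H * (\<delta> * (2 * R))" using SR H1 by (intro mult_left_mono) auto
    also have "\<dots> = 24 * H * R * \<delta>" by simp
    finally show "12 * H * S \<le> 1" "12 * H * S \<le> r" using small by linarith+
  qed
  have SHS: "S \<le> H * S" using mult_right_mono[OF H1 S0] by simp
  have var: "norm (z1 t - z1 t') \<le> S" if "t \<in> {l..m}" "t' \<in> {l..m}" for t t'
    unfolding S_def by (rule derivative_variation[OF w(1,2) that])
  have bound: "norm (F t - F t') \<le> S" if F: "\<And>t. t \<in> {l..m} \<Longrightarrow> (F has_vector_derivative F1 t) (at t within {l..m})"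
    "continuous_on {l..m} F1" "\<And>t. t \<in> {l..m} \<Longrightarrow> norm (F1 t) \<le> S" and t: "t \<in> {l..m}" "t' \<in> {l..m}"
    for F F1 :: "real \<Rightarrow> 'e" and t t'
  proof -
    have "norm (F t - F t') \<le> integral {l..m} (\<lambda>t. norm (F1 t))" by (rule derivative_variation[OF F(2,1) t])
    also have "\<dots> \<le> integral {l..m} (\<lambda>_. S)"
      by (rule integral_le) (use F(2,3) in \<open>auto intro!: integrable_continuous_real continuous_on_norm\<close>)
    also have "\<dots> = \<delta> * S" using const[of S] integral_unique by blast
    also have "\<dots> \<le> S" using len(4) S0 \<delta>0 by (simp add: mult_left_le_one_le)
    finally show ?thesis .
  qed
  have z1D: "norm (z1 t) \<le> S" if "t \<in> {l..m}" for t
    using var[OF that D(5)] z1B[OF B(4)] by simp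
  have z1c: "continuous_on {l..m} z1" using continuous_on_vector_derivative[OF w(2)] by blast
  have zd: "(z has_vector_derivative z1 t) (at t within {l..m})" if "t \<in> {l..m}" for t
    using brokenD(4)[OF z, of t] D(6) that has_vector_derivative_within_subset by blast
  have zD: "norm (z t) \<le> S" if "t \<in> {l..m}" for t
    using bound[OF zd z1c z1D that D(5)] zB[OF B(4)] by simp
  have "S = 0"
  proof (rule ccontr)
    assume "S \<noteq> 0"
    then have Spos: "0 < S" using S0 by simp
    have p's: "p' = s \<or> p' = e" using orient by auto
    obtain h h1 h2 :: "real \<Rightarrow> real" where h: "broken s T e h h1 h2" "h p' = 0" "h1 p' = 0"
      and hD: "\<And>t. \<lbrakk>t \<in> {s..e}; t \<notin> closed_segment T p' \<or> t = T\<rbrakk> \<Longrightarrow> h t = 1 \<and> h1 t = 0"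
      "\<And>t. \<lbrakk>t \<in> {s..e}; t \<notin> closed_segment T p'\<rbrakk> \<Longrightarrow> h2 t = 0"
      and hB: "\<And>t. t \<in> closed_segment T p' \<Longrightarrow> \<bar>h t\<bar> \<le> 18 / \<epsilon>\<^sup>2 \<and> \<bar>h1 t\<bar> \<le> 18 / \<epsilon>\<^sup>2"
      "\<And>t. t \<in> closed_segment T p' - {T} \<Longrightarrow> \<bar>h2 t\<bar> \<le> 18 / \<epsilon>\<^sup>2"
      using cutoff_exists[OF ord p's len(1)[symmetric] len(2)] by blast
    (* The affine function with the value and the derivative of z at p. Subtracting it makes phi vanish to
       first order at p; beyond T the cut-off h removes it before p' is reached. *)
    define \<l> where "\<l> t = z p + (t - p) *\<^sub>R z1 p" for t
    define \<phi> where "\<phi> t = z t - h t *\<^sub>R \<l> t" for t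
    define \<phi>1 where "\<phi>1 t = z1 t - (h t *\<^sub>R z1 p + h1 t *\<^sub>R \<l> t)" for t
    define \<phi>2 where "\<phi>2 t = z2 t - ((h t *\<^sub>R 0 + h1 t *\<^sub>R z1 p) + (h1 t *\<^sub>R z1 p + h2 t *\<^sub>R \<l> t))" for t
    have hl: "broken s T e (\<lambda>t. h t *\<^sub>R \<l> t) (\<lambda>t. h t *\<^sub>R z1 p + h1 t *\<^sub>R \<l> t)
      (\<lambda>t. (h t *\<^sub>R 0 + h1 t *\<^sub>R z1 p) + (h1 t *\<^sub>R z1 p + h2 t *\<^sub>R \<l> t))"
      unfolding \<l>_def by (rule broken_scaleR[OF ord h(1) broken_affine[OF ord]])
    have \<phi>: "broken s T e \<phi> \<phi>1 \<phi>2"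
      using broken_lincomb[OF ord z hl, of 1 "- 1"]
      by (simp add: \<phi>_def[abs_def] \<phi>1_def[abs_def] \<phi>2_def[abs_def] algebra_simps)
    have hDD: "h t = 1" "h1 t = 0" if "t \<in> {l..m}" for t
      using hD(1)[of t] that DB(2)[OF that] D(6) B(5) by auto
    have h2D: "h2 t = 0" if "t \<in> {l<..<m}" for t
    proof -
      have "t \<in> {l..m}" "t \<noteq> T" using that D(1,7) by auto
      then show ?thesis using hD(2)[of t] DB(2)[of t] D(6) B(5) by auto
    qed
    have \<phi>1D: "\<phi>1 t = z1 t - z1 p" if "t \<in> {l..m}" for t using hDD[OF that] by (simp add: \<phi>1_def)
    have \<phi>2D: "\<phi>2 t = z2 t" if "t \<in> {l<..<m}" for t
      using hDD[of t] h2D[OF that] that by (simp add: \<phi>2_def)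
    have \<phi>p: "\<phi> p = 0" "\<phi>1 p = 0" using hDD[OF D(4)] by (auto simp: \<phi>_def \<phi>1_def \<l>_def)
    have \<phi>p': "\<phi> p' = 0" "\<phi>1 p' = 0" using zB[OF B(3)] z1B[OF B(3)] h by (auto simp: \<phi>_def \<phi>1_def)
    have \<phi>ends: "\<phi> s = 0" "\<phi> e = 0" "\<phi>1 s = 0" "\<phi>1 e = 0" using \<phi>p \<phi>p' orient by auto
    have n\<phi>1D: "norm (\<phi>1 t) \<le> S" if "t \<in> {l..m}" for t
      unfolding \<phi>1D[OF that] by (rule var[OF that D(4)])
    have n\<phi>D: "norm (\<phi> t) \<le> S" if t: "t \<in> {l..m}" for t
    proof -
      have "norm (\<phi> t - \<phi> p) \<le> S"
      proof (rule bound[OF _ _ n\<phi>1D t D(4)])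
        show "(\<phi> has_vector_derivative \<phi>1 t) (at t within {l..m})" if "t \<in> {l..m}" for t
          using brokenD(4)[OF \<phi>, of t] D(6) that has_vector_derivative_within_subset by blast
        show "continuous_on {l..m} \<phi>1"
          by (rule continuous_on_eq[of _ "\<lambda>t. z1 t - z1 p"])
            (auto intro!: continuous_on_diff z1c simp: \<phi>1D)
      qed
      then show ?thesis using \<phi>p by simp
    qed
    have lB: "norm (\<l> t) \<le> 3 * S" if "t \<in> {s..e}" for t
    proof -
      have "\<bar>t - p\<bar> \<le> \<epsilon> + \<delta>" using that orient len ord by auto
      then have "\<bar>t - p\<bar> \<le> 2" using len by linarith
      then have "\<bar>t - p\<bar> * norm (z1 p) \<le> 2 * S" using z1D[OF D(4)] by (intro mult_mono) auto
      then show ?thesis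
        unfolding \<l>_def using norm_triangle_ineq[of "z p" "(t - p) *\<^sub>R z1 p"] zD[OF D(4)] by simp
    qed
    have mulS: "norm (\<alpha> *\<^sub>R v) \<le> H * (k * S)" if "\<bar>\<alpha>\<bar> \<le> H" "norm v \<le> k * S" for \<alpha> k and v :: 'e
      unfolding norm_scaleR using that H1 by (intro mult_mono) auto
    have nB: "norm (\<phi> t) \<le> 3 * H * S" "norm (\<phi>1 t) \<le> 4 * H * S" if t: "t \<in> {lb..mb}" for t
    proof -
      have ts: "t \<in> {s..e}" using t B by auto
      have hh: "\<bar>h t\<bar> \<le> H" "\<bar>h1 t\<bar> \<le> H" using hB(1)[of t] t B(5) H by auto
      have "norm (h t *\<^sub>R \<l> t) \<le> H * (3 * S)" "norm (h1 t *\<^sub>R \<l> t) \<le> H * (3 * S)" "norm (h t *\<^sub>R z1 p) \<le> H * (1 * S)"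
        by (rule mulS[OF hh(1) lB[OF ts]] mulS[OF hh(2) lB[OF ts]] mulS[OF hh(1)]; use z1D[OF D(4)] in simp)+
      moreover have "norm (\<phi> t) = norm (h t *\<^sub>R \<l> t)" "norm (\<phi>1 t) = norm (h t *\<^sub>R z1 p + h1 t *\<^sub>R \<l> t)"
        unfolding \<phi>_def \<phi>1_def zB[OF t] z1B[OF t] diff_0 norm_minus_cancel by (rule refl)+
      ultimately show "norm (\<phi> t) \<le> 3 * H * S" "norm (\<phi>1 t) \<le> 4 * H * S"
        using norm_triangle_ineq[of "h t *\<^sub>R z1 p" "h1 t *\<^sub>R \<l> t"] by simp_all
    qed
    have n2B: "norm (\<phi>2 t) \<le> 5 * H * S" if t: "t \<in> {lb<..<mb}" for t
    proof -
      have ts: "t \<in> {s..e}" using t B by auto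
      have "t \<noteq> T" using t B by auto
      have hh: "\<bar>h1 t\<bar> \<le> H" "\<bar>h2 t\<bar> \<le> H" using hB[of t] t B(5) H \<open>t \<noteq> T\<close> by auto
      have "norm (h2 t *\<^sub>R \<l> t) \<le> H * (3 * S)" "norm (h1 t *\<^sub>R z1 p) \<le> H * (1 * S)"
        by (rule mulS[OF hh(2) lB[OF ts]] mulS[OF hh(1)]; use z1D[OF D(4)] in simp)+
      moreover have "norm (\<phi>2 t) = norm (h1 t *\<^sub>R z1 p + (h1 t *\<^sub>R z1 p + h2 t *\<^sub>R \<l> t))"
        unfolding \<phi>2_def z2B[OF t] diff_0 norm_minus_cancel scaleR_zero_right add_0 ..
      ultimately show ?thesis
        using norm_triangle_ineq[of "h1 t *\<^sub>R z1 p" "h1 t *\<^sub>R z1 p + h2 t *\<^sub>R \<l> t"]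
          norm_triangle_ineq[of "h1 t *\<^sub>R z1 p" "h2 t *\<^sub>R \<l> t"]
        by linarith
    qed
    have HS0: "0 \<le> H * S" using H1 S0 by simp
    have n\<phi>: "norm (\<phi> t) \<le> 12 * H * S" "norm (\<phi>1 t) \<le> 12 * H * S" if "t \<in> {s..e}" for t
      using n\<phi>D[of t] n\<phi>1D[of t] nB[of t] that DB(1) SHS HS0 by fastforce+
    have cb: "x t \<in> cball x0 r" "y t \<in> cball x0 r" "x t + (1/2) *\<^sub>R \<phi> t \<in> cball x0 r" "y t - (1/2) *\<^sub>R \<phi> t \<in> cball x0 r"
      "x1 t \<in> cball 0 (R + 1)" "y1 t \<in> cball 0 (R + 1)"
      "x1 t + (1/2) *\<^sub>R \<phi>1 t \<in> cball 0 (R + 1)" "y1 t - (1/2) *\<^sub>R \<phi>1 t \<in> cball 0 (R + 1)" "x1 t - (1/2) *\<^sub>R \<phi>1 t \<in> cball 0 (R + 1)"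
      if ts: "t \<in> {s..e}" for t
    proof -
      have n: "norm ((1/2) *\<^sub>R \<phi> t) \<le> r / 2" "norm ((1/2) *\<^sub>R \<phi>1 t) \<le> 1" using n\<phi>[OF ts] HS by auto
      have r0: "0 \<le> r" using pos(1)[OF ts] zero_le_dist[of x0 "x t"] by linarith
      show "x t \<in> cball x0 r" "y t \<in> cball x0 r" using pos(1)[OF ts] pos(2)[OF ts] r0 by auto
      have "dist x0 (x t + (1/2) *\<^sub>R \<phi> t) \<le> dist x0 (x t) + norm ((1/2) *\<^sub>R \<phi> t)"
        by (metis dist_norm add_diff_cancel_left' dist_commute dist_triangle2 dist_triangle)
      then show "x t + (1/2) *\<^sub>R \<phi> t \<in> cball x0 r" using n pos(1)[OF ts] by simp
      have "norm (x0 - (y t - (1/2) *\<^sub>R \<phi> t)) \<le> norm (x0 - y t) + norm ((1/2) *\<^sub>R \<phi> t)"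
        using norm_triangle_ineq[of "x0 - y t" "(1/2) *\<^sub>R \<phi> t"] by (simp add: algebra_simps)
      then show "y t - (1/2) *\<^sub>R \<phi> t \<in> cball x0 r" using n pos(2)[OF ts] by (simp add: dist_norm)
      show "x1 t \<in> cball 0 (R + 1)" "y1 t \<in> cball 0 (R + 1)" using vel(1)[OF ts] vel(2)[OF ts] by auto
      show "x1 t + (1/2) *\<^sub>R \<phi>1 t \<in> cball 0 (R + 1)" "y1 t - (1/2) *\<^sub>R \<phi>1 t \<in> cball 0 (R + 1)" "x1 t - (1/2) *\<^sub>R \<phi>1 t \<in> cball 0 (R + 1)"
        using norm_triangle_ineq[of "x1 t" "(1/2) *\<^sub>R \<phi>1 t"] norm_triangle_ineq4[of "y1 t" "(1/2) *\<^sub>R \<phi>1 t"]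
          norm_triangle_ineq4[of "x1 t" "(1/2) *\<^sub>R \<phi>1 t"] n vel(1)[OF ts] vel(2)[OF ts] by auto
    qed
    let ?P = "\<lambda>t. (x t, x1 t, x2 t)" and ?Q = "\<lambda>t. (y t, y1 t, y2 t)"
    let ?P' = "\<lambda>t. (x t + (1/2) *\<^sub>R \<phi> t, x1 t + (1/2) *\<^sub>R \<phi>1 t, x2 t + (1/2) *\<^sub>R \<phi>2 t)"
    let ?Q' = "\<lambda>t. (y t - (1/2) *\<^sub>R \<phi> t, y1 t - (1/2) *\<^sub>R \<phi>1 t, y2 t - (1/2) *\<^sub>R \<phi>2 t)"
    have bu: "broken s T e (\<lambda>t. x t + (1/2) *\<^sub>R \<phi> t) (\<lambda>t. x1 t + (1/2) *\<^sub>R \<phi>1 t) (\<lambda>t. x2 t + (1/2) *\<^sub>R \<phi>2 t)"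
      using broken_lincomb[OF ord x \<phi>, of 1 "1/2"] by simp
    have bw: "broken s T e (\<lambda>t. y t - (1/2) *\<^sub>R \<phi> t) (\<lambda>t. y1 t - (1/2) *\<^sub>R \<phi>1 t) (\<lambda>t. y2 t - (1/2) *\<^sub>R \<phi>2 t)"
      using broken_lincomb[OF ord y \<phi>, of 1 "- (1/2)"] by simp
    obtain Ix Iu where Ix: "((\<lambda>t. f (?P t)) has_integral Ix) {s..e}" "((\<lambda>t. f (?P' t)) has_integral Iu) {s..e}" "Ix \<le> Iu"
      using minx[OF bu] cb(3) \<phi>ends by (auto simp: image_subset_iff)
    obtain Iy Iw where Iy: "((\<lambda>t. f (?Q t)) has_integral Iy) {s..e}" "((\<lambda>t. f (?Q' t)) has_integral Iw) {s..e}" "Iy \<le> Iw"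
      using miny[OF bw] cb(4) \<phi>ends by (auto simp: image_subset_iff)
    define E where "E t = f (?P' t) + f (?Q' t) - f (?P t) - f (?Q t)" for t
    have E: "(E has_integral (Iu + Iw - Ix - Iy)) {s..e}"
      unfolding E_def by (intro has_integral_diff has_integral_add Ix Iy)
    then have Ei: "E integrable_on {s..e}" by blast
    have split: "integral {s..e} E = integral {l..m} E + integral {lb..mb} E"
    proof (cases "p = e")
      case True
      then show ?thesis
        using Henstock_Kurzweil_Integration.integral_combine[OF _ _ Ei, of T] ord by (simp add: l_def m_def lb_def mb_def)
    next
      case False
      then show ?thesis
        using Henstock_Kurzweil_Integration.integral_combine[OF _ _ Ei, of T] ord by (simp add: l_def m_def lb_def mb_def)
    qed
    have EDi: "(E has_integral integral {l..m} E) {l..m}" and EBi: "(E has_integral integral {lb..mb} E) {lb..mb}"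
      using integrable_on_subinterval[OF Ei D(6)] integrable_on_subinterval[OF Ei B(6)] by (auto simp: has_integral_integral)
    (* Where the paths agree, the two competitors are opposite perturbations of one path. *)
    have boundB: "integral {lb..mb} E \<le> \<epsilon> * (M * (36 * H\<^sup>2 * S\<^sup>2))"
    proof (rule has_integral_le_off_finite[OF EBi])
      show "((\<lambda>_. M * (36 * H\<^sup>2 * S\<^sup>2)) has_integral (\<epsilon> * (M * (36 * H\<^sup>2 * S\<^sup>2)))) {lb..mb}"
        using has_integral_const_real[of "M * (36 * H\<^sup>2 * S\<^sup>2)" lb mb] B(1,2) by simp
      fix t assume "t \<in> {lb..mb} - {lb, mb}"
      then have t: "t \<in> {lb<..<mb}" "t \<in> {lb..mb}" by auto
      then have ts: "t \<in> {s..e}" "t \<in> {s<..<e} - {T}" using B by blast+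
      have eq: "y t = x t" "y1 t = x1 t" "y2 t = x2 t"
        using zB[OF t(2)] z1B[OF t(2)] z2B[OF t(1)] by (simp_all add: z_def z1_def z2_def)
      define q where "q = ((1/2) *\<^sub>R \<phi> t, (1/2) *\<^sub>R \<phi>1 t, (1/2) *\<^sub>R \<phi>2 t)"
      have nq: "norm q \<le> 6 * H * S"
      proof -
        have "norm q \<le> norm ((1/2) *\<^sub>R \<phi> t) + (norm ((1/2) *\<^sub>R \<phi>1 t) + norm ((1/2) *\<^sub>R \<phi>2 t))"
          unfolding q_def by (rule order_trans[OF norm_Pair_le add_left_mono[OF norm_Pair_le]])
        also have "\<dots> \<le> 6 * H * S" using nB[OF t(2)] n2B[OF t(1)] by simp
        finally show ?thesis .
      qed
      have n2: "norm ((1/2) *\<^sub>R \<phi>2 t) \<le> 1" using n2B[OF t(1)] HS HS0 by simp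
      have c3: "x2 t \<in> cball 0 (R + 1)" "x2 t + (1/2) *\<^sub>R \<phi>2 t \<in> cball 0 (R + 1)" "x2 t - (1/2) *\<^sub>R \<phi>2 t \<in> cball 0 (R + 1)"
        using acc(1)[OF ts(2)] n2 norm_triangle_ineq[of "x2 t" "(1/2) *\<^sub>R \<phi>2 t"] norm_triangle_ineq4[of "x2 t" "(1/2) *\<^sub>R \<phi>2 t"]
        by auto
      have "f (?P t + q) + f (?P t - q) - 2 * f (?P t) \<le> M * (norm q)\<^sup>2"
      proof (rule symmetric_perturbation_estimate[OF M])
        show "?P t \<in> cball x0 r \<times> cball 0 (R + 1) \<times> cball 0 (R + 1)"
          using cb(1,5)[OF ts(1)] c3(1) by simp
        show "?P t + q \<in> cball x0 r \<times> cball 0 (R + 1) \<times> cball 0 (R + 1)"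
          unfolding q_def add_Pair mem_Times_iff fst_conv snd_conv using cb(3,7)[OF ts(1)] c3(2) by blast
        show "?P t - q \<in> cball x0 r \<times> cball 0 (R + 1) \<times> cball 0 (R + 1)"
          unfolding q_def diff_Pair mem_Times_iff fst_conv snd_conv using cb(4,9)[OF ts(1)] c3(3) eq by simp
      qed
      also have "M * (norm q)\<^sup>2 \<le> M * (6 * H * S)\<^sup>2"
        using nq M0 by (intro mult_left_mono power_mono) auto
      also have "M * (6 * H * S)\<^sup>2 = M * (36 * H\<^sup>2 * S\<^sup>2)" by (simp add: power_mult_distrib)
      finally show "E t \<le> M * (36 * H\<^sup>2 * S\<^sup>2)" by (simp add: E_def eq q_def)
    qed simp
    (* The mean of |w|. The inequality (|w| - k)^2 >= 0 replaces -|w|^2 by a function affine in |w|, whose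
       integral is known. *)
    define k where "k = S / \<delta>"
    have boundD: "integral {l..m} E \<le> \<delta> * (lam * k\<^sup>2 + 3 * M * S\<^sup>2) + (M * S - 2 * lam * k) * S"
    proof (rule has_integral_le_off_finite[OF EDi])
      show "((\<lambda>t. (lam * k\<^sup>2 + 3 * M * S\<^sup>2) + (M * S - 2 * lam * k) * norm (w t)) has_integral
          (\<delta> * (lam * k\<^sup>2 + 3 * M * S\<^sup>2) + (M * S - 2 * lam * k) * S)) {l..m}"
        by (intro has_integral_add const has_integral_mult_right wS)
      fix t assume "t \<in> {l..m} - {l, m}"
      then have t: "t \<in> {l<..<m}" "t \<in> {l..m}" by auto
      then have ts: "t \<in> {s..e}" "t \<in> {s<..<e} - {T}" using D by blast+
      have w': "w t = y2 t - x2 t" using w(3)[OF t(1)] by (simp add: z2_def)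
      have \<phi>2': "\<phi>2 t = y2 t - x2 t" using \<phi>2D[OF t(1)] by (simp add: z2_def)
      have zz: "norm (y t - x t) \<le> S" "norm (y1 t - x1 t) \<le> S"
        using zD[OF t(2)] z1D[OF t(2)] by (simp_all add: z_def z1_def)
      have c3: "x2 t \<in> cball 0 (R + 1)" "y2 t \<in> cball 0 (R + 1)"
        using acc(1)[OF ts(2)] acc(2)[OF ts(2)] by auto
      have "E t \<le> - lam * (norm (y2 t - x2 t))\<^sup>2 + M * (3 * S\<^sup>2 + S * norm (y2 t - x2 t))"
        unfolding E_def \<phi>2'
        by (rule crossed_midpoint_estimate[OF M convex_cball conv[OF cb(1)[OF ts(1)]] cb(1-4)[OF ts(1)] cb(5-8)[OF ts(1)] c3 zz
              n\<phi>D[OF t(2)] n\<phi>1D[OF t(2)]])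
      also have "\<dots> \<le> (lam * k\<^sup>2 + 3 * M * S\<^sup>2) + (M * S - 2 * lam * k) * norm (w t)"
      proof -
        have "0 \<le> lam * (norm (w t) - k)\<^sup>2" using lam by simp
        then show ?thesis unfolding w' by (simp add: power2_eq_square algebra_simps)
      qed
      finally show "E t \<le> (lam * k\<^sup>2 + 3 * M * S\<^sup>2) + (M * S - 2 * lam * k) * norm (w t)" .
    qed simp
    (* The sum of the two integrals cannot drop, as both paths are minimal. *)
    have "0 \<le> integral {l..m} E + integral {lb..mb} E"
      using integral_unique[OF E] split Ix(3) Iy(3) by linarith
    also have "\<dots> \<le> \<delta> * (lam * k\<^sup>2 + 3 * M * S\<^sup>2) + (M * S - 2 * lam * k) * S + \<epsilon> * (M * (36 * H\<^sup>2 * S\<^sup>2))"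
      using boundB boundD by linarith
    also have "\<dots> = S\<^sup>2 * (- (lam / \<delta>) + \<delta> * (3 * M) + M + \<epsilon> * (36 * M * H\<^sup>2))"
      using \<delta>0 by (simp add: k_def field_simps power2_eq_square)
    finally have "0 \<le> - (lam / \<delta>) + \<delta> * (3 * M) + M + \<epsilon> * (36 * M * H\<^sup>2)"
      using Spos by (simp add: zero_le_mult_iff)
    moreover have "\<delta> * (3 * M) \<le> 3 * M" using len(4) \<delta>0 M0 by (intro mult_left_le_one_le) auto
    moreover have "\<epsilon> * (36 * M * H\<^sup>2) \<le> 36 * M * H\<^sup>2" using len(2) \<epsilon>0 M0 by (intro mult_left_le_one_le) auto
    ultimately show False using small(3) by linarith
  qed
  then have "z t = 0" using zB[of t] zD[of t] t DB(1) by auto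
  then show ?thesis by (simp add: z_def)
qed

section \<open>Unique continuation of minimizers\<close>

lemma broken_subset:
  assumes "broken s T e u u1 u2" "s \<le> s'" "s' < T" "T < e'" "e' \<le> e"
  shows "broken s' T e' u u1 u2"
proof -
  have sub: "{s'..e'} \<subseteq> {s..e}" "{s'..T} \<subseteq> {s..T}" "{T..e'} \<subseteq> {T..e}" "{s'<..<e'} - {T} \<subseteq> {s<..<e} - {T}"
    using assms by auto
  have dd: "diff_dom {s'..e'}" "diff_dom {s'..T}" "diff_dom {T..e'}" using assms by (auto intro!: diff_dom_Icc)
  show ?thesis
    unfolding broken_def
  proof (intro conjI allI ballI)
    show "Ck_on 1 {s'..e'} u" by (rule Ck_on_subset[OF dd(1) sub(1) brokenD(1)[OF assms(1)]])
    show "Ck_on k {s'..T} u" for k by (rule Ck_on_subset[OF dd(2) sub(2) brokenD(2)[OF assms(1)]])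
    show "Ck_on k {T..e'} u" for k by (rule Ck_on_subset[OF dd(3) sub(3) brokenD(3)[OF assms(1)]])
    show "(u has_vector_derivative u1 t) (at t within {s'..e'})" if "t \<in> {s'..e'}" for t
      using has_vector_derivative_within_subset[OF brokenD(4)[OF assms(1)] sub(1)] sub(1) that by blast
    show "(u1 has_vector_derivative u2 t) (at t)" if "t \<in> {s'<..<e'} - {T}" for t
      using brokenD(5)[OF assms(1)] sub(4) that by blast
  qed
qed

lemma norm_bounded_on_Icc:
  fixes f :: "real \<Rightarrow> 'e::real_normed_vector"
  assumes "continuous_on {l..m} f"
  shows "\<exists>C\<ge>0. \<forall>t\<in>{l..m}. norm (f t) \<le> C"
  using bounded_on_compact[OF compact_Icc continuous_on_norm[OF assms]] by (metis abs_norm_cancel)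

lemma broken_bounded:
  fixes u :: "real \<Rightarrow> 'e::euclidean_space"
  assumes ord: "s < T" "T < e" and u: "broken s T e u u1 u2" and c: "continuous_on {s..e} u1"
  obtains R where "0 \<le> R" "\<And>t. t \<in> {s..e} \<Longrightarrow> norm (u1 t) \<le> R" "\<And>t. t \<in> {s<..<e} - {T} \<Longrightarrow> norm (u2 t) \<le> R"
proof -
  obtain C0 where C0: "0 \<le> C0" "\<forall>t\<in>{s..e}. norm (u1 t) \<le> C0"
    using norm_bounded_on_Icc[OF c] by metis
  have half: "\<exists>C\<ge>0. \<forall>t\<in>{l<..<m}. norm (u2 t) \<le> C" if D: "l = s \<and> m = T \<or> l = T \<and> m = e" for l m
  proof (rule broken_half[OF ord u D])
    fix w assume w: "continuous_on {l..m} w" "\<And>t. t \<in> {l<..<m} \<Longrightarrow> w t = u2 t"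
    obtain C where C: "0 \<le> C" "\<forall>t\<in>{l..m}. norm (w t) \<le> C"
      using norm_bounded_on_Icc[OF w(1)] by metis
    have "norm (u2 t) \<le> C" if "t \<in> {l<..<m}" for t
      using bspec[OF C(2), of t] w(2)[OF that] that by auto
    then show ?thesis using C(1) by metis
  qed
  obtain C1 where C1: "0 \<le> C1" "\<forall>t\<in>{s<..<T}. norm (u2 t) \<le> C1" using half[of s T] by metis
  obtain C2 where C2: "0 \<le> C2" "\<forall>t\<in>{T<..<e}. norm (u2 t) \<le> C2" using half[of T e] by metis
  show ?thesis
  proof (rule that[of "C0 + C1 + C2"])
    show "norm (u1 t) \<le> C0 + C1 + C2" if "t \<in> {s..e}" for t using bspec[OF C0(2) that] C1(1) C2(1) by linarith
    show "norm (u2 t) \<le> C0 + C1 + C2" if "t \<in> {s<..<e} - {T}" for t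
    proof (cases "t < T")
      case True
      then show ?thesis using bspec[OF C1(2), of t] that C0(1) C2(1) by simp
    next
      case False
      then show ?thesis using bspec[OF C2(2), of t] that C0(1) C1(1) by simp
    qed
  qed (use C0(1) C1(1) C2(1) in simp)
qed

text \<open>
  A property that is closed and can be continued beyond every parameter up to which it holds is
  propagated to the whole interval: consider the supremum of the parameters it has reached.
\<close>
lemma continuation_right:
  fixes E :: "real \<Rightarrow> bool"
  assumes lm: "l < m" "m \<le> b" and E: "\<And>t. t \<in> {l..m} \<Longrightarrow> E t"
    and closed: "\<And>T. \<lbrakk>l < T; T \<le> b; \<And>t. t \<in> {l..<T} \<Longrightarrow> E t\<rbrakk> \<Longrightarrow> E T"
    and ext: "\<And>T. \<lbrakk>l < T; T < b; \<And>t. t \<in> {l..T} \<Longrightarrow> E t\<rbrakk> \<Longrightarrow> \<exists>d>0. \<forall>t. T \<le> t \<and> t \<le> T + d \<and> t \<le> b \<longrightarrow> E t"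
    and t: "t \<in> {l..b}"
  shows "E t"
proof -
  define X where "X = {r \<in> {m..b}. \<forall>t\<in>{l..r}. E t}"
  have mX: "m \<in> X" using lm E by (auto simp: X_def)
  have bdd: "bdd_above X" by (rule bdd_aboveI[of _ b]) (auto simp: X_def)
  define T where "T = Sup X"
  have mT: "m \<le> T" unfolding T_def by (rule cSup_upper[OF mX bdd])
  have Tb: "T \<le> b" unfolding T_def by (rule cSup_least) (use mX in \<open>auto simp: X_def\<close>)
  have below: "E r" if "r \<in> {l..<T}" for r
  proof -
    have "r < Sup X" using that by (simp add: T_def)
    then obtain q where "q \<in> X" "r < q"
      using less_cSup_iff[OF _ bdd, of r] mX by blast
    then show ?thesis using that by (auto simp: X_def)
  qed
  have "E T" by (rule closed[OF _ Tb below]) (use lm mT in auto)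
  then have le: "E r" if "r \<in> {l..T}" for r using below[of r] that by (cases "r = T") auto
  have "T = b"
  proof (rule ccontr)
    assume "T \<noteq> b"
    then have "T < b" using Tb by simp
    then obtain d where d: "d > 0" "\<And>t. T \<le> t \<Longrightarrow> t \<le> T + d \<Longrightarrow> t \<le> b \<Longrightarrow> E t"
      using ext[of T] le lm mT by fastforce
    define T' where "T' = min b (T + d)"
    have "E r" if "r \<in> {l..T'}" for r
      using le[of r] d(2)[of r] that by (cases "r \<le> T") (auto simp: T'_def)
    then have "T' \<in> X" using mT \<open>T < b\<close> d(1) by (auto simp: X_def T'_def)
    then have "T' \<le> T" unfolding T_def by (rule cSup_upper[OF _ bdd])
    then show False using \<open>T < b\<close> d(1) by (simp add: T'_def)
  qed
  then show ?thesis using le t by simp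
qed

context lagrangian
begin

text \<open>
  Agreement of two minimizers on one side of \<open>T\<close> (the past for \<open>\<sigma> = 1\<close>, the future for \<open>\<sigma> = - 1\<close>)
  extends across \<open>T\<close>. In a chart around the common point both have the form required by
  \<open>difference_vanishes\<close>.
\<close>
lemma minimizers_agree_beyond:
  assumes q: "minimizer a b \<xi> \<eta> q" and q': "minimizer a b \<xi> \<eta> q'"
    and T: "a < T" "T < b" and \<sigma>: "\<sigma> = 1 \<or> \<sigma> = - 1" and \<epsilon>0: "0 < \<epsilon>0"
    and agree: "\<And>t. \<lbrakk>t \<in> {a..b}; 0 \<le> - \<sigma> * (t - T); - \<sigma> * (t - T) \<le> \<epsilon>0\<rbrakk> \<Longrightarrow> q t = q' t"
  shows "\<exists>\<delta>>0. \<forall>t\<in>{a..b}. 0 \<le> \<sigma> * (t - T) \<and> \<sigma> * (t - T) \<le> \<delta> \<longrightarrow> q t = q' t"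
proof -
  have facts: "Ck_curve A 1 {a..b} \<gamma>" "piecewise_smooth A a b \<gamma>" "continuous_on {a..b} \<gamma>"
    if "minimizer a b \<xi> \<eta> \<gamma>" for \<gamma>
    using that by (auto simp: global_minimizer_def admissible_curves_def piecewise_smooth_C1_iff Ck_curve_def)
  obtain c where c: "c \<in> A" "q T \<in> chart_dom c" using dom_cover by blast
  define x0 where "x0 = chart_map c (q T)"
  have "x0 \<in> chart_img c" unfolding x0_def by (rule chart_map_img[OF c(2)])
  then obtain r where r: "r > 0" "cball x0 r \<subseteq> chart_img c"
    using img_open[OF c(1)] open_contains_cball by blast
  (* Half of the radius r is kept as room for the perturbation. *)
  define U where "U = chart_dom c \<inter> chart_map c -` ball x0 (r / 2)"
  have Uo: "open U"
    unfolding U_def by (rule continuous_open_preimage[OF chart_map_cont[OF c(1)] dom_open[OF c(1)] open_ball])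
  have qT: "q T = q' T" using agree[of T] T \<epsilon>0 by simp
  have near: "\<exists>d>0. d \<le> 1 \<and> d \<le> \<epsilon>0 \<and> a \<le> T - d \<and> T + d \<le> b \<and> (\<forall>t\<in>{T - d..T + d}. \<gamma> t \<in> U) \<and>
      (\<forall>d'. 0 < d' \<and> d' \<le> d \<longrightarrow> smooth_curve A {T - d'..T} \<gamma> \<and> smooth_curve A {T..T + d'} \<gamma>)"
    if \<gamma>: "minimizer a b \<xi> \<eta> \<gamma>" "\<gamma> T = q T" for \<gamma>
  proof -
    have "\<gamma> T \<in> U" using \<gamma>(2) c(2) r by (simp add: U_def x0_def)
    moreover have "(\<gamma> \<longlongrightarrow> \<gamma> T) (at T within {a..b})"
      using facts(3)[OF \<gamma>(1)] T by (simp add: continuous_on_def)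
    ultimately have "eventually (\<lambda>t. \<gamma> t \<in> U) (at T within {a..b})"
      using topological_tendstoD Uo by blast
    then obtain d0 where d0: "d0 > 0" "\<And>t. t \<in> {a..b} \<Longrightarrow> t \<noteq> T \<Longrightarrow> dist t T < d0 \<Longrightarrow> \<gamma> t \<in> U"
      unfolding eventually_at by auto
    obtain d1 where d1: "d1 > 0" "\<And>d'. 0 < d' \<Longrightarrow> d' \<le> d1 \<Longrightarrow> smooth_curve A {T..T + d'} \<gamma>"
      using piecewise_smooth_right[OF facts(2)[OF \<gamma>(1)] less_imp_le[OF T(1)] T(2)] by metis
    obtain d2 where d2: "d2 > 0" "\<And>d'. 0 < d' \<Longrightarrow> d' \<le> d2 \<Longrightarrow> smooth_curve A {T - d'..T} \<gamma>"
      using piecewise_smooth_left[OF facts(2)[OF \<gamma>(1)] T(1) less_imp_le[OF T(2)]] by metis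
    define d where "d = min (min (min 1 \<epsilon>0) (min (T - a) (b - T))) (min (d0 / 2) (min d1 d2))"
    have d: "d > 0" "d \<le> 1" "d \<le> \<epsilon>0" "d \<le> T - a" "d \<le> b - T" "d \<le> d0 / 2" "d \<le> d1" "d \<le> d2"
      using T \<epsilon>0 d0(1) d1(1) d2(1) unfolding d_def by linarith+
    have "\<gamma> t \<in> U" if "t \<in> {T - d..T + d}" for t
      using d0(2)[of t] \<open>\<gamma> T \<in> U\<close> that d d0(1) by (cases "t = T") (auto simp: dist_real_def)
    then show ?thesis using d d1(2) d2(2) by (intro exI[of _ d]) auto
  qed
  obtain da where da: "da > 0" "da \<le> 1" "da \<le> \<epsilon>0" "a \<le> T - da" "T + da \<le> b" "\<And>t. t \<in> {T - da..T + da} \<Longrightarrow> q t \<in> U"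
    "\<And>d'. 0 < d' \<Longrightarrow> d' \<le> da \<Longrightarrow> smooth_curve A {T - d'..T} q \<and> smooth_curve A {T..T + d'} q"
    using near[OF q refl] by blast
  obtain db where db: "db > 0" "\<And>t. t \<in> {T - db..T + db} \<Longrightarrow> q' t \<in> U"
    "\<And>d'. 0 < d' \<Longrightarrow> d' \<le> db \<Longrightarrow> smooth_curve A {T - d'..T} q' \<and> smooth_curve A {T..T + d'} q'"
    using near[OF q' qT[symmetric]] by blast
  define \<epsilon> where "\<epsilon> = min da db"
  have \<epsilon>: "\<epsilon> > 0" "\<epsilon> \<le> 1" "\<epsilon> \<le> \<epsilon>0" "a \<le> T - \<epsilon>" "T + \<epsilon> \<le> b" using da db by (auto simp: \<epsilon>_def)
  let ?s = "T - \<epsilon>" and ?e = "T + \<epsilon>"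
  have ord: "?s < T" "T < ?e" "?s < ?e" using \<epsilon> by auto
  have coord: "\<exists>x1 x2 R. broken ?s T ?e (chart_map c \<circ> \<gamma>) x1 x2 \<and> 0 \<le> R \<and>
      (\<forall>t\<in>{?s..?e}. norm (x1 t) \<le> R) \<and> (\<forall>t\<in>{?s<..<?e} - {T}. norm (x2 t) \<le> R)"
    if \<gamma>: "minimizer a b \<xi> \<eta> \<gamma>" "\<And>t. t \<in> {?s..?e} \<Longrightarrow> \<gamma> t \<in> U"
      "smooth_curve A {?s..T} \<gamma>" "smooth_curve A {T..?e} \<gamma>" for \<gamma>
  proof -
    have C1: "Ck_curve A 1 {?s..?e} \<gamma>"
      by (rule Ck_curve_subset[OF facts(1)[OF \<gamma>(1)] _ ord(3) dom_open]) (use \<epsilon> in auto)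
    have whole: "{t \<in> J. \<gamma> t \<in> chart_dom c} = J" if "J \<subseteq> {?s..?e}" for J
      using that \<gamma>(2) by (auto simp: U_def)
    have Ck: "Ck_on k J (chart_map c \<circ> \<gamma>)" if "Ck_curve A k J \<gamma>" "J \<subseteq> {?s..?e}" for k J
      using that c(1) whole[OF that(2)] by (auto simp: Ck_curve_def simp del: Ck_on.simps)
    have "Ck_on 1 {?s..?e} (chart_map c \<circ> \<gamma>)" by (rule Ck[OF C1]) simp
    moreover have "Ck_on k {?s..T} (chart_map c \<circ> \<gamma>)" "Ck_on k {T..?e} (chart_map c \<circ> \<gamma>)" for k
      using \<gamma>(3,4) ord by (auto intro!: Ck simp: smooth_curve_def simp del: Ck_on.simps)
    ultimately obtain x1 x2 where x: "broken ?s T ?e (chart_map c \<circ> \<gamma>) x1 x2" "continuous_on {?s..?e} x1"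
      using broken_exists[OF ord(1,2)] by blast
    obtain R where "0 \<le> R" "\<And>t. t \<in> {?s..?e} \<Longrightarrow> norm (x1 t) \<le> R" "\<And>t. t \<in> {?s<..<?e} - {T} \<Longrightarrow> norm (x2 t) \<le> R"
      using broken_bounded[OF ord(1,2) x] by blast
    then show ?thesis using x(1) by blast
  qed
  have qU: "q t \<in> U" "q' t \<in> U" if "t \<in> {?s..?e}" for t
  proof -
    have "\<epsilon> \<le> da" "\<epsilon> \<le> db" by (auto simp: \<epsilon>_def)
    then show "q t \<in> U" "q' t \<in> U" using da(6)[of t] db(2)[of t] that by auto
  qed
  define x where "x = chart_map c \<circ> q"
  define y where "y = chart_map c \<circ> q'"
  obtain x1 x2 Rx where x: "broken ?s T ?e x x1 x2" "0 \<le> Rx" "\<And>t. t \<in> {?s..?e} \<Longrightarrow> norm (x1 t) \<le> Rx"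
      "\<And>t. t \<in> {?s<..<?e} - {T} \<Longrightarrow> norm (x2 t) \<le> Rx"
    using coord[OF q qU(1)] da(7)[of \<epsilon>] \<epsilon>(1) unfolding x_def by (auto simp: \<epsilon>_def)
  obtain y1 y2 Ry where y: "broken ?s T ?e y y1 y2" "0 \<le> Ry" "\<And>t. t \<in> {?s..?e} \<Longrightarrow> norm (y1 t) \<le> Ry"
      "\<And>t. t \<in> {?s<..<?e} - {T} \<Longrightarrow> norm (y2 t) \<le> Ry"
    using coord[OF q' qU(2)] db(3)[of \<epsilon>] \<epsilon>(1) unfolding y_def by (auto simp: \<epsilon>_def)
  define R where "R = max Rx Ry"
  have R: "Rx \<le> R" "Ry \<le> R" "0 \<le> R" using x(2) by (auto simp: R_def)
  obtain M where M: "sd_bound M (cball x0 r \<times> cball 0 (R + 1) \<times> cball 0 (R + 1)) (lagr c)"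
    using lagr_sd_bounded[OF c(1) compact_cball convex_cball r(2) bounded_cball bounded_cball]
    unfolding sd_bounded_def by blast
  obtain lam where lam: "0 < lam" "\<And>x u. x \<in> cball x0 r \<Longrightarrow> lam * (norm u)\<^sup>2 \<le> G c x u u"
    using G_coercive[OF c(1) compact_cball r(2)] by blast
  define H where "H = 18 / \<epsilon>\<^sup>2"
  have H0: "0 \<le> H" by (simp add: H_def)
  have M0: "0 \<le> M" by (rule sd_boundD(1)[OF M])
  (* All constants depend only on \<epsilon> and on bounds over the whole neighbourhood, so \<delta> may be chosen last. *)
  define N1 where "N1 = 24 * H * R + 1"
  define N2 where "N2 = 4 * M + 36 * M * H\<^sup>2 + 1"
  have N: "0 < N1" "0 < N2" using H0 R(3) M0 by (auto simp: N1_def N2_def add_nonneg_pos)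
  define \<delta> where "\<delta> = min (min \<epsilon> (1 / N1)) (min (r / N1) ((lam / 4) / N2))"
  have \<delta>: "0 < \<delta>" "\<delta> \<le> \<epsilon>" "\<delta> \<le> 1 / N1" "\<delta> \<le> r / N1" "\<delta> \<le> (lam / 4) / N2"
    using \<epsilon> N r lam by (auto simp: \<delta>_def)
  have small: "24 * H * R * \<delta> \<le> 1" "24 * H * R * \<delta> \<le> r" "4 * M + 36 * M * H\<^sup>2 < (lam / 4) / \<delta>"
  proof -
    have "24 * H * R * \<delta> \<le> N1 * \<delta>" using \<delta>(1) by (simp add: N1_def algebra_simps)
    moreover have "N1 * \<delta> \<le> 1" "N1 * \<delta> \<le> r" using \<delta>(3,4) N(1) by (simp_all add: field_simps)
    ultimately show "24 * H * R * \<delta> \<le> 1" "24 * H * R * \<delta> \<le> r" by linarith+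
    have "N2 \<le> (lam / 4) / \<delta>" using \<delta>(1,5) N(2) by (simp add: field_simps)
    then show "4 * M + 36 * M * H\<^sup>2 < (lam / 4) / \<delta>" by (simp add: N2_def)
  qed
  define p where "p = T + \<sigma> * \<delta>"
  define p' where "p' = T - \<sigma> * \<epsilon>"
  define s where "s = min p p'"
  define e where "e = max p p'"
  have se: "s < T" "T < e" "p' = s \<and> p = e \<or> p' = e \<and> p = s" "?s \<le> s" "e \<le> ?e" "\<bar>T - p'\<bar> = \<epsilon>" "\<bar>T - p\<bar> = \<delta>"
    using \<sigma> \<epsilon>(1) \<delta>(1,2) by (auto simp: s_def e_def p_def p'_def)
  have sub: "{s..e} \<subseteq> {?s..?e}" "{s<..<e} - {T} \<subseteq> {?s<..<?e} - {T}" using se by auto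
  have aseb: "a \<le> s" "e \<le> b" using se \<epsilon> by auto
  have bx: "broken s T e x x1 x2" by (rule broken_subset[OF x(1) se(4,1,2,5)])
  have by': "broken s T e y y1 y2" by (rule broken_subset[OF y(1) se(4,1,2,5)])
  have min: "\<exists>I I'. ((\<lambda>t. lagr c (v t, v1 t, v2 t)) has_integral I) {s..e} \<and>
      ((\<lambda>t. lagr c (u t, u1 t, u2 t)) has_integral I') {s..e} \<and> I \<le> I'"
    if "minimizer a b \<xi> \<eta> \<gamma>" "\<And>t. t \<in> {?s..?e} \<Longrightarrow> \<gamma> t \<in> U" "v = chart_map c \<circ> \<gamma>" "broken s T e v v1 v2"
      "broken s T e u u1 u2" "u ` {s..e} \<subseteq> cball x0 r" "u s = v s" "u e = v e" "u1 s = v1 s" "u1 e = v1 e"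
    for \<gamma> v v1 v2 u u1 u2
  proof (rule minimizer_in_chart[OF that(1) aseb(1) se(1,2) aseb(2) c(1)])
    show "\<gamma> t \<in> chart_dom c" if "t \<in> {s..e}" for t
      using \<open>\<And>t. t \<in> {?s..?e} \<Longrightarrow> \<gamma> t \<in> U\<close>[of t] sub(1) that by (auto simp: U_def)
    show "chart_map c (\<gamma> t) = v t" for t by (simp add: that(3))
    show "u ` {s..e} \<subseteq> chart_img c" using that(6) r(2) by blast
  qed (use brokenD[OF that(4)] brokenD[OF that(5)] that(7-) in \<open>simp_all del: Ck_on.simps\<close>)
  have xy: "x t = y t" if t: "t \<in> {s..e}" for t
  proof (rule difference_vanishes[OF se(1,2,3,6) \<epsilon>(2) se(7) _ bx by' _ _ _ _ _ _ _ M _ _ _ _ H_def small t])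
    show "\<delta> \<le> 1" using \<delta>(2) \<epsilon>(2) by simp
    show "x t = y t" if "t \<in> closed_segment T p'" for t
    proof -
      have "t \<in> {a..b}" "0 \<le> - \<sigma> * (t - T)" "- \<sigma> * (t - T) \<le> \<epsilon>0"
        using that \<sigma> \<epsilon> by (auto simp: p'_def closed_segment_eq_real_ivl split: if_splits)
      then show ?thesis using agree by (simp add: x_def y_def)
    qed
    show "dist x0 (x t) \<le> r / 2" "dist x0 (y t) \<le> r / 2" if "t \<in> {s..e}" for t
      using qU[of t] sub(1) that by (auto simp: U_def x_def y_def)
    show "norm (x1 t) \<le> R" "norm (y1 t) \<le> R" if "t \<in> {s..e}" for t
      using x(3)[of t] y(3)[of t] sub(1) that R by fastforce+
    show "norm (x2 t) \<le> R" "norm (y2 t) \<le> R" if "t \<in> {s<..<e} - {T}" for t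
      using x(4)[of t] y(4)[of t] sub(2) that R by fastforce+
    show "0 < lam / 4" using lam by simp
    show "2 * lagr c (x, v, (1/2) *\<^sub>R (a + b)) - lagr c (x, v, a) - lagr c (x, v, b) \<le> - (lam / 4) * (norm (b - a))\<^sup>2"
      if "x \<in> cball x0 r" for x v a b
      by (rule lagr_strongly_convex[OF c(1)]) (use that r(2) lam(2) in auto)
  qed (rule min[OF q qU(1) x_def bx] min[OF q' qU(2) y_def by']; assumption)+
  show ?thesis
  proof (intro exI[of _ \<delta>] conjI ballI impI)
    fix t assume "t \<in> {a..b}" and t: "0 \<le> \<sigma> * (t - T) \<and> \<sigma> * (t - T) \<le> \<delta>"
    have ts: "t \<in> {s..e}" using t \<sigma> \<epsilon>(1) \<delta>(1) by (auto simp: s_def e_def p_def p'_def)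
    have "q t \<in> chart_dom c" "q' t \<in> chart_dom c" using qU[of t] ts sub(1) by (auto simp: U_def)
    then show "q t = q' t" using xy[OF ts] chart_inv_map[OF c(1)] unfolding x_def y_def o_def by metis
  qed (rule \<delta>(1))
qed

text \<open>
  Continuation to the left is continuation to the right in the parameter \<open>- t\<close>.
\<close>
lemma minimizers_unique:
  assumes q: "minimizer a b \<xi> \<eta> q" and q': "minimizer a b \<xi> \<eta> q'"
    and lm: "a \<le> l" "l < m" "m \<le> b" and eq: "\<And>t. t \<in> {l..m} \<Longrightarrow> q t = q' t" and t: "t \<in> {a..b}"
  shows "q t = q' t"
proof -
  have cont: "continuous_on {a..b} q" "continuous_on {a..b} q'"
    using q q' by (auto simp: global_minimizer_def admissible_curves_def piecewise_smooth_C1_iff Ck_curve_def)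
  have limit: "q T = q' T" if T: "T \<in> {a..b}" "J \<subseteq> {a..b}" "at T within J \<noteq> bot" "\<And>t. t \<in> J \<Longrightarrow> q t = q' t" for T J
  proof -
    have 1: "(q \<longlongrightarrow> q T) (at T within J)" "(q' \<longlongrightarrow> q' T) (at T within J)"
      using cont T(1,2) by (auto simp: continuous_on_def intro: tendsto_within_subset)
    have "eventually (\<lambda>t. q' t = q t) (at T within J)"
      using T(4) by (auto simp: eventually_at_filter)
    then have "(q \<longlongrightarrow> q' T) (at T within J)" using 1(2) tendsto_cong by blast
    then show ?thesis using tendsto_unique[OF T(3) 1(1)] by simp
  qed
  have right: "q t = q' t" if "t \<in> {l..b}" for t
  proof (rule continuation_right[OF lm(2,3) eq _ _ that])
    fix T assume T: "l < T" "T \<le> b" "\<And>t. t \<in> {l..<T} \<Longrightarrow> q t = q' t"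
    have nb: "at T within {l..<T} \<noteq> bot"
      using T(1) islimpt_greaterThanLessThan2[OF T(1)] islimpt_subset[of T "{l<..<T}" "{l..<T}"]
      by (auto simp: trivial_limit_within)
    show "q T = q' T" by (rule limit[OF _ _ nb T(3)]) (use T(1,2) lm in auto)
  next
    fix T assume T: "l < T" "T < b" "\<And>t. t \<in> {l..T} \<Longrightarrow> q t = q' t"
    have "\<exists>\<delta>>0. \<forall>t\<in>{a..b}. 0 \<le> 1 * (t - T) \<and> 1 * (t - T) \<le> \<delta> \<longrightarrow> q t = q' t"
      by (rule minimizers_agree_beyond[OF q q', of T 1 "T - l"]) (use T lm in auto)
    then show "\<exists>d>0. \<forall>t. T \<le> t \<and> t \<le> T + d \<and> t \<le> b \<longrightarrow> q t = q' t"
      using T lm by (smt (verit) atLeastAtMost_iff)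
  qed
  have left: "q (- t) = q' (- t)" if "t \<in> {- m..- a}" for t
  proof (rule continuation_right[where E = "\<lambda>t. q (- t) = q' (- t)" and m = "- l", OF _ _ _ _ _ that])
    fix T assume T: "- m < T" "T \<le> - a" "\<And>t. t \<in> {- m..<T} \<Longrightarrow> q (- t) = q' (- t)"
    have "at (- T) within {- T<..m} \<noteq> bot"
      using T(1) islimpt_greaterThanLessThan1[of "- T" m] islimpt_subset[of "- T" "{- T<..<m}" "{- T<..m}"]
      by (auto simp: trivial_limit_within)
    moreover have "q t = q' t" if "t \<in> {- T<..m}" for t using T(3)[of "- t"] that by auto
    ultimately show "q (- T) = q' (- T)" by (intro limit[of "- T" "{- T<..m}"]) (use T lm in auto)
  next
    fix T assume T: "- m < T" "T < - a" "\<And>t. t \<in> {- m..T} \<Longrightarrow> q (- t) = q' (- t)"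
    have eq: "q t = q' t" if "t \<in> {- T..m}" for t using T(3)[of "- t"] that by auto
    have "\<exists>\<delta>>0. \<forall>t\<in>{a..b}. 0 \<le> - 1 * (t - (- T)) \<and> - 1 * (t - (- T)) \<le> \<delta> \<longrightarrow> q t = q' t"
      by (rule minimizers_agree_beyond[OF q q', of "- T" "- 1" "m + T"]) (use T(1,2) eq lm in auto)
    then obtain d where d: "d > 0" "\<And>t. t \<in> {a..b} \<Longrightarrow> 0 \<le> - 1 * (t - (- T)) \<Longrightarrow> - 1 * (t - (- T)) \<le> d \<Longrightarrow> q t = q' t"
      by blast
    show "\<exists>d>0. \<forall>t. T \<le> t \<and> t \<le> T + d \<and> t \<le> - a \<longrightarrow> q (- t) = q' (- t)"
      using d(1) T lm by (intro exI[of _ d] conjI allI impI d(2)) auto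
  qed (use lm eq in auto)
  show ?thesis
    using right[of t] left[of "- t"] t lm by (cases "l \<le> t") auto
qed

text \<open>
  The inclusion is proper, so \<open>q\<close> and the splice of \<open>r\<close> into \<open>q\<close> share a nondegenerate interval at one
  of the two ends.
\<close>
lemma restricted_minimizer_unique:
  assumes q: "minimizer a b \<xi> \<eta> q"
    and sub: "s < e" "{s..e} \<subset> {a..b}"
    and r: "minimizer s e (q s, velocity A {a..b} q s) (q e, velocity A {a..b} q e) r"
  shows "r = restrict q {s..e}"
proof -
  have ord: "a \<le> s" "e \<le> b" "a < s \<or> e < b" using sub by (auto simp: psubset_eq)
  let ?\<sigma> = "splice_curve s e r q"
  have \<sigma>: "minimizer a b \<xi> \<eta> ?\<sigma>"
    by (rule minimizer_splice[OF q ord(1) sub(1) ord(2) r])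
  have radm: "r \<in> extensional {s..e}" "r s = q s" "r e = q e"
    using r by (auto simp: global_minimizer_def admissible_curves_def)
  have eq: "q t = ?\<sigma> t" if t: "t \<in> {a..b}" for t
  proof (cases "a < s")
    case True
    show ?thesis
      by (rule minimizers_unique[OF q \<sigma>, of a s]) (use True ord sub t radm in \<open>auto simp: splice_curve_def\<close>)
  next
    case False
    show ?thesis
      by (rule minimizers_unique[OF q \<sigma>, of e b]) (use False ord sub t radm in \<open>auto simp: splice_curve_def\<close>)
  qed
  have "r t = q t" if "t \<in> {s..e}" for t
    using eq[of t] that ord by (simp add: splice_curve_def)
  then show ?thesis
    by (intro extensionalityI[OF radm(1) restrict_extensional]) (simp add: restrict_def)
qed

end

theorem corollary1:
  fixes A :: "('q::{t2_space, second_countable_topology}, 'e::euclidean_space) chart set"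
    and g :: "('q, 'e) metric"
    and V :: "'q \<Rightarrow> real"
    and a b as bs :: real
    and \<xi> \<eta> \<mu> \<nu> :: "'q \<times> ('q, 'e) tangent"
    and q :: "real \<Rightarrow> 'q"
  assumes "smooth_atlas A"
    and "connected (UNIV :: 'q set)"
    and "riemannian_metric A g"
    and "geodesically_complete A g"
    and "smooth_function A V"
    and "\<And>p. V p \<ge> 0"
    and "a < b"
    and "\<xi> \<in> tangent_bundle A" and "\<eta> \<in> tangent_bundle A"
    and "global_minimizer A g V a b \<xi> \<eta> q"
    and "as < bs" and "{as..bs} \<subset> {a..b}"
    and "\<mu> = (q as, velocity A {a..b} q as)"
    and "\<nu> = (q bs, velocity A {a..b} q bs)"
  shows "global_minimizer A g V as bs \<mu> \<nu> (restrict q {as..bs}) \<and>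
    (\<forall>r. global_minimizer A g V as bs \<mu> \<nu> r \<longrightarrow> r = restrict q {as..bs})"
proof -
  interpret lagrangian A g V
    by unfold_locales (fact assms)+
  have "a \<le> as" "bs \<le> b" using assms(11,12) by (auto simp: psubset_eq)
  then show ?thesis
    unfolding assms(13,14)
    using minimizer_restrict[OF assms(10) _ assms(11)] restricted_minimizer_unique[OF assms(10-12)]
    by blast
qed

end
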